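(* Assume that there are real constants $\sigma^2>0$ and $\rho$ with $|\rho|<\sigma^2$ such that, for all $n\ge p-1$: (i) for every $k\in\mathbb{G}_{n+1}$, $\varepsilon_k\in L^2$, $\mathbb{E}[\varepsilon_k\mid\mathcal{F}_n]=0$ and $\mathbb{E}[\varepsilon_k^2\mid\mathcal{F}_n]=\sigma^2$ a.s.; (ii) for all different $k,l\in\mathbb{G}_{n+1}$, if $[k/2]=[l/2]$ then $\mathbb{E}[\varepsilon_k\varepsilon_l\mid\mathcal{F}_n]=\rho$ a.s., and otherwise $\varepsilon_k$ and $\varepsilon_l$ are conditionally independent given $\mathcal{F}_n$. Assume also that (iii) $\varepsilon_k\in L^4$ for all $k\in\mathbb{G}_{n+1}$, $n\ge p-1$, and $\sup_{n\ge p-1}\sup_{k\in\mathbb{G}_{n+1}}\mathbb{E}[\varepsilon_k^4\mid\mathcal{F}_n]<\infty$ a.s. Then $\widehat\sigma_n^2$ converges almost surely to $\sigma^2$; more precisely, $$\lim_{n\to\infty}\frac1n\sum_{k\in\mathbb{T}_{n-1,p}}\Big((\widehat\varepsilon_{2k}-\varepsilon_{2k})^2+(\widehat\varepsilon_{2k+1}-\varepsilon_{2k+1})^2\Big)=2(p+1)\sigma^2\quad\text{a.s.},$$ $$\lim_{n\to\infty}\frac{|\mathbb{T}_n|}{n}(\widehat\sigma_n^2-\sigma_n^2)=2(p+1)\sigma^2\quad\text{a.s.}$$ In addition, $\widehat\rho_n$ converges almost surely to $\rho$, and $$\lim_{n\to\infty}\frac1n\sum_{k\in\mathbb{T}_{n-1,p}}(\widehat\varepsilon_{2k}-\varepsilon_{2k})(\widehat\varepsilon_{2k+1}-\varepsilon_{2k+1})=(p+1)\rho\quad\text{a.s.},$$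 $$\lim_{n\to\infty}\frac{|\mathbb{T}_n|}{n}(\widehat\rho_n-\rho_n)=2(p+1)\rho\quad\text{a.s.}$$
   Context: Fix an integer $p\ge1$. For $n\ge0$ let $\mathbb{G}_n=\{2^n,\dots,2^{n+1}-1\}$, $\mathbb{T}_n=\bigcup_{k=0}^n\mathbb{G}_k$, and for an integer $q\geq 0$ let $\mathbb{T}_{n,q}=\{k\in\mathbb{T}_n:k\ge2^q\}$; $|E|$ denotes cardinality, so $|\mathbb{G}_n|=2^n$, $|\mathbb{T}_n|=2^{n+1}-1$. $[x]$ is the integer part of $x$. The asymmetric BAR($p$) process consists of real random variables $(X_n)_{n\ge1}$ and $(\varepsilon_n)_{n\ge2^p}$ such that for all $n\ge2^{p-1}$ $$X_{2n}=a_0+\sum_{k=1}^pa_kX_{[n/2^{k-1}]}+\varepsilon_{2n},\qquad X_{2n+1}=b_0+\sum_{k=1}^pb_kX_{[n/2^{k-1}]}+\varepsilon_{2n+1},$$ with real parameters $a_0,\dots,a_p,b_0,\dots,b_p$. The initial states satisfy $\mathbb{E}[X_k^8]<\infty$ for $1\le k\le2^p-1$. For $n\ge2^{p-1}$, $\mathbb{X}_n=(X_n,X_{[n/2]},\dots,X_{[n/2^{p-1}]})^t\in\mathbb{R}^p$. $A$ (resp. $B$) is the $p\times p$ companion matrix with first row $(a_1,\dots,a_p)$ (resp. $(b_1,\dots,b_p)$), ones on the subdiagonal and zeros elsewhere. It is assumed that $\beta=\max\{\|A\|,\|B\|\}<1$, where $\|A\|=\sup\{\|Au\|:u\in\mathbb{R}^p,\|u\|=1\}$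 is the operator norm induced by a norm on $\mathbb{R}^p$. $\mathcal{F}_n=\sigma\{X_k:k\in\mathbb{T}_n\}$. $Y_n=(1,\mathbb{X}_n^t)^t\in\mathbb{R}^{p+1}$, $Z_n=(X_{2n},X_{2n+1})^t$ and, for $n\ge p-1$, $S_n=\sum_{k\in\mathbb{T}_{n,p-1}}Y_kY_k^t$, with the convention that when $S_n$ is not invertible it is replaced by $S_n+I_{p+1}$. The least squares estimator is, for $n\ge p$, the $(p+1)\times2$ matrix $S_{n-1}^{-1}\sum_{k\in\mathbb{T}_{n-1,p-1}}Y_kZ_k^t$, whose first column is denoted $(\widehat a_{0,n},\dots,\widehat a_{p,n})^t$ and second column $(\widehat b_{0,n},\dots,\widehat b_{p,n})^t$; for $n=p-1$ these estimates are given an arbitrary fixed initial value. For all $n\ge p-1$ and $k\in\mathbb{G}_n$, $$\widehat\varepsilon_{2k}=X_{2k}-\widehat a_{0,n}-\sum_{i=1}^p\widehat a_{i,n}X_{[k/2^{i-1}]},\qquad\widehat\varepsilon_{2k+1}=X_{2k+1}-\widehat b_{0,n}-\sum_{i=1}^p\widehat b_{i,n}X_{[k/2^{i-1}]}.$$ (So the estimates used for $k$ are those indexed by the generation $n$ of $k$.) Define $$\widehat\sigma_n^2=\frac1{2|\mathbb{T}_{n-1}|}\sum_{k\in\mathbb{T}_{n-1,p-1}}(\widehat\varepsilon_{2k}^2+\widehat\varepsilon_{2k+1}^2),\qquad\widehat\rho_n=\frac1{|\mathbb{T}_{n-1}|}\sum_{k\in\mathbb{T}_{n-1,p-1}}\widehat\varepsilon_{2k}\widehat\varepsilon_{2k+1},$$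 $$\sigma_n^2=\frac1{2|\mathbb{T}_{n-1}|}\sum_{k\in\mathbb{T}_{n-1,p}}(\varepsilon_{2k}^2+\varepsilon_{2k+1}^2),\qquad\rho_n=\frac1{|\mathbb{T}_{n-1}|}\sum_{k\in\mathbb{T}_{n-1,p}}\varepsilon_{2k}\varepsilon_{2k+1}.$$
   Formalization: Conditional independence in (ii) is required jointly: given F_n, the sibling pairs (ε_{2k}, ε_{2k+1}), k in G_n, form a mutually independent family; with only pairwise independence of ε_k and ε_l the claim is false (ε_{2k}=δ_k, ε_{2k+1}=s_nδ_k with independent random signs). *)

theory Defs
  imports "HOL-Probability.Probability" "Jordan_Normal_Form.Gauss_Jordan_Elimination"
begin

text \<open>Vectors and matrices are those of the Jordan normal form entry, indexed from 0 and of a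
  dimension that is an ordinary natural number; \<open>$\<close> is their indexing operator.\<close>

unbundle no vec_syntax

section \<open>The binary tree\<close>

definition gen_set :: "nat \<Rightarrow> nat set" where
  "gen_set n = {2 ^ n .. 2 ^ (n + 1) - 1}"

definition tree :: "nat \<Rightarrow> nat set" where
  "tree n = (\<Union>k\<le>n. gen_set k)"

definition tree_from :: "nat \<Rightarrow> nat \<Rightarrow> nat set" where
  "tree_from n q = {k \<in> tree n. k \<ge> 2 ^ q}"

text \<open>The sets \<open>gen_set n\<close> partition the positive integers, so \<open>generation k\<close> is determined for
  every \<open>k \<ge> 1\<close>.\<close>

definition generation :: "nat \<Rightarrow> nat" where
  "generation k = (THE n. k \<in> gen_set n)"

section \<open>Conditioning\<close>

definition sigma_X :: "'a measure \<Rightarrow> (nat \<Rightarrow> 'a \<Rightarrow> real) \<Rightarrow> nat \<Rightarrow> 'a measure" where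
  "sigma_X M X n =
     sigma (space M) {X k -` B \<inter> space M | k B. k \<in> tree n \<and> B \<in> sets borel}"

definition cond_indep_vars ::
    "'a measure \<Rightarrow> 'a measure \<Rightarrow> 'b measure \<Rightarrow> ('i \<Rightarrow> 'a \<Rightarrow> 'b) \<Rightarrow> 'i set \<Rightarrow> bool" where
  "cond_indep_vars M F N U I \<longleftrightarrow>
     (\<forall>J B. J \<subseteq> I \<longrightarrow> finite J \<longrightarrow> J \<noteq> {} \<longrightarrow> (\<forall>i\<in>J. B i \<in> sets N) \<longrightarrow>
        (AE \<omega> in M.
           real_cond_exp M F (indicator (\<Inter>i\<in>J. U i -` B i \<inter> space M)) \<omega> =
           (\<Prod>i\<in>J. real_cond_exp M F (indicator (U i -` B i \<inter> space M)) \<omega>)))"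

text \<open>Conditional independence of innovations with different mothers is understood of the whole
  generation: the sibling pairs \<open>(\<epsilon>\<^bsub>2k\<^esub>, \<epsilon>\<^bsub>2k+1\<^esub>)\<close> with \<open>k\<close> in generation \<open>n\<close> form a conditionally
  independent family. Requiring it only of each two innovations \<open>\<epsilon>\<^sub>k\<close>, \<open>\<epsilon>\<^sub>l\<close> with different mothers
  would not do: take \<open>p = 1\<close>, null parameters, independent uniform signs \<open>\<delta>\<^sub>k\<close>, \<open>s\<^sub>n\<close>, and
  \<open>\<epsilon>\<^bsub>2k\<^esub> = \<delta>\<^sub>k\<close>, \<open>\<epsilon>\<^bsub>2k+1\<^esub> = s\<^sub>n \<delta>\<^sub>k\<close> for \<open>k\<close> in generation \<open>n\<close>. Then \<open>\<rho> = 0\<close>, but the empirical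
  covariance \<open>\<rho>\<^sub>n\<close> is \<open>s\<^bsub>n-1\<^esub>/2 + s\<^bsub>n-2\<^esub>/4 + \<dots>\<close> up to \<open>o(1)\<close> and has no limit.\<close>

definition siblings :: "(nat \<Rightarrow> 'a \<Rightarrow> real) \<Rightarrow> nat \<Rightarrow> 'a \<Rightarrow> real \<times> real" where
  "siblings eps k \<omega> = (eps (2 * k) \<omega>, eps (2 * k + 1) \<omega>)"

section \<open>Companion matrices and induced norms\<close>

definition companion :: "nat \<Rightarrow> (nat \<Rightarrow> real) \<Rightarrow> real mat" where
  "companion p c =
     Matrix.mat p p (\<lambda>(i, j). if i = 0 then c (j + 1) else if i = j + 1 then 1 else 0)"

definition is_norm :: "nat \<Rightarrow> (real Matrix.vec \<Rightarrow> real) \<Rightarrow> bool" where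
  "is_norm p N \<longleftrightarrow>
     (\<forall>u \<in> carrier_vec p. N u \<ge> 0 \<and> (N u = 0 \<longleftrightarrow> u = 0\<^sub>v p)) \<and>
     (\<forall>u \<in> carrier_vec p. \<forall>c. N (c \<cdot>\<^sub>v u) = \<bar>c\<bar> * N u) \<and>
     (\<forall>u \<in> carrier_vec p. \<forall>v \<in> carrier_vec p. N (u + v) \<le> N u + N v)"

definition op_norm :: "nat \<Rightarrow> (real Matrix.vec \<Rightarrow> real) \<Rightarrow> real mat \<Rightarrow> real" where
  "op_norm p N A = (SUP u \<in> {u \<in> carrier_vec p. N u = 1}. N (A *\<^sub>v u))"

section \<open>Least squares estimation\<close>

definition XX :: "nat \<Rightarrow> (nat \<Rightarrow> 'a \<Rightarrow> real) \<Rightarrow> nat \<Rightarrow> 'a \<Rightarrow> real Matrix.vec" where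
  "XX p X n \<omega> = Matrix.vec p (\<lambda>i. X (n div 2 ^ i) \<omega>)"

definition YY :: "nat \<Rightarrow> (nat \<Rightarrow> 'a \<Rightarrow> real) \<Rightarrow> nat \<Rightarrow> 'a \<Rightarrow> real Matrix.vec" where
  "YY p X n \<omega> = vCons 1 (XX p X n \<omega>)"

definition ZZ :: "(nat \<Rightarrow> 'a \<Rightarrow> real) \<Rightarrow> nat \<Rightarrow> 'a \<Rightarrow> real Matrix.vec" where
  "ZZ X n \<omega> = vec_of_list [X (2 * n) \<omega>, X (2 * n + 1) \<omega>]"

text \<open>The \<open>d \<times> e\<close> matrix \<open>\<Sum>k\<in>K. u\<^sub>k v\<^sub>k\<^sup>t\<close>, written out entrywise because matrices of varying
  dimension do not form a type with a zero.\<close>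

definition sum_outer ::
    "nat \<Rightarrow> nat \<Rightarrow> nat set \<Rightarrow> (nat \<Rightarrow> real Matrix.vec) \<Rightarrow> (nat \<Rightarrow> real Matrix.vec) \<Rightarrow> real mat" where
  "sum_outer d e K u v = Matrix.mat d e (\<lambda>(i, j). \<Sum>k\<in>K. u k $ i * v k $ j)"

definition S_mat :: "nat \<Rightarrow> (nat \<Rightarrow> 'a \<Rightarrow> real) \<Rightarrow> nat \<Rightarrow> 'a \<Rightarrow> real mat" where
  "S_mat p X n \<omega> =
     (let S = sum_outer (p + 1) (p + 1) (tree_from n (p - 1)) (\<lambda>k. YY p X k \<omega>) (\<lambda>k. YY p X k \<omega>)
      in if invertible_mat S then S else S + 1\<^sub>m (p + 1))"

text \<open>Column 0 holds the estimates of \<open>a\<^sub>0, \<dots>, a\<^sub>p\<close>, column 1 those of \<open>b\<^sub>0, \<dots>, b\<^sub>p\<close>. The matrix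
  \<open>init\<close> is the arbitrary initial value at \<open>n = p - 1\<close>. As \<open>S_mat\<close> is always invertible,
  \<open>mat_inverse\<close> is never \<open>None\<close> here.\<close>

definition theta_hat ::
    "nat \<Rightarrow> real mat \<Rightarrow> (nat \<Rightarrow> 'a \<Rightarrow> real) \<Rightarrow> nat \<Rightarrow> 'a \<Rightarrow> real mat" where
  "theta_hat p init X n \<omega> =
     (if n \<ge> p
      then the (mat_inverse (S_mat p X (n - 1) \<omega>)) *
           sum_outer (p + 1) 2 (tree_from (n - 1) (p - 1)) (\<lambda>k. YY p X k \<omega>) (\<lambda>k. ZZ X k \<omega>)
      else init)"

text \<open>The residual of index \<open>m = 2 k\<close> uses the column 0, that of index \<open>m = 2 k + 1\<close> the column 1,
  of the estimate indexed by the generation of \<open>k\<close>, not of \<open>m\<close>.\<close>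

definition eps_hat ::
    "nat \<Rightarrow> real mat \<Rightarrow> (nat \<Rightarrow> 'a \<Rightarrow> real) \<Rightarrow> nat \<Rightarrow> 'a \<Rightarrow> real" where
  "eps_hat p init X m \<omega> =
     (let k = m div 2; c = m mod 2; \<theta> = theta_hat p init X (generation k) \<omega>
      in X m \<omega> - \<theta> $$ (0, c) - (\<Sum>i=1..p. \<theta> $$ (i, c) * X (k div 2 ^ (i - 1)) \<omega>))"

text \<open>The four quantities below are meant for \<open>n \<ge> 1\<close>: at \<open>n = 0\<close>, \<open>n - 1\<close> is truncated.\<close>

definition sigma2_hat ::
    "nat \<Rightarrow> real mat \<Rightarrow> (nat \<Rightarrow> 'a \<Rightarrow> real) \<Rightarrow> nat \<Rightarrow> 'a \<Rightarrow> real" where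
  "sigma2_hat p init X n \<omega> =
     1 / (2 * real (card (tree (n - 1)))) *
     (\<Sum>k\<in>tree_from (n - 1) (p - 1).
        (eps_hat p init X (2 * k) \<omega>)\<^sup>2 + (eps_hat p init X (2 * k + 1) \<omega>)\<^sup>2)"

definition rho_hat ::
    "nat \<Rightarrow> real mat \<Rightarrow> (nat \<Rightarrow> 'a \<Rightarrow> real) \<Rightarrow> nat \<Rightarrow> 'a \<Rightarrow> real" where
  "rho_hat p init X n \<omega> =
     1 / real (card (tree (n - 1))) *
     (\<Sum>k\<in>tree_from (n - 1) (p - 1).
        eps_hat p init X (2 * k) \<omega> * eps_hat p init X (2 * k + 1) \<omega>)"

definition sigma2_emp :: "nat \<Rightarrow> (nat \<Rightarrow> 'a \<Rightarrow> real) \<Rightarrow> nat \<Rightarrow> 'a \<Rightarrow> real" where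
  "sigma2_emp p eps n \<omega> =
     1 / (2 * real (card (tree (n - 1)))) *
     (\<Sum>k\<in>tree_from (n - 1) p. (eps (2 * k) \<omega>)\<^sup>2 + (eps (2 * k + 1) \<omega>)\<^sup>2)"

definition rho_emp :: "nat \<Rightarrow> (nat \<Rightarrow> 'a \<Rightarrow> real) \<Rightarrow> nat \<Rightarrow> 'a \<Rightarrow> real" where
  "rho_emp p eps n \<omega> =
     1 / real (card (tree (n - 1))) *
     (\<Sum>k\<in>tree_from (n - 1) p. eps (2 * k) \<omega> * eps (2 * k + 1) \<omega>)"

end

theory Submission
  imports Defs "Jordan_Normal_Form.Determinant" "HOL-Library.Landau_Symbols"
    "HOL-Real_Asymp.Real_Asymp"
begin

text \<open>Let \<open>\<H>\<^sub>k\<close> be generated by the \<open>X\<^sub>j\<close> with \<open>j < 2 k\<close>. Conditional independence within the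
  generations makes \<open>\<epsilon>\<^bsub>2k\<^esub>\<close>, \<open>\<epsilon>\<^bsub>2k+1\<^esub>\<close> and their centred products martingale differences for this
  filtration, indexed by the mothers \<open>k\<close>, so that every law of large numbers is an instance of the
  convergence of \<open>\<Sum>c\<^sub>k \<eta>\<^sub>k\<close> on the event \<open>\<Sum>c\<^sub>k\<^sup>2 < \<infinity>\<close>, for predictable \<open>c\<close> and differences \<open>\<eta>\<close> with
  bounded conditional variances.

  The first and second empirical moments of a generation satisfy affine recursions up to \<open>o(1)\<close>,
  which are contractions when tested against the dual unit ball of the norm. Hence
  \<open>2\<^bsup>-l\<^esup> \<Sum>Y\<^sub>k Y\<^sub>k\<^sup>t\<close> over generation \<open>l\<close> has a limit \<open>L\<close>, and \<open>L\<close> is positive definite because the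
  innovation enters the newest coordinate of \<open>Y\<close>.

  Let \<open>S\<^sub>l\<close> be the martingale \<open>\<Sum>Y\<^sub>k \<epsilon>\<^bsub>2k+i\<^esub>\<close> before generation \<open>l\<close> and \<open>D\<^sub>l\<close> its increment. The means over \<open>l\<close>
  of \<open>2\<^bsup>-l\<^esup> D\<^sub>l D\<^sub>l\<^sup>t\<close> converge to \<open>\<Gamma> L\<close> and those of \<open>2\<^bsup>-l\<^esup> S\<^sub>l D\<^sub>l\<^sup>t\<close> to \<open>0\<close>; since \<open>2\<^bsup>-l\<^esup>\<close> halves at every step,
  the means of \<open>2\<^bsup>-l\<^esup> S\<^sub>l S\<^sub>l\<^sup>t\<close> then converge to \<open>\<Gamma> L\<close> as well. The error of the estimator is
  \<open>2\<^bsup>-l\<^esup> L\<^sup>-\<^sup>1 S\<^sub>l\<close> up to a factor \<open>1 + o(1)\<close>, so the squared prediction errors have mean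
  \<open>\<Gamma> tr (L\<^sup>-\<^sup>1 L) = (p + 1) \<Gamma>\<close> per generation, and the cross terms with the innovations vanish.\<close>

section \<open>Means and contractions of sequences\<close>

text \<open>Two obstacles shape the argument. The two daughters follow different companion matrices,
  so the empirical mean of a linear functional is expressed through two other functionals at the
  previous generation, and no recursion closes on a single one; the dual ball is iterated as a
  whole, in the supremum norm. And the bound on the conditional fourth moments is random, so only
  second moments of the process are controlled uniformly over the tree; the quadratic terms are
  estimated on events where empirical second moments are bounded. The limit \<open>L\<close> is
  never computed: the estimator supplies its inverse, the squared prediction error supplies
  \<open>L\<close>, and \<open>p + 1\<close> is the trace of the identity. The factor 2 in the rates
  normalised by \<open>card (tree n)\<close> has another origin: the estimators divide by
  \<open>card (tree (n - 1))\<close>, about half as much. Consistency is read off from these rates,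
  once the empirical quantities of the true innovations are known to converge.\<close>

lemma cesaro_mean_zero:
  fixes u :: "nat \<Rightarrow> real"
  assumes "u \<longlonglongrightarrow> 0"
  shows "(\<lambda>n. (\<Sum>l<n. u l) / real n) \<longlonglongrightarrow> 0"
proof (rule LIMSEQ_I)
  fix e :: real assume e: "0 < e"
  obtain N where N: "\<And>l. l \<ge> N \<Longrightarrow> \<bar>u l\<bar> < e / 2"
    using LIMSEQ_D[OF assms, of "e/2"] e by auto
  define C where "C = (\<Sum>l<N. \<bar>u l\<bar>)"
  have C: "0 \<le> C" by (simp add: C_def)
  have b: "\<bar>\<Sum>l<n. u l\<bar> \<le> C + real n * (e / 2)" for n
  proof -
    have "\<bar>\<Sum>l<n. u l\<bar> \<le> (\<Sum>l<n. \<bar>u l\<bar>)" by (rule sum_abs)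
    also have "\<dots> \<le> (\<Sum>l<n. (if l < N then \<bar>u l\<bar> else 0) + e / 2)"
      using N e by (intro sum_mono) (force simp: not_less intro: less_imp_le)
    also have "\<dots> = (\<Sum>l<n. (if l < N then \<bar>u l\<bar> else 0)) + real n * (e / 2)"
      by (simp add: sum.distrib)
    also have "(\<Sum>l<n. (if l < N then \<bar>u l\<bar> else 0)) \<le> C"
      unfolding C_def by (subst sum.inter_filter[symmetric]) (auto intro!: sum_mono2)
    finally show ?thesis by simp
  qed
  obtain K :: nat where K: "2 * C / e < real K" using reals_Archimedean2 by blast
  show "\<exists>no. \<forall>n\<ge>no. norm ((\<Sum>l<n. u l) / real n - 0) < e"
  proof (intro exI[of _ "Suc K"] allI impI)
    fix n assume n: "Suc K \<le> n"
    then have "2 * C / e < real n" using K by linarith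
    then have "C < real n * (e / 2)" using e by (simp add: field_simps)
    then have "\<bar>\<Sum>l<n. u l\<bar> < real n * e" using b[of n] by linarith
    then show "norm ((\<Sum>l<n. u l) / real n - 0) < e"
      using n by (simp add: field_simps)
  qed
qed

lemma cesaro_mean:
  fixes u :: "nat \<Rightarrow> real"
  assumes "u \<longlonglongrightarrow> c"
  shows "(\<lambda>n. (\<Sum>l<n. u l) / real n) \<longlonglongrightarrow> c"
proof -
  have "(\<lambda>n. (\<Sum>l<n. u l - c) / real n) \<longlonglongrightarrow> 0"
    by (rule cesaro_mean_zero) (use assms in \<open>simp add: LIM_zero\<close>)
  then have "(\<lambda>n. (\<Sum>l<n. u l - c) / real n + c) \<longlonglongrightarrow> 0 + c" by (intro tendsto_add tendsto_const)
  moreover have "\<forall>\<^sub>F n in sequentially. (\<Sum>l<n. u l - c) / real n + c = (\<Sum>l<n. u l) / real n"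
    using eventually_gt_at_top[of 0] by eventually_elim (simp add: sum_subtractf field_simps)
  ultimately show ?thesis using Lim_transform_eventually by fastforce
qed

text \<open>Kronecker's lemma for the weights \<open>Suc l\<close>. Abel summation writes the mean
  of \<open>x\<close> as \<open>s n\<close> minus the mean of the earlier \<open>s l\<close>, and
  both tend to the sum of the series.\<close>

lemma kronecker_cesaro:
  fixes x :: "nat \<Rightarrow> real"
  assumes "summable (\<lambda>l. x l / real (Suc l))"
  shows "(\<lambda>n. (\<Sum>l<n. x l) / real n) \<longlonglongrightarrow> 0"
proof -
  define s where "s n = (\<Sum>l<n. x l / real (Suc l))" for n
  obtain c where c: "s \<longlonglongrightarrow> c"
    using summable_LIMSEQ[OF assms] unfolding s_def by blast
  have eq: "(\<Sum>l<n. x l) = real n * s n - (\<Sum>l<n. s l)" for n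
  proof (induction n)
    case (Suc n)
    have "s (Suc n) = s n + x n / real (Suc n)" by (simp add: s_def)
    then have "real (Suc n) * s (Suc n) = real (Suc n) * s n + x n" by (simp add: distrib_left)
    then show ?case using Suc by (simp add: algebra_simps)
  qed simp
  have "(\<lambda>n. s n - (\<Sum>l<n. s l) / real n) \<longlonglongrightarrow> c - c"
    by (intro tendsto_diff c cesaro_mean)
  moreover have "\<forall>\<^sub>F n in sequentially. s n - (\<Sum>l<n. s l) / real n = (\<Sum>l<n. x l) / real n"
    using eventually_gt_at_top[of 0] by eventually_elim (simp add: eq field_simps)
  ultimately show ?thesis using Lim_transform_eventually by fastforce
qed

lemma perturbed_contraction_tendsto_zero:
  fixes z e :: "nat \<Rightarrow> real"
  assumes step: "\<And>n. \<bar>z (Suc n)\<bar> \<le> \<theta> * \<bar>z n\<bar> + e n" and \<theta>: "0 \<le> \<theta>" "\<theta> < 1" and e: "e \<longlonglongrightarrow> 0"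
  shows "z \<longlonglongrightarrow> 0"
proof (rule LIMSEQ_I)
  fix d :: real assume d: "0 < d"
  \<comment> \<open>\<open>d / 2\<close> is the fixed point of
    \<open>t = \<theta> * t + (1 - \<theta>) * (d / 2)\<close>, so perturbations below
    \<open>(1 - \<theta>) * (d / 2)\<close> leave a geometric term plus
    \<open>d / 2\<close>.\<close>
  then have "0 < (1 - \<theta>) * (d / 2)" using \<theta> by simp
  from LIMSEQ_D[OF e this] obtain N where N: "\<And>n. n \<ge> N \<Longrightarrow> \<bar>e n\<bar> < (1 - \<theta>) * (d / 2)" by auto
  have ind: "\<bar>z (N + k)\<bar> \<le> \<theta> ^ k * \<bar>z N\<bar> + d / 2" for k
  proof (induction k)
    case (Suc k)
    have "\<bar>z (N + Suc k)\<bar> \<le> \<theta> * \<bar>z (N + k)\<bar> + (1 - \<theta>) * (d / 2)"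
      using step[of "N + k"] N[of "N + k"] by simp
    also have "\<dots> \<le> \<theta> * (\<theta> ^ k * \<bar>z N\<bar> + d / 2) + (1 - \<theta>) * (d / 2)"
      using Suc \<theta> by (intro add_right_mono mult_left_mono) auto
    finally show ?case by (simp add: field_simps)
  qed (use d in simp)
  have "(\<lambda>k. \<theta> ^ k * \<bar>z N\<bar>) \<longlonglongrightarrow> 0"
    using LIMSEQ_realpow_zero[OF \<theta>] tendsto_mult_left_zero by blast
  from LIMSEQ_D[OF this, of "d/2"] d obtain K where K: "\<And>k. k \<ge> K \<Longrightarrow> \<bar>\<theta> ^ k * \<bar>z N\<bar>\<bar> < d / 2" by auto
  show "\<exists>no. \<forall>n\<ge>no. norm (z n - 0) < d"
  proof (intro exI[of _ "N + K"] allI impI)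
    fix n assume "N + K \<le> n"
    define k where "k = n - N"
    have k: "n = N + k" "K \<le> k" using \<open>N + K \<le> n\<close> by (auto simp: k_def)
    then show "norm (z n - 0) < d" using ind[of k] K[of k] by simp
  qed
qed

text \<open>Convergence at a single \<open>f\<close> does not pass through a recursion that relates
  \<open>q (Suc n) f\<close> to \<open>q n\<close> at other points of \<open>F\<close>; uniform
  Cauchy bounds do, and no limit has to be named. Boundedness is included to make the class stable
  under products.\<close>

definition unif_Cauchy_bdd :: "'f set \<Rightarrow> (nat \<Rightarrow> 'f \<Rightarrow> real) \<Rightarrow> bool" where
  "unif_Cauchy_bdd F q \<longleftrightarrow> (\<exists>C. \<forall>n. \<forall>f\<in>F. \<bar>q n f\<bar> \<le> C) \<and>
     (\<forall>e>0. \<exists>N. \<forall>m\<ge>N. \<forall>n\<ge>N. \<forall>f\<in>F. \<bar>q m f - q n f\<bar> \<le> e)"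

lemma unif_Cauchy_bdd_bound:
  assumes "unif_Cauchy_bdd F q"
  obtains C where "\<And>n f. f \<in> F \<Longrightarrow> \<bar>q n f\<bar> \<le> C"
proof -
  from assms obtain C where "\<forall>n. \<forall>f\<in>F. \<bar>q n f\<bar> \<le> C" unfolding unif_Cauchy_bdd_def by (elim conjE exE)
  then show ?thesis by (intro that) blast
qed

lemma unif_Cauchy_bdd_Cauchy:
  assumes "unif_Cauchy_bdd F q" "0 < e"
  obtains N where "\<And>m n f. m \<ge> N \<Longrightarrow> n \<ge> N \<Longrightarrow> f \<in> F \<Longrightarrow> \<bar>q m f - q n f\<bar> \<le> e"
proof -
  from assms(1) have "\<forall>e>0. \<exists>N. \<forall>m\<ge>N. \<forall>n\<ge>N. \<forall>f\<in>F. \<bar>q m f - q n f\<bar> \<le> e"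
    unfolding unif_Cauchy_bdd_def by (elim conjE)
  with assms(2) obtain N where "\<forall>m\<ge>N. \<forall>n\<ge>N. \<forall>f\<in>F. \<bar>q m f - q n f\<bar> \<le> e" by blast
  then show ?thesis by (intro that) blast
qed

lemma unif_Cauchy_bdd_const:
  assumes "\<And>f. f \<in> F \<Longrightarrow> \<bar>c f\<bar> \<le> C"
  shows "unif_Cauchy_bdd F (\<lambda>n. c)"
proof -
  have "\<forall>n::nat. \<forall>f\<in>F. \<bar>c f\<bar> \<le> C" using assms by blast
  then show ?thesis unfolding unif_Cauchy_bdd_def by auto
qed

lemma unif_Cauchy_bdd_seq:
  assumes "convergent s"
  shows "unif_Cauchy_bdd F (\<lambda>n f. s n)"
proof -
  have "Bseq s" "Cauchy s" using assms by (simp_all add: convergent_imp_Bseq convergent_Cauchy)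
  then show ?thesis unfolding unif_Cauchy_bdd_def Bseq_def Cauchy_def dist_real_def
    by (auto simp: less_imp_le) (meson less_imp_le)
qed

lemma unif_Cauchy_bdd_compose:
  assumes "unif_Cauchy_bdd F q" "\<And>f. f \<in> F' \<Longrightarrow> g f \<in> F"
  shows "unif_Cauchy_bdd F' (\<lambda>n f. q n (g f))"
proof -
  obtain C where "\<And>n f. f \<in> F \<Longrightarrow> \<bar>q n f\<bar> \<le> C" using unif_Cauchy_bdd_bound[OF assms(1)] by blast
  moreover have "\<exists>N. \<forall>m\<ge>N. \<forall>n\<ge>N. \<forall>f\<in>F. \<bar>q m f - q n f\<bar> \<le> e" if "e > 0" for e
    using assms(1) that unfolding unif_Cauchy_bdd_def by blast
  ultimately show ?thesis unfolding unif_Cauchy_bdd_def by (meson assms(2))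
qed

lemma unif_Cauchy_bdd_add:
  assumes "unif_Cauchy_bdd F q" "unif_Cauchy_bdd F r"
  shows "unif_Cauchy_bdd F (\<lambda>n f. q n f + r n f)"
proof -
  obtain C where C: "\<And>n f. f \<in> F \<Longrightarrow> \<bar>q n f\<bar> \<le> C" using unif_Cauchy_bdd_bound[OF assms(1)] by blast
  obtain D where D: "\<And>n f. f \<in> F \<Longrightarrow> \<bar>r n f\<bar> \<le> D" using unif_Cauchy_bdd_bound[OF assms(2)] by blast
  have "\<exists>N. \<forall>m\<ge>N. \<forall>n\<ge>N. \<forall>f\<in>F. \<bar>(q m f + r m f) - (q n f + r n f)\<bar> \<le> e" if "e > 0" for e
  proof -
    obtain N1 where 1: "\<And>m n f. m \<ge> N1 \<Longrightarrow> n \<ge> N1 \<Longrightarrow> f \<in> F \<Longrightarrow> \<bar>q m f - q n f\<bar> \<le> e / 2"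
      using unif_Cauchy_bdd_Cauchy[OF assms(1), of "e / 2"] \<open>e > 0\<close> half_gt_zero by blast
    obtain N2 where 2: "\<And>m n f. m \<ge> N2 \<Longrightarrow> n \<ge> N2 \<Longrightarrow> f \<in> F \<Longrightarrow> \<bar>r m f - r n f\<bar> \<le> e / 2"
      using unif_Cauchy_bdd_Cauchy[OF assms(2), of "e / 2"] \<open>e > 0\<close> half_gt_zero by blast
    show ?thesis
    proof (intro exI[of _ "max N1 N2"] allI impI ballI)
      fix m n f assume "max N1 N2 \<le> m" "max N1 N2 \<le> n" "f \<in> F"
      then have "\<bar>q m f - q n f\<bar> + \<bar>r m f - r n f\<bar> \<le> e / 2 + e / 2" by (intro add_mono 1 2) auto
      then show "\<bar>(q m f + r m f) - (q n f + r n f)\<bar> \<le> e"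
        using abs_triangle_ineq[of "q m f - q n f" "r m f - r n f"] by (simp add: algebra_simps)
    qed
  qed
  moreover have "\<bar>q n f + r n f\<bar> \<le> C + D" if "f \<in> F" for n f using C[of f n] D[of f n] that by linarith
  ultimately show ?thesis unfolding unif_Cauchy_bdd_def by blast
qed

lemma unif_Cauchy_bdd_mult:
  assumes "unif_Cauchy_bdd F q" "unif_Cauchy_bdd F r"
  shows "unif_Cauchy_bdd F (\<lambda>n f. q n f * r n f)"
proof -
  obtain C0 where "\<And>n f. f \<in> F \<Longrightarrow> \<bar>q n f\<bar> \<le> C0" using unif_Cauchy_bdd_bound[OF assms(1)] by blast
  moreover obtain D0 where "\<And>n f. f \<in> F \<Longrightarrow> \<bar>r n f\<bar> \<le> D0" using unif_Cauchy_bdd_bound[OF assms(2)] by blast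
  moreover define C where "C = max 1 (max C0 D0)"
  ultimately have C: "\<And>n f. f \<in> F \<Longrightarrow> \<bar>q n f\<bar> \<le> C" "\<And>n f. f \<in> F \<Longrightarrow> \<bar>r n f\<bar> \<le> C" "0 < C"
    unfolding C_def by (fastforce simp: le_max_iff_disj)+
  have "\<exists>N. \<forall>m\<ge>N. \<forall>n\<ge>N. \<forall>f\<in>F. \<bar>q m f * r m f - q n f * r n f\<bar> \<le> e" if "e > 0" for e
  proof -
    define d where "d = e / (2 * C)"
    have d: "0 < d" "d * C = e / 2" using that C(3) by (auto simp: d_def)
    obtain N1 where 1: "\<And>m n f. m \<ge> N1 \<Longrightarrow> n \<ge> N1 \<Longrightarrow> f \<in> F \<Longrightarrow> \<bar>q m f - q n f\<bar> \<le> d"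
      using unif_Cauchy_bdd_Cauchy[OF assms(1) d(1)] by blast
    obtain N2 where 2: "\<And>m n f. m \<ge> N2 \<Longrightarrow> n \<ge> N2 \<Longrightarrow> f \<in> F \<Longrightarrow> \<bar>r m f - r n f\<bar> \<le> d"
      using unif_Cauchy_bdd_Cauchy[OF assms(2) d(1)] by blast
    show ?thesis
    proof (intro exI[of _ "max N1 N2"] allI impI ballI)
      fix m n f assume a: "max N1 N2 \<le> m" "max N1 N2 \<le> n" "f \<in> F"
      have "q m f * r m f - q n f * r n f = (q m f - q n f) * r m f + (r m f - r n f) * q n f"
        by (simp add: algebra_simps)
      also have "\<bar>\<dots>\<bar> \<le> \<bar>q m f - q n f\<bar> * \<bar>r m f\<bar> + \<bar>r m f - r n f\<bar> * \<bar>q n f\<bar>"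
        by (metis abs_mult abs_triangle_ineq)
      also have "\<dots> \<le> d * C + d * C"
        using 1[of m n f] 2[of m n f] C a d by (intro add_mono mult_mono) auto
      finally show "\<bar>q m f * r m f - q n f * r n f\<bar> \<le> e" using d by simp
    qed
  qed
  moreover have "\<bar>q n f * r n f\<bar> \<le> C * C" if "f \<in> F" for n f
    unfolding abs_mult using C that by (intro mult_mono) auto
  ultimately show ?thesis unfolding unif_Cauchy_bdd_def by blast
qed

lemma unif_Cauchy_bdd_sum:
  assumes "finite I" "\<And>i. i \<in> I \<Longrightarrow> unif_Cauchy_bdd F (q i)"
  shows "unif_Cauchy_bdd F (\<lambda>n f. \<Sum>i\<in>I. q i n f)"
  using assms
proof (induction I rule: finite_induct)
  case empty then show ?case using unif_Cauchy_bdd_const[of F "\<lambda>_. 0" 0] by simp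
next
  case (insert i I) then show ?case by (auto intro!: unif_Cauchy_bdd_add)
qed

lemma unif_Cauchy_bdd_convergent:
  assumes "unif_Cauchy_bdd F q" "f \<in> F"
  shows "convergent (\<lambda>n. q n f)"
proof (rule Cauchy_convergent, rule metric_CauchyI)
  fix e :: real assume e: "0 < e"
  then have "0 < e / 2" by simp
  moreover have "\<forall>e>0. \<exists>N. \<forall>m\<ge>N. \<forall>n\<ge>N. \<forall>f\<in>F. \<bar>q m f - q n f\<bar> \<le> e"
    using assms(1) unfolding unif_Cauchy_bdd_def by (elim conjE)
  ultimately obtain N where "\<forall>m\<ge>N. \<forall>n\<ge>N. \<forall>f\<in>F. \<bar>q m f - q n f\<bar> \<le> e / 2" by blast
  then have "\<bar>q m f - q n f\<bar> \<le> e / 2" if "m \<ge> N" "n \<ge> N" for m n using that assms(2) by blast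
  then show "\<exists>M. \<forall>m\<ge>M. \<forall>n\<ge>M. dist (q m f) (q n f) < e"
    using e by (intro exI[of _ N]) (fastforce simp: dist_real_def)
qed

text \<open>One step replaces \<open>f\<close> by \<open>g f\<close> and \<open>h f\<close>, so it
  is the supremum over \<open>F\<close> of the differences that contracts by
  \<open>\<theta>\<close>. Going back \<open>j\<close> steps from \<open>m\<close> and from
  \<open>N0 + j\<close> leaves \<open>\<theta> ^ j\<close> times a global bound and a small
  remainder.\<close>

lemma unif_Cauchy_bdd_contraction:
  assumes step: "\<And>n f. n \<ge> n0 \<Longrightarrow> f \<in> F \<Longrightarrow> q (Suc n) f = \<theta> * ((q n (g f) + q n (h f)) / 2) + r n f"
    and gh: "\<And>f. f \<in> F \<Longrightarrow> g f \<in> F" "\<And>f. f \<in> F \<Longrightarrow> h f \<in> F"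
    and \<theta>: "0 \<le> \<theta>" "\<theta> < 1" and r: "unif_Cauchy_bdd F r"
    and q0: "\<And>n f. n \<le> n0 \<Longrightarrow> f \<in> F \<Longrightarrow> \<bar>q n f\<bar> \<le> B"
  shows "unif_Cauchy_bdd F q"
proof -
  obtain C where C: "\<And>n f. f \<in> F \<Longrightarrow> \<bar>r n f\<bar> \<le> C" using unif_Cauchy_bdd_bound[OF r] by blast
  \<comment> \<open>\<open>C / (1 - \<theta>)\<close> is the level preserved by
    \<open>t \<mapsto> \<theta> * t + C\<close>; \<open>B\<close> covers the indices up to
    \<open>n0\<close>, which the recursion does not reach.\<close>
  define K where "K = max \<bar>B\<bar> (\<bar>C\<bar> / (1 - \<theta>))"
  have KC: "\<bar>C\<bar> \<le> (1 - \<theta>) * K"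
    using \<theta> by (simp add: K_def field_simps max_def)
  have K: "\<bar>q n f\<bar> \<le> K" if "f \<in> F" for n f using that
  proof (induction n arbitrary: f)
    case 0 then show ?case using q0[of 0 f] by (auto simp: K_def)
  next
    case (Suc n)
    show ?case
    proof (cases "Suc n \<le> n0")
      case True then show ?thesis using q0[of "Suc n" f] Suc.prems by (auto simp: K_def)
    next
      case False
      have "\<bar>q n (g f) + q n (h f)\<bar> \<le> K + K" using Suc gh by (meson abs_triangle_ineq add_mono order_trans)
      then have "\<bar>\<theta> * ((q n (g f) + q n (h f)) / 2)\<bar> \<le> \<theta> * K"
        unfolding abs_mult using \<theta> by (intro mult_mono) auto
      moreover have "\<bar>r n f\<bar> \<le> (1 - \<theta>) * K" using C[of f n] KC Suc.prems by linarith
      moreover have "(1 - \<theta>) * K + \<theta> * K = K" by (simp add: algebra_simps)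
      ultimately show ?thesis using step[of n f] Suc.prems False by auto
    qed
  qed
  have K0: "0 \<le> K" by (simp add: K_def)
  have "\<exists>N. \<forall>m\<ge>N. \<forall>n\<ge>N. \<forall>f\<in>F. \<bar>q m f - q n f\<bar> \<le> e" if e: "e > 0" for e
  proof -
    \<comment> \<open>Both \<open>q m f\<close> and \<open>q n f\<close> are compared with
      \<open>q (N0 + j) f\<close>, each at a cost below \<open>d + d\<close>.\<close>
    define d where "d = e / 4"
    have d: "0 < d" using e by (simp add: d_def)
    then have "0 < (1 - \<theta>) * d" using \<theta> by simp
    then obtain N1 where N1: "\<And>m n f. m \<ge> N1 \<Longrightarrow> n \<ge> N1 \<Longrightarrow> f \<in> F \<Longrightarrow> \<bar>r m f - r n f\<bar> \<le> (1 - \<theta>) * d"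
      using unif_Cauchy_bdd_Cauchy[OF r] by blast
    define N0 where "N0 = max N1 n0"
    have ind: "\<bar>q m f - q (N0 + j) f\<bar> \<le> 2 * K * \<theta> ^ j + d" if "f \<in> F" "m \<ge> N0 + j" for m j f
      using that
    proof (induction j arbitrary: m f)
      case 0
      then show ?case using K[of f m] K[of f N0] d by auto
    next
      case (Suc j)
      then obtain m' where m: "m = Suc m'" by (cases m) auto
      let ?D = "\<lambda>f. q m' f - q (N0 + j) f"
      have IH: "\<bar>?D f\<bar> \<le> 2 * K * \<theta> ^ j + d" if "f \<in> F" for f
        using Suc.IH[of f m'] Suc.prems m that by auto
      have "q m f - q (N0 + Suc j) f = \<theta> * ((?D (g f) + ?D (h f)) / 2) + (r m' f - r (N0 + j) f)"
        using Suc.prems m by (simp add: step N0_def field_simps)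
      moreover have "\<bar>\<theta> * ((?D (g f) + ?D (h f)) / 2)\<bar> \<le> \<theta> * (2 * K * \<theta> ^ j + d)"
        unfolding abs_mult using \<theta> IH[of "g f"] IH[of "h f"] gh Suc.prems
        by (intro mult_mono) auto
      moreover have "\<bar>r m' f - r (N0 + j) f\<bar> \<le> (1 - \<theta>) * d"
        using Suc.prems m by (intro N1) (auto simp: N0_def)
      moreover have "\<theta> * (2 * K * \<theta> ^ j + d) + (1 - \<theta>) * d = 2 * K * \<theta> ^ Suc j + d"
        by (simp add: algebra_simps)
      ultimately show ?case by linarith
    qed
    have "(\<lambda>j. 2 * K * \<theta> ^ j) \<longlonglongrightarrow> 0"
      using LIMSEQ_realpow_zero[OF \<theta>] tendsto_mult_right_zero by blast
    from LIMSEQ_D[OF this d] obtain j where j: "\<bar>2 * K * \<theta> ^ j\<bar> < d" by auto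
    show ?thesis
    proof (intro exI[of _ "N0 + j"] allI impI ballI)
      fix m n f assume a: "N0 + j \<le> m" "N0 + j \<le> n" "f \<in> F"
      show "\<bar>q m f - q n f\<bar> \<le> e"
        using ind[of f j m] ind[of f j n] a j by (auto simp: d_def)
    qed
  qed
  then show ?thesis using K unfolding unif_Cauchy_bdd_def by blast
qed

text \<open>As \<open>x\<^sub>l\<^sub>+\<^sub>1 z\<^sub>l\<^sub>+\<^sub>1 / 2\<^sup>l\<^sup>+\<^sup>1\<close> is half of \<open>x\<^sub>l z\<^sub>l / 2\<^sup>l\<close> plus half of the increments, the mean \<open>m\<close> of these
  terms solves \<open>m = m / 2 + c / 2\<close>.\<close>

lemma cesaro_mean_dyadic_products:
  fixes x z u v :: "nat \<Rightarrow> real"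
  assumes x: "\<And>l. x (Suc l) = x l + u l" and z: "\<And>l. z (Suc l) = z l + v l"
    and uv: "(\<lambda>n. (\<Sum>l<n. u l * v l / 2 ^ l) / real n) \<longlonglongrightarrow> c"
    and xv: "(\<lambda>n. (\<Sum>l<n. x l * v l / 2 ^ l) / real n) \<longlonglongrightarrow> 0"
    and zu: "(\<lambda>n. (\<Sum>l<n. z l * u l / 2 ^ l) / real n) \<longlonglongrightarrow> 0"
  shows "(\<lambda>n. (\<Sum>l<n. x l * z l / 2 ^ l) / real n) \<longlonglongrightarrow> c"
proof -
  define s where "s n = (\<Sum>l<n. x l * z l / 2 ^ l)" for n
  define A where "A n = (\<Sum>l<n. u l * v l / 2 ^ l) + (\<Sum>l<n. x l * v l / 2 ^ l) + (\<Sum>l<n. z l * u l / 2 ^ l)" for n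
  have A: "(\<lambda>n. A n / real n) \<longlonglongrightarrow> c"
    using tendsto_add[OF tendsto_add[OF uv xv] zu] by (simp add: A_def add_divide_distrib)
  have s: "s (Suc n) = x 0 * z 0 + (s n + A n) / 2" for n
  proof (induction n)
    case 0 then show ?case by (simp add: s_def A_def)
  next
    case (Suc n)
    define t where "t = x n * z n / 2 ^ n"
    define d where "d = u n * v n / 2 ^ n + x n * v n / 2 ^ n + z n * u n / 2 ^ n"
    have "x (Suc n) * z (Suc n) / 2 ^ Suc n = (t + d) / 2"
      by (simp add: x z t_def d_def field_simps)
    then have "s (Suc (Suc n)) = s (Suc n) + (t + d) / 2" by (simp add: s_def)
    moreover have "s (Suc n) = s n + t" by (simp add: s_def t_def)
    moreover have "A (Suc n) = A n + d" by (simp add: A_def d_def)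
    ultimately show ?case using Suc by (simp add: field_simps)
  qed
  \<comment> \<open>Passing from division by \<open>n\<close> to division by \<open>Suc n\<close>
    costs the factor \<open>n / Suc n\<close>. The deviation \<open>w\<close> is then at most
    halved, up to \<open>e\<close>, which vanishes because \<open>c / 2 + c / 2 = c\<close>.\<close>
  define w where "w n = s n / real n - c" for n
  define e where "e n = \<bar>c / 2 * (real n / real (Suc n)) + (x 0 * z 0 / real (Suc n) + A n / real n / 2 * (real n / real (Suc n))) - c\<bar>" for n
  have nn: "(\<lambda>n. real n / real (Suc n)) \<longlonglongrightarrow> 1" by (rule LIMSEQ_n_over_Suc_n)
  have "e \<longlonglongrightarrow> \<bar>c / 2 * 1 + (0 + c / 2 * 1) - c\<bar>" unfolding e_def
    by (intro tendsto_intros nn A) (use LIMSEQ_Suc[OF lim_const_over_n[of "x 0 * z 0"]] in simp_all)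
  then have e: "e \<longlonglongrightarrow> 0" by simp
  have "w \<longlonglongrightarrow> 0"
  proof (rule perturbed_contraction_tendsto_zero[OF _ _ _ e])
    fix n
    have "A 0 = 0" "s 0 = 0" by (simp_all add: A_def s_def)
    then have "w (Suc n) = (1 / 2) * (real n / real (Suc n)) * w n +
      (c / 2 * (real n / real (Suc n)) + (x 0 * z 0 / real (Suc n) + A n / real n / 2 * (real n / real (Suc n))) - c)"
      by (cases n) (simp_all add: w_def s divide_simps, simp_all add: algebra_simps)
    moreover have "\<bar>(1 / 2) * (real n / real (Suc n)) * w n\<bar> \<le> (1 / 2) * \<bar>w n\<bar>"
      unfolding abs_mult by (intro mult_right_mono) auto
    ultimately show "\<bar>w (Suc n)\<bar> \<le> (1 / 2) * \<bar>w n\<bar> + e n" unfolding e_def by linarith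
  qed auto
  then have "(\<lambda>n. w n + c) \<longlonglongrightarrow> 0 + c" by (intro tendsto_intros)
  then show ?thesis by (simp add: w_def s_def)
qed

section \<open>Least squares in the mean\<close>

definition cmean :: "(nat \<Rightarrow> real) \<Rightarrow> nat \<Rightarrow> real" where
  "cmean f n = (\<Sum>l<n. f l) / real n"

lemma cmean_add: "cmean (\<lambda>l. f l + g l) n = cmean f n + cmean g n"
  by (simp add: cmean_def sum.distrib add_divide_distrib)

lemma cmean_cmult: "cmean (\<lambda>l. c * f l) n = c * cmean f n"
  by (simp add: cmean_def sum_distrib_left)

lemma cmean_sum: "cmean (\<lambda>l. \<Sum>i\<in>I. f i l) n = (\<Sum>i\<in>I. cmean (f i) n)"
  by (simp add: cmean_def sum.swap[of _ I] sum_divide_distrib)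

text \<open>The terms need be small only relative to \<open>t\<close>, which may be unbounded as
  long as its means converge. Only finitely many terms of \<open>f\<close> exceed
  \<open>c * t\<close>, and the mean of \<open>c * t\<close> is at most
  \<open>c * B\<close>.\<close>

lemma cmean_smallo:
  assumes f: "f \<in> o(t)" and t: "\<And>l. 0 \<le> t l" and b: "convergent (cmean t)"
  shows "cmean f \<longlonglongrightarrow> 0"
proof (rule LIMSEQ_I)
  fix d :: real assume d: "0 < d"
  obtain B where B: "0 < B" "\<And>n. \<bar>cmean t n\<bar> \<le> B"
    using convergent_imp_Bseq[OF b] unfolding Bseq_def by auto
  define c where "c = d / (2 * B)"
  have c: "0 < c" "c * B = d / 2" using d B(1) by (auto simp: c_def)
  define u where "u l = (if \<bar>f l\<bar> \<le> c * t l then 0 else \<bar>f l\<bar>)" for l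
  have "\<forall>\<^sub>F l in sequentially. u l = 0"
    using landau_o.smallD[OF f c(1)] by eventually_elim (use t in \<open>auto simp: u_def\<close>)
  then have "u \<longlonglongrightarrow> 0" by (rule tendsto_eventually)
  from LIMSEQ_D[OF cesaro_mean_zero[OF this], of "d / 2"] d
  obtain N where N: "\<And>n. n \<ge> N \<Longrightarrow> \<bar>(\<Sum>l<n. u l) / real n\<bar> < d / 2" by auto
  have "\<bar>cmean f n\<bar> < d" if "n \<ge> N" for n
  proof -
    have "\<bar>cmean f n\<bar> \<le> (\<Sum>l<n. \<bar>f l\<bar>) / real n" unfolding cmean_def by (simp add: divide_right_mono sum_abs)
    also have "\<dots> \<le> (\<Sum>l<n. u l + c * t l) / real n"
      by (intro divide_right_mono sum_mono) (use t c in \<open>auto simp: u_def\<close>)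
    also have "\<dots> = (\<Sum>l<n. u l) / real n + c * cmean t n"
      by (simp add: sum.distrib add_divide_distrib cmean_def sum_distrib_left)
    also have "\<dots> < d / 2 + c * B"
    proof (rule add_less_le_mono)
      show "(\<Sum>l<n. u l) / real n < d / 2" using N[OF that] by (simp only: abs_less_iff)
      have "cmean t n \<le> B" using B(2)[of n] by (simp only: abs_le_iff)
      then show "c * cmean t n \<le> c * B" using c(1) by (intro mult_left_mono) auto
    qed
    finally show ?thesis using c by simp
  qed
  then show "\<exists>no. \<forall>n\<ge>no. norm (cmean f n - 0) < d" by auto
qed

text \<open>Under the weights \<open>2 ^ m\<close> the past is halved at each step, so the deviation
  from \<open>c\<close> is contracted up to \<open>(f n - c) / 2\<close>. For generations: a sum
  over all generations before \<open>l\<close>, divided by \<open>2 ^ l\<close>, has the limit of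
  the means within one generation.\<close>

lemma dyadic_mean_tendsto:
  fixes f :: "nat \<Rightarrow> real"
  assumes "f \<longlonglongrightarrow> c"
  shows "(\<lambda>l. (\<Sum>m<l. 2 ^ m * f m) / 2 ^ l) \<longlonglongrightarrow> c"
proof -
  define z where "z l = (\<Sum>m<l. 2 ^ m * f m) / 2 ^ l - c" for l
  have "z \<longlonglongrightarrow> 0"
  proof (rule perturbed_contraction_tendsto_zero)
    show "\<bar>z (Suc n)\<bar> \<le> 1 / 2 * \<bar>z n\<bar> + \<bar>f n - c\<bar> / 2" for n
    proof -
      have "z (Suc n) = z n / 2 + (f n - c) / 2" by (simp add: z_def field_simps)
      then show ?thesis using abs_triangle_ineq[of "z n / 2" "(f n - c) / 2"] by simp
    qed
    have "(\<lambda>n. \<bar>f n - c\<bar> / 2) \<longlonglongrightarrow> \<bar>c - c\<bar> / 2" by (intro tendsto_intros assms) simp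
    then show "(\<lambda>n. \<bar>f n - c\<bar> / 2) \<longlonglongrightarrow> 0" by simp
  qed auto
  then have "(\<lambda>l. z l + c) \<longlonglongrightarrow> 0 + c" by (intro tendsto_intros)
  then show ?thesis by (simp add: z_def)
qed

text \<open>As \<open>G\<close> inverts \<open>L\<close>, \<open>u - h\<close> is \<open>G\<close>
  applied to \<open>(L - P) u\<close>, hence at most \<open>\<eta>\<close> times the sum of the
  absolute entries of \<open>u\<close>. Summing over the \<open>d\<close> entries,
  \<open>real d * \<eta> \<le> 1 / 2\<close> absorbs that sum, and bounds in terms of
  \<open>h\<close> alone remain. No inverse of \<open>P\<close> is formed.\<close>

lemma near_inverse_bound:
  fixes L P G :: "nat \<Rightarrow> nat \<Rightarrow> real" and u h :: "nat \<Rightarrow> real"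
  assumes G: "\<And>a c. a < d \<Longrightarrow> c < d \<Longrightarrow> (\<Sum>b<d. G a b * L b c) = (if a = c then 1 else 0)"
    and h: "\<And>a. a < d \<Longrightarrow> h a = (\<Sum>b<d. G a b * (\<Sum>c<d. P b c * u c))"
    and \<eta>: "\<eta> = (\<Sum>a<d. \<Sum>c<d. \<Sum>b<d. \<bar>G a b\<bar> * \<bar>L b c - P b c\<bar>)" "real d * \<eta> \<le> 1 / 2" and a: "a < d"
  shows "\<bar>u a - h a\<bar> \<le> 2 * \<eta> * (\<Sum>c<d. \<bar>h c\<bar>)" "\<bar>u a\<bar> \<le> 2 * (\<Sum>c<d. \<bar>h c\<bar>)"
proof -
  define U where "U = (\<Sum>c<d. \<bar>u c\<bar>)"
  define Hs where "Hs = (\<Sum>c<d. \<bar>h c\<bar>)"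
  have U0: "0 \<le> U" by (simp add: U_def sum_nonneg)
  have \<eta>0: "0 \<le> \<eta>" unfolding \<eta>(1) by (intro sum_nonneg) auto
  have diff: "\<bar>u a - h a\<bar> \<le> \<eta> * U" if a: "a < d" for a
  proof -
    have "(\<Sum>c<d. (if a = c then 1 else 0) * u c) = (\<Sum>c<d. if a = c then u c else 0)"
      by (intro sum.cong) auto
    then have "u a = (\<Sum>c<d. (if a = c then 1 else 0) * u c)" using a by simp
    also have "\<dots> = (\<Sum>c<d. (\<Sum>b<d. G a b * L b c) * u c)" by (intro sum.cong refl) (use G a in auto)
    finally have ua: "u a = (\<Sum>c<d. \<Sum>b<d. G a b * L b c * u c)" by (simp add: sum_distrib_right)
    have "h a = (\<Sum>b<d. \<Sum>c<d. G a b * P b c * u c)" unfolding h[OF a] by (simp add: sum_distrib_left mult.assoc)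
    also have "\<dots> = (\<Sum>c<d. \<Sum>b<d. G a b * P b c * u c)" by (rule sum.swap)
    finally have "u a - h a = (\<Sum>c<d. \<Sum>b<d. G a b * (L b c - P b c) * u c)"
      by (simp add: ua sum_subtractf algebra_simps)
    also have "\<bar>\<dots>\<bar> \<le> (\<Sum>c<d. \<Sum>b<d. \<bar>G a b * (L b c - P b c) * u c\<bar>)"
      by (rule order_trans[OF sum_abs]) (intro sum_mono sum_abs)
    also have "\<dots> \<le> (\<Sum>c<d. \<Sum>b<d. \<bar>G a b\<bar> * \<bar>L b c - P b c\<bar> * U)"
    proof (intro sum_mono)
      fix c b assume "c \<in> {..<d}"
      then have "\<bar>u c\<bar> \<le> U" unfolding U_def by (intro member_le_sum) auto
      then show "\<bar>G a b * (L b c - P b c) * u c\<bar> \<le> \<bar>G a b\<bar> * \<bar>L b c - P b c\<bar> * U"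
        unfolding abs_mult by (intro mult_left_mono) auto
    qed
    also have "\<dots> = (\<Sum>c<d. \<Sum>b<d. \<bar>G a b\<bar> * \<bar>L b c - P b c\<bar>) * U" by (simp add: sum_distrib_right)
    also have "\<dots> \<le> \<eta> * U"
    proof (rule mult_right_mono[OF _ U0])
      show "(\<Sum>c<d. \<Sum>b<d. \<bar>G a b\<bar> * \<bar>L b c - P b c\<bar>) \<le> \<eta>"
        unfolding \<eta>(1) using a by (intro member_le_sum[where f = "\<lambda>a. \<Sum>c<d. \<Sum>b<d. \<bar>G a b\<bar> * \<bar>L b c - P b c\<bar>"]) (auto intro!: sum_nonneg)
    qed
    finally show ?thesis .
  qed
  have "U \<le> (\<Sum>c<d. \<bar>h c\<bar> + \<eta> * U)" unfolding U_def[of]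
  proof (rule sum_mono)
    fix c assume "c \<in> {..<d}"
    then have "\<bar>u c - h c\<bar> \<le> \<eta> * U" by (intro diff) simp
    then show "\<bar>u c\<bar> \<le> \<bar>h c\<bar> + \<eta> * (\<Sum>c<d. \<bar>u c\<bar>)" unfolding U_def by linarith
  qed
  also have "\<dots> = Hs + (real d * \<eta>) * U" by (simp add: sum.distrib Hs_def)
  also have "(real d * \<eta>) * U \<le> 1 / 2 * U" by (rule mult_right_mono[OF \<eta>(2) U0])
  finally have U: "U \<le> 2 * Hs" by simp
  then have "\<eta> * U \<le> \<eta> * (2 * Hs)" by (rule mult_left_mono[OF _ \<eta>0])
  then show "\<bar>u a - h a\<bar> \<le> 2 * \<eta> * (\<Sum>c<d. \<bar>h c\<bar>)" using diff[OF a] by (simp add: Hs_def)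
  have "\<bar>u a\<bar> \<le> U" unfolding U_def using a by (intro member_le_sum) auto
  then show "\<bar>u a\<bar> \<le> 2 * (\<Sum>c<d. \<bar>h c\<bar>)" using U by (simp add: Hs_def)
qed

text \<open>After rescaling by \<open>2\<^bsup>l/2\<^esup>\<close>, the estimation error is \<open>L\<^sup>-\<^sup>1\<close> applied to the martingale up to
  a relative error \<open>o(1)\<close>, and such errors disappear in the means.\<close>

lemma least_squares_cesaro:
  fixes \<Phi> :: "nat \<Rightarrow> nat \<Rightarrow> nat \<Rightarrow> real" and L G \<Gamma> :: "nat \<Rightarrow> nat \<Rightarrow> real"
    and S D \<Delta> :: "nat \<Rightarrow> nat \<Rightarrow> nat \<Rightarrow> real"
  assumes \<Phi>: "\<And>a b. a < d \<Longrightarrow> b < d \<Longrightarrow> \<Phi> a b \<longlonglongrightarrow> L a b"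
    and G: "\<And>a c. a < d \<Longrightarrow> c < d \<Longrightarrow> (\<Sum>b<d. G a b * L b c) = (if a = c then 1 else 0)"
    and S: "\<And>i a l. S i a (Suc l) = S i a l + D i a l"
    and DD: "\<And>i j a b. i < r \<Longrightarrow> j < r \<Longrightarrow> a < d \<Longrightarrow> b < d \<Longrightarrow> cmean (\<lambda>l. D i a l * D j b l / 2 ^ l) \<longlonglongrightarrow> \<Gamma> i j * L a b"
    and SD: "\<And>i j a b. i < r \<Longrightarrow> j < r \<Longrightarrow> a < d \<Longrightarrow> b < d \<Longrightarrow> cmean (\<lambda>l. S i a l * D j b l / 2 ^ l) \<longlonglongrightarrow> 0"
    and \<Delta>: "\<forall>\<^sub>F l in sequentially. \<forall>i<r. \<forall>a<d. (\<Sum>b<d. (\<Sum>m<l. 2 ^ m * \<Phi> a b m) * \<Delta> i b l) = S i a l"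
    and i: "i < r" and j: "j < r"
  shows "cmean (\<lambda>l. \<Sum>a<d. \<Sum>b<d. \<Delta> i a l * \<Delta> j b l * (2 ^ l * \<Phi> a b l)) \<longlonglongrightarrow> real d * \<Gamma> i j"
    and "cmean (\<lambda>l. \<Sum>a<d. \<Delta> i a l * D j a l) \<longlonglongrightarrow> 0"
proof -
  define q where "q l = sqrt (2 ^ l)" for l :: nat
  have q: "0 < q l" "q l * q l = 2 ^ l" for l by (simp_all add: q_def)
  define \<mu> where "\<mu> i a l = S i a l / q l" for i a l
  define \<nu> where "\<nu> i a l = D i a l / q l" for i a l
  define u where "u i a l = q l * \<Delta> i a l" for i a l
  define h where "h i a l = (\<Sum>b<d. G a b * \<mu> i b l)" for i a l
  define P where "P a b l = (\<Sum>m<l. 2 ^ m * \<Phi> a b m) / 2 ^ l" for a b l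
  \<comment> \<open>One scale for all Landau estimates: \<open>s\<close>, the root of
    \<open>\<tau>\<close>, dominates every rescaled martingale entry and increment, and the means of
    \<open>\<tau>\<close> converge although \<open>\<tau>\<close> itself may be unbounded.\<close>
  define \<tau> where "\<tau> l = (\<Sum>i<r. \<Sum>a<d. (\<mu> i a l)\<^sup>2 + (\<nu> i a l)\<^sup>2)" for l
  define s where "s l = sqrt (\<tau> l)" for l
  have \<tau>0: "0 \<le> \<tau> l" for l unfolding \<tau>_def by (intro sum_nonneg) auto
  have ss: "s l * s l = \<tau> l" for l by (simp add: s_def \<tau>0)
  have SS: "cmean (\<lambda>l. S i a l * S j b l / 2 ^ l) \<longlonglongrightarrow> \<Gamma> i j * L a b" if "i < r" "j < r" "a < d" "b < d" for i j a b
    unfolding cmean_def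
    by (rule cesaro_mean_dyadic_products[where u = "D i a" and v = "D j b"])
       (use S DD SD that in \<open>auto simp: cmean_def[abs_def]\<close>)
  have mm: "\<mu> i a l * \<mu> j b l = S i a l * S j b l / 2 ^ l" "\<nu> i a l * \<nu> j b l = D i a l * D j b l / 2 ^ l"
    "\<mu> i a l * \<nu> j b l = S i a l * D j b l / 2 ^ l" for i j a b l
    by (simp_all add: \<mu>_def \<nu>_def q(2))
  have c\<mu>\<mu>: "cmean (\<lambda>l. \<mu> i a l * \<mu> j b l) \<longlonglongrightarrow> \<Gamma> i j * L a b" if "i < r" "j < r" "a < d" "b < d" for i j a b
    unfolding mm using SS that by blast
  have c\<nu>\<nu>: "cmean (\<lambda>l. \<nu> i a l * \<nu> j b l) \<longlonglongrightarrow> \<Gamma> i j * L a b" if "i < r" "j < r" "a < d" "b < d" for i j a b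
    unfolding mm using DD that by blast
  have c\<mu>\<nu>: "cmean (\<lambda>l. \<mu> i a l * \<nu> j b l) \<longlonglongrightarrow> 0" if "i < r" "j < r" "a < d" "b < d" for i j a b
    unfolding mm using SD that by blast
  have c\<tau>: "convergent (cmean \<tau>)"
  proof -
    have "cmean \<tau> = (\<lambda>n. \<Sum>i<r. \<Sum>a<d. cmean (\<lambda>l. \<mu> i a l * \<mu> i a l) n + cmean (\<lambda>l. \<nu> i a l * \<nu> i a l) n)"
      by (simp add: fun_eq_iff \<tau>_def[abs_def] cmean_sum cmean_add power2_eq_square)
    moreover have "convergent (\<lambda>n. \<Sum>i<r. \<Sum>a<d. cmean (\<lambda>l. \<mu> i a l * \<mu> i a l) n + cmean (\<lambda>l. \<nu> i a l * \<nu> i a l) n)"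
      by (intro convergent_sum convergent_add) (auto intro!: convergentI c\<mu>\<mu> c\<nu>\<nu>)
    ultimately show ?thesis by simp
  qed
  have le_s: "\<bar>\<mu> i a l\<bar> \<le> s l" "\<bar>\<nu> i a l\<bar> \<le> s l" if "i < r" "a < d" for i a l
  proof -
    have "(\<mu> i a l)\<^sup>2 + (\<nu> i a l)\<^sup>2 \<le> (\<Sum>a<d. (\<mu> i a l)\<^sup>2 + (\<nu> i a l)\<^sup>2)"
      using that by (intro member_le_sum[where f = "\<lambda>a. (\<mu> i a l)\<^sup>2 + (\<nu> i a l)\<^sup>2"]) auto
    also have "\<dots> \<le> \<tau> l" unfolding \<tau>_def
      using that by (intro member_le_sum[where f = "\<lambda>i. \<Sum>a<d. (\<mu> i a l)\<^sup>2 + (\<nu> i a l)\<^sup>2"]) (auto intro!: sum_nonneg)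
    finally have *: "(\<mu> i a l)\<^sup>2 + (\<nu> i a l)\<^sup>2 \<le> \<tau> l" .
    have "(\<mu> i a l)\<^sup>2 \<le> \<tau> l" using * zero_le_power2[of "\<nu> i a l"] by linarith
    then show "\<bar>\<mu> i a l\<bar> \<le> s l" unfolding s_def by (intro real_le_rsqrt) simp
    have "(\<nu> i a l)\<^sup>2 \<le> \<tau> l" using * zero_le_power2[of "\<mu> i a l"] by linarith
    then show "\<bar>\<nu> i a l\<bar> \<le> s l" unfolding s_def by (intro real_le_rsqrt) simp
  qed
  have s0: "0 \<le> s l" for l by (simp add: s_def \<tau>0)
  have \<nu>O: "\<nu> i a \<in> O(s)" and \<mu>O: "\<mu> i a \<in> O(s)" if "i < r" "a < d" for i a
    using le_s[OF that] s0 by (auto intro!: landau_o.bigI[of 1] always_eventually)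
  have hO: "h i a \<in> O(s)" if "i < r" for i a
    unfolding h_def using that by (intro big_sum_in_bigo landau_o.big.cmult_in_iff'[THEN iffD2]) (auto intro: \<mu>O)
  have PL: "P a b \<longlonglongrightarrow> L a b" if "a < d" "b < d" for a b
    unfolding P_def[abs_def] by (rule dyadic_mean_tendsto[OF \<Phi>[OF that]])
  define \<eta> where "\<eta> l = (\<Sum>a<d. \<Sum>c<d. \<Sum>b<d. \<bar>G a b\<bar> * \<bar>L b c - P b c l\<bar>)" for l
  have "\<eta> \<longlonglongrightarrow> (\<Sum>a<d. \<Sum>c<d. \<Sum>b<d. \<bar>G a b\<bar> * \<bar>L b c - L b c\<bar>)"
    unfolding \<eta>_def[abs_def] by (intro tendsto_intros PL) auto
  then have \<eta>: "\<eta> \<longlonglongrightarrow> 0" by simp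
  have "(\<lambda>l. real d * \<eta> l) \<longlonglongrightarrow> real d * 0" by (intro tendsto_intros \<eta>)
  then have small: "\<forall>\<^sub>F l in sequentially. real d * \<eta> l < 1 / 2" by (rule order_tendstoD) simp
  \<comment> \<open>Divided by \<open>q l\<close>, the normal equations for \<open>\<Delta>\<close>
    read \<open>P u = \<mu>\<close>, so \<open>h\<close> is \<open>G\<close> applied to
    \<open>P u\<close>, the setting of \<open>near_inverse_bound\<close>.\<close>
  have key: "\<forall>\<^sub>F l in sequentially. \<forall>i<r. \<forall>a<d. \<bar>u i a l - h i a l\<bar> \<le> 2 * \<eta> l * (\<Sum>c<d. \<bar>h i c l\<bar>) \<and> \<bar>u i a l\<bar> \<le> 2 * (\<Sum>c<d. \<bar>h i c l\<bar>)"
    using \<Delta> small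
  proof eventually_elim
    case (elim l)
    show ?case
    proof (intro allI impI)
      fix i a assume i: "i < r" and a: "a < d"
      have hh: "h i a l = (\<Sum>b<d. G a b * (\<Sum>c<d. P b c l * u i c l))" if "a < d" for a
        unfolding h_def
      proof (intro sum.cong refl arg_cong2[where f = "(*)"])
        fix b assume "b \<in> {..<d}"
        then have "S i b l = (\<Sum>c<d. (\<Sum>m<l. 2 ^ m * \<Phi> b c m) * \<Delta> i c l)" using elim(1) i by simp
        also have "\<dots> = q l * (\<Sum>c<d. P b c l * u i c l)"
          unfolding sum_distrib_left
        proof (intro sum.cong refl)
          fix c
          have "q l * (P b c l * u i c l) = (q l * q l) * P b c l * \<Delta> i c l" by (simp add: u_def)
          then show "(\<Sum>m<l. 2 ^ m * \<Phi> b c m) * \<Delta> i c l = q l * (P b c l * u i c l)"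
            unfolding q(2) by (simp add: P_def)
        qed
        finally show "\<mu> i b l = (\<Sum>c<d. P b c l * u i c l)" using q(1)[of l] by (simp add: \<mu>_def)
      qed
      show "\<bar>u i a l - h i a l\<bar> \<le> 2 * \<eta> l * (\<Sum>c<d. \<bar>h i c l\<bar>) \<and> \<bar>u i a l\<bar> \<le> 2 * (\<Sum>c<d. \<bar>h i c l\<bar>)"
        using near_inverse_bound[where L = L and P = "\<lambda>a b. P a b l" and G = G and u = "\<lambda>a. u i a l" and h = "\<lambda>a. h i a l", OF G hh \<eta>_def _ a] elim(2)
        by auto
    qed
  qed
  have sumO: "(\<lambda>l. \<Sum>c<d. \<bar>h i c l\<bar>) \<in> O(s)" if "i < r" for i
    by (intro big_sum_in_bigo) (use hO[OF that] in auto)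
  have uO: "u i a \<in> O(s)" if "i < r" "a < d" for i a
  proof -
    have "u i a \<in> O(\<lambda>l. \<Sum>c<d. \<bar>h i c l\<bar>)"
      by (rule landau_o.bigI[of 2]) (use key that in \<open>auto elim!: eventually_mono simp: sum_nonneg\<close>)
    then show ?thesis by (rule landau_o.big_trans[OF _ sumO[OF that(1)]])
  qed
  have uho: "(\<lambda>l. u i a l - h i a l) \<in> o(s)" if "i < r" "a < d" for i a
  proof -
    have "(\<lambda>l. u i a l - h i a l) \<in> O(\<lambda>l. \<eta> l * (\<Sum>c<d. \<bar>h i c l\<bar>))"
    proof (rule landau_o.bigI[of 2])
      have \<eta>0: "0 \<le> \<eta> l" for l unfolding \<eta>_def by (intro sum_nonneg) auto
      show "\<forall>\<^sub>F l in sequentially. norm (u i a l - h i a l) \<le> 2 * norm (\<eta> l * (\<Sum>c<d. \<bar>h i c l\<bar>))"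
        using key by eventually_elim (use that \<eta>0 in \<open>auto simp: abs_mult sum_nonneg mult.assoc\<close>)
    qed simp
    moreover have "\<eta> \<in> o(\<lambda>_. 1)" using \<eta> by (intro smalloI_tendsto) auto
    from landau_o.small_big_mult[OF this sumO[OF that(1)]]
    have "(\<lambda>l. \<eta> l * (\<Sum>c<d. \<bar>h i c l\<bar>)) \<in> o(s)" by simp
    ultimately show ?thesis by (rule landau_o.big_small_trans)
  qed
  have o\<tau>: "f \<in> o(\<tau>)" if "f \<in> o(\<lambda>l. s l * s l)" for f :: "nat \<Rightarrow> real" using that unfolding ss .
  have hh: "cmean (\<lambda>l. h i a l * h j b l * L a b) \<longlonglongrightarrow> (\<Sum>c<d. \<Sum>e<d. G a c * G b e * L a b * (\<Gamma> i j * L c e))"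
    if "a < d" "b < d" for a b
  proof -
    have "h i a l * h j b l * L a b = (\<Sum>c<d. \<Sum>e<d. (G a c * G b e * L a b) * (\<mu> i c l * \<mu> j e l))" for l
    proof -
      have "h i a l * h j b l * L a b = (\<Sum>c<d. \<Sum>e<d. (G a c * \<mu> i c l) * (G b e * \<mu> j e l)) * L a b"
        by (simp only: h_def sum_product)
      also have "\<dots> = (\<Sum>c<d. \<Sum>e<d. (G a c * \<mu> i c l) * (G b e * \<mu> j e l) * L a b)"
        by (simp only: sum_distrib_right)
      also have "\<dots> = (\<Sum>c<d. \<Sum>e<d. (G a c * G b e * L a b) * (\<mu> i c l * \<mu> j e l))"
        by (intro sum.cong refl) (simp add: algebra_simps)
      finally show ?thesis .
    qed
    then have "cmean (\<lambda>l. h i a l * h j b l * L a b) = (\<lambda>n. \<Sum>c<d. \<Sum>e<d. (G a c * G b e * L a b) * cmean (\<lambda>l. \<mu> i c l * \<mu> j e l) n)"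
      by (simp add: fun_eq_iff cmean_sum cmean_cmult)
    then show ?thesis by (auto intro!: tendsto_intros c\<mu>\<mu> i j)
  qed
  \<comment> \<open>This is \<open>\<Gamma> i j\<close> times the trace of the identity: the sum
    over \<open>c\<close> of \<open>G a c * L c e\<close> forces \<open>e = a\<close>, and the sum
    over \<open>a\<close> of \<open>G b a * L a b\<close> is 1 for each \<open>b\<close>.\<close>
  have val: "(\<Sum>a<d. \<Sum>b<d. \<Sum>c<d. \<Sum>e<d. G a c * G b e * L a b * (\<Gamma> i j * L c e)) = real d * \<Gamma> i j"
  proof -
    have "(\<Sum>c<d. \<Sum>e<d. G a c * G b e * L a b * (\<Gamma> i j * L c e)) = \<Gamma> i j * (L a b * G b a)" if "a < d" "b < d" for a b
    proof -
      have "(\<Sum>c<d. \<Sum>e<d. G a c * G b e * L a b * (\<Gamma> i j * L c e)) = (\<Sum>e<d. \<Sum>c<d. G a c * G b e * L a b * (\<Gamma> i j * L c e))"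
        by (rule sum.swap)
      also have "\<dots> = (\<Sum>e<d. \<Gamma> i j * L a b * G b e * (\<Sum>c<d. G a c * L c e))"
        unfolding sum_distrib_left by (intro sum.cong refl) (simp add: algebra_simps)
      also have "\<dots> = (\<Sum>e<d. if e = a then \<Gamma> i j * L a b * G b e else 0)"
        using G that by (intro sum.cong refl) auto
      finally show ?thesis using that by simp
    qed
    then have "(\<Sum>a<d. \<Sum>b<d. \<Sum>c<d. \<Sum>e<d. G a c * G b e * L a b * (\<Gamma> i j * L c e)) = (\<Sum>a<d. \<Sum>b<d. \<Gamma> i j * (L a b * G b a))"
      by (intro sum.cong refl) auto
    also have "\<dots> = (\<Sum>b<d. \<Sum>a<d. \<Gamma> i j * (L a b * G b a))" by (rule sum.swap)
    also have "\<dots> = (\<Sum>b<d. \<Gamma> i j * (\<Sum>a<d. G b a * L a b))" by (simp add: sum_distrib_left mult.commute)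
    also have "\<dots> = (\<Sum>b<d. \<Gamma> i j)" using G by (intro sum.cong refl) auto
    finally show ?thesis by simp
  qed
  \<comment> \<open>\<open>u i * u j * \<Phi>\<close> is replaced factor by factor by
    \<open>h i * h j * L\<close>; each of the three differences has one factor of lower order and is
    \<open>o(\<tau>)\<close>.\<close>
  have main: "cmean (\<lambda>l. u i a l * u j b l * \<Phi> a b l) \<longlonglongrightarrow> (\<Sum>c<d. \<Sum>e<d. G a c * G b e * L a b * (\<Gamma> i j * L c e))"
    if a: "a < d" and b: "b < d" for a b
  proof -
    have \<Phi>O: "\<Phi> a b \<in> O(\<lambda>_. 1)" by (rule bigoI_tendsto[OF _ ]) (use \<Phi>[OF a b] in auto)
    have \<Phi>o: "(\<lambda>l. \<Phi> a b l - L a b) \<in> o(\<lambda>_. 1)"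
      by (rule smalloI_tendsto) (use \<Phi>[OF a b] in \<open>auto intro!: LIM_zero\<close>)
    have 1: "(\<lambda>l. (u i a l - h i a l) * u j b l * \<Phi> a b l) \<in> o(\<tau>)"
      using landau_o.small_big_mult[OF landau_o.small_big_mult[OF uho[OF i a] uO[OF j b]] \<Phi>O] by (intro o\<tau>) simp
    have 2: "(\<lambda>l. h i a l * (u j b l - h j b l) * \<Phi> a b l) \<in> o(\<tau>)"
      using landau_o.small_big_mult[OF landau_o.big_small_mult[OF hO[OF i] uho[OF j b]] \<Phi>O] by (intro o\<tau>) simp
    have 3: "(\<lambda>l. h i a l * h j b l * (\<Phi> a b l - L a b)) \<in> o(\<tau>)"
      using landau_o.big_small_mult[OF landau_o.big_mult[OF hO[OF i] hO[OF j]] \<Phi>o] by (intro o\<tau>) simp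
    have "cmean (\<lambda>l. (u i a l - h i a l) * u j b l * \<Phi> a b l + h i a l * (u j b l - h j b l) * \<Phi> a b l +
        h i a l * h j b l * (\<Phi> a b l - L a b)) \<longlonglongrightarrow> 0"
      by (rule cmean_smallo[OF sum_in_smallo(1)[OF sum_in_smallo(1)[OF 1 2] 3] \<tau>0 c\<tau>])
    from tendsto_add[OF this hh[OF a b]] show ?thesis
      unfolding cmean_add[symmetric] by (simp add: algebra_simps)
  qed
  have rescale: "\<Delta> i a l * \<Delta> j b l * (2 ^ l * \<Phi> a b l) = u i a l * u j b l * \<Phi> a b l" for a b l
    unfolding u_def q(2)[symmetric] by simp
  have "cmean (\<lambda>l. \<Sum>a<d. \<Sum>b<d. \<Delta> i a l * \<Delta> j b l * (2 ^ l * \<Phi> a b l)) = (\<lambda>n. \<Sum>a<d. \<Sum>b<d. cmean (\<lambda>l. u i a l * u j b l * \<Phi> a b l) n)"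
    by (simp only: rescale fun_eq_iff cmean_sum) simp
  moreover have "(\<lambda>n. \<Sum>a<d. \<Sum>b<d. cmean (\<lambda>l. u i a l * u j b l * \<Phi> a b l) n) \<longlonglongrightarrow>
    (\<Sum>a<d. \<Sum>b<d. \<Sum>c<d. \<Sum>e<d. G a c * G b e * L a b * (\<Gamma> i j * L c e))"
    by (intro tendsto_sum main) auto
  ultimately show "cmean (\<lambda>l. \<Sum>a<d. \<Sum>b<d. \<Delta> i a l * \<Delta> j b l * (2 ^ l * \<Phi> a b l)) \<longlonglongrightarrow> real d * \<Gamma> i j"
    unfolding val by simp
  have "cmean (\<lambda>l. \<Delta> i a l * D j a l) \<longlonglongrightarrow> 0" if a: "a < d" for a
  proof -
    \<comment> \<open>The second part is linear in the products \<open>\<mu> * \<nu>\<close>, whose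
      means vanish by \<open>SD\<close>; the first is negligible because \<open>u\<close> is
      approximated by \<open>h\<close>.\<close>
    have uv: "\<Delta> i a l * D j a l = (u i a l - h i a l) * \<nu> j a l + (\<Sum>b<d. G a b * (\<mu> i b l * \<nu> j a l))" for l
    proof -
      have "\<Delta> i a l * D j a l = u i a l * \<nu> j a l" using q(1)[of l] by (simp add: u_def \<nu>_def)
      moreover have "(\<Sum>b<d. G a b * (\<mu> i b l * \<nu> j a l)) = h i a l * \<nu> j a l"
        by (simp add: h_def sum_distrib_right mult.assoc)
      ultimately show ?thesis by (simp add: algebra_simps)
    qed
    have "(\<lambda>l. (u i a l - h i a l) * \<nu> j a l) \<in> o(\<tau>)"
      by (intro o\<tau> landau_o.small_big_mult uho \<nu>O i j a)
    then have "cmean (\<lambda>l. (u i a l - h i a l) * \<nu> j a l) \<longlonglongrightarrow> 0" by (rule cmean_smallo[OF _ \<tau>0 c\<tau>])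
    moreover have "(\<lambda>n. \<Sum>b<d. G a b * cmean (\<lambda>l. \<mu> i b l * \<nu> j a l) n) \<longlonglongrightarrow> (\<Sum>b<d. G a b * 0)"
      by (intro tendsto_intros c\<mu>\<nu> i j a) auto
    ultimately have "(\<lambda>n. cmean (\<lambda>l. (u i a l - h i a l) * \<nu> j a l) n + (\<Sum>b<d. G a b * cmean (\<lambda>l. \<mu> i b l * \<nu> j a l) n)) \<longlonglongrightarrow> 0 + (\<Sum>b<d. G a b * 0)"
      by (rule tendsto_add)
    moreover have "cmean (\<lambda>l. \<Delta> i a l * D j a l) = (\<lambda>n. cmean (\<lambda>l. (u i a l - h i a l) * \<nu> j a l) n + (\<Sum>b<d. G a b * cmean (\<lambda>l. \<mu> i b l * \<nu> j a l) n))"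
      by (rule ext) (simp only: uv cmean_add cmean_sum cmean_cmult)
    ultimately show ?thesis by simp
  qed
  then have "(\<lambda>n. \<Sum>a<d. cmean (\<lambda>l. \<Delta> i a l * D j a l) n) \<longlonglongrightarrow> (\<Sum>a<d. 0)" by (intro tendsto_sum) auto
  moreover have "cmean (\<lambda>l. \<Sum>a<d. \<Delta> i a l * D j a l) = (\<lambda>n. \<Sum>a<d. cmean (\<lambda>l. \<Delta> i a l * D j a l) n)"
    by (rule ext) (rule cmean_sum)
  ultimately show "cmean (\<lambda>l. \<Sum>a<d. \<Delta> i a l * D j a l) \<longlonglongrightarrow> 0" by simp
qed

text \<open>The homogeneous case \<open>h = 0\<close> of \<open>near_inverse_bound\<close>. It makes
  the matrix of the normal equations invertible from some generation on.\<close>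

lemma eventually_injective:
  fixes \<Phi> :: "nat \<Rightarrow> nat \<Rightarrow> nat \<Rightarrow> real" and L G :: "nat \<Rightarrow> nat \<Rightarrow> real"
  assumes \<Phi>: "\<And>a b. a < d \<Longrightarrow> b < d \<Longrightarrow> \<Phi> a b \<longlonglongrightarrow> L a b"
    and G: "\<And>a c. a < d \<Longrightarrow> c < d \<Longrightarrow> (\<Sum>b<d. G a b * L b c) = (if a = c then 1 else 0)"
  shows "\<forall>\<^sub>F l in sequentially. \<forall>u. (\<forall>a<d. (\<Sum>b<d. (\<Sum>m<l. 2 ^ m * \<Phi> a b m) * u b) = 0) \<longrightarrow> (\<forall>a<d. u a = (0 :: real))"
proof -
  define P where "P a b l = (\<Sum>m<l. 2 ^ m * \<Phi> a b m) / 2 ^ l" for a b l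
  have PL: "P a b \<longlonglongrightarrow> L a b" if "a < d" "b < d" for a b
    unfolding P_def[abs_def] by (rule dyadic_mean_tendsto[OF \<Phi>[OF that]])
  define \<eta> where "\<eta> l = (\<Sum>a<d. \<Sum>c<d. \<Sum>b<d. \<bar>G a b\<bar> * \<bar>L b c - P b c l\<bar>)" for l
  have "(\<lambda>l. real d * \<eta> l) \<longlonglongrightarrow> real d * (\<Sum>a<d. \<Sum>c<d. \<Sum>b<d. \<bar>G a b\<bar> * \<bar>L b c - L b c\<bar>)"
    unfolding \<eta>_def[abs_def] by (intro tendsto_intros PL) auto
  then have "\<forall>\<^sub>F l in sequentially. real d * \<eta> l < 1 / 2" by (rule order_tendstoD) simp
  then show ?thesis
  proof eventually_elim
    case (elim l)
    show ?case
    proof (intro allI impI)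
      fix u :: "nat \<Rightarrow> real" and a assume 0: "\<forall>a<d. (\<Sum>b<d. (\<Sum>m<l. 2 ^ m * \<Phi> a b m) * u b) = 0" and a: "a < d"
      have "0 = (\<Sum>b<d. G a b * (\<Sum>c<d. P b c l * u c))" for a
      proof -
        have "(\<Sum>c<d. P b c l * u c) = (\<Sum>c<d. (\<Sum>m<l. 2 ^ m * \<Phi> b c m) * u c) / 2 ^ l" for b
          by (simp add: P_def flip: sum_divide_distrib)
        then show ?thesis using 0 by simp
      qed
      from near_inverse_bound(2)[where L = L and P = "\<lambda>a b. P a b l" and G = G and u = u and h = "\<lambda>_. 0", OF G this \<eta>_def _ a] elim
      show "u a = 0" by simp
    qed
  qed
qed

section \<open>Companion matrices and the dual unit ball\<close>

lemma is_normD: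
  assumes "is_norm p N" "u \<in> carrier_vec p"
  shows "0 \<le> N u" "N u = 0 \<longleftrightarrow> u = 0\<^sub>v p" "N (c \<cdot>\<^sub>v u) = \<bar>c\<bar> * N u"
    "v \<in> carrier_vec p \<Longrightarrow> N (u + v) \<le> N u + N v"
  using assms unfolding is_norm_def by blast+

lemma is_norm_sum_le:
  assumes N: "is_norm p N" and "finite I" "\<And>i. i \<in> I \<Longrightarrow> v i \<in> carrier_vec p"
  shows "N (Matrix.vec p (\<lambda>j. \<Sum>i\<in>I. v i $ j)) \<le> (\<Sum>i\<in>I. N (v i))"
  using assms(2,3)
proof (induction I rule: finite_induct)
  case empty
  have "Matrix.vec p (\<lambda>i. 0 :: real) = 0\<^sub>v p" by (auto simp: zero_vec_def)
  then show ?case using is_normD(2)[OF N, of "0\<^sub>v p"] by simp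
next
  case (insert i I)
  have "Matrix.vec p (\<lambda>j. \<Sum>i\<in>insert i I. v i $ j) = v i + Matrix.vec p (\<lambda>j. \<Sum>i\<in>I. v i $ j)"
    using insert by (intro eq_vecI) auto
  then have "N (Matrix.vec p (\<lambda>j. \<Sum>i\<in>insert i I. v i $ j)) \<le> N (v i) + N (Matrix.vec p (\<lambda>j. \<Sum>i\<in>I. v i $ j))"
    using is_normD(4)[OF N, of "v i" "Matrix.vec p (\<lambda>j. \<Sum>i\<in>I. v i $ j)"] insert.prems by simp
  then show ?case using insert by auto
qed

lemma is_norm_le_coord:
  assumes N: "is_norm p N" and w: "w \<in> carrier_vec p"
  shows "N w \<le> (\<Sum>i<p. \<bar>w $ i\<bar> * N (unit_vec p i))"
proof -
  have "w = Matrix.vec p (\<lambda>j. \<Sum>i\<in>{..<p}. (w $ i \<cdot>\<^sub>v unit_vec p i) $ j)"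
    using w by (intro eq_vecI) (auto simp: unit_vec_def if_distrib[of "(*) _"] cong: if_cong)
  then have "N w \<le> (\<Sum>i<p. N (w $ i \<cdot>\<^sub>v unit_vec p i))"
    using is_norm_sum_le[OF N, of "{..<p}" "\<lambda>i. w $ i \<cdot>\<^sub>v unit_vec p i"] by simp
  then show ?thesis using is_normD(3)[OF N, of "unit_vec p _"] by simp
qed

text \<open>Half of the equivalence of norms in finite dimension, by induction on the number
  \<open>d\<close> of coordinates allowed to be nonzero. The bound for \<open>d\<close> coordinates
  makes their span complete, so the next unit vector has a positive distance \<open>\<delta>\<close>
  from it, and this distance controls the next coordinate.\<close>

lemma is_norm_coord_bound:
  assumes N: "is_norm p N"
  shows "\<exists>C. \<forall>u\<in>carrier_vec p. \<forall>i<p. \<bar>u $ i\<bar> \<le> C * N u"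
proof -
  note nn = is_normD(1)[OF N] and n0 = is_normD(2)[OF N] and hom = is_normD(3)[OF N] and tri = is_normD(4)[OF N]
  have "\<exists>C. 0 \<le> C \<and> (\<forall>u\<in>carrier_vec p. (\<forall>i. d \<le> i \<longrightarrow> i < p \<longrightarrow> u $ i = 0) \<longrightarrow> (\<forall>i<p. \<bar>u $ i\<bar> \<le> C * N u))"
    if "d \<le> p" for d
    using that
  proof (induction d)
    case 0
    then show ?case by (intro exI[of _ 0]) auto
  next
    case (Suc d)
    then obtain C where C: "0 \<le> C" and Cb: "\<And>u i. u \<in> carrier_vec p \<Longrightarrow> (\<And>i. d \<le> i \<Longrightarrow> i < p \<Longrightarrow> u $ i = 0) \<Longrightarrow> i < p \<Longrightarrow> \<bar>u $ i\<bar> \<le> C * N u"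
      by fastforce
    have d: "d < p" using Suc.prems by simp
    let ?V = "{w \<in> carrier_vec p. \<forall>i. d \<le> i \<longrightarrow> i < p \<longrightarrow> w $ i = 0}"
    let ?e = "unit_vec p d :: real Matrix.vec"
    note Nsum = is_norm_le_coord[OF N]
    \<comment> \<open>If the distance were zero, vectors \<open>w n\<close> with
      \<open>N (?e + w n)\<close> tending to 0 would be Cauchy in \<open>N\<close>, hence in each
      coordinate by the induction hypothesis; their limit \<open>v\<close> would satisfy
      \<open>?e + v = 0\<close>, against \<open>v $ d = 0\<close>.\<close>
    have "\<exists>\<delta>>0. \<forall>w\<in>?V. \<delta> \<le> N (?e + w)"
    proof (rule ccontr)
      assume neg: "\<not> ?thesis"
      have "\<forall>n. \<exists>w. w \<in> ?V \<and> N (?e + w) < 1 / real (Suc n)"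
      proof
        fix n
        have "0 < 1 / real (Suc n)" by simp
        with neg have "\<not> (\<forall>w\<in>?V. 1 / real (Suc n) \<le> N (?e + w))" by blast
        then show "\<exists>w. w \<in> ?V \<and> N (?e + w) < 1 / real (Suc n)" by (auto simp: not_le)
      qed
      from choice[OF this] obtain w where "\<forall>n. w n \<in> ?V \<and> N (?e + w n) < 1 / real (Suc n)" by (elim exE)
      then have w: "\<And>n. w n \<in> ?V" "\<And>n. N (?e + w n) < 1 / real (Suc n)" by blast+
      have wc: "w n \<in> carrier_vec p" "w n \<in> carrier_vec p" for n using w(1)[of n] by auto
      have [simp]: "dim_vec (w n) = p" for n using wc(1)[of n] by auto
      have diff: "N (w n - w m) \<le> 1 / real (Suc n) + 1 / real (Suc m)" for n m
      proof -
        have "w n - w m = (?e + w n) + (-1) \<cdot>\<^sub>v (?e + w m)" using wc by (intro eq_vecI) auto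
        then have "N (w n - w m) \<le> N (?e + w n) + N ((-1) \<cdot>\<^sub>v (?e + w m))"
          using tri[of "?e + w n" "(-1) \<cdot>\<^sub>v (?e + w m)"] wc by simp
        also have "\<dots> \<le> 1 / real (Suc n) + 1 / real (Suc m)"
          using w(2)[of n] w(2)[of m] hom[of "?e + w m" "-1"] wc by simp
        finally show ?thesis .
      qed
      have "Cauchy (\<lambda>n. w n $ i)" if i: "i < p" for i
      proof (rule metric_CauchyI)
        fix e :: real assume e: "0 < e"
        \<comment> \<open>\<open>C + 1\<close> instead of \<open>C\<close> keeps the denominator
          positive when \<open>C = 0\<close>.\<close>
        then have "0 < e / (2 * (C + 1))" using C by simp
        then obtain K where K: "1 / real (Suc K) < e / (2 * (C + 1))" by (rule nat_approx_posE)
        have "dist (w m $ i) (w n $ i) < e" if mn: "m \<ge> K" "n \<ge> K" for m n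
        proof -
          have "\<bar>(w m - w n) $ i\<bar> \<le> C * N (w m - w n)"
            by (rule Cb) (use i d wc w(1)[of n] w(1)[of m] in auto)
          also have "\<dots> \<le> C * (1 / real (Suc m) + 1 / real (Suc n))" using diff C by (intro mult_left_mono) auto
          also have "\<dots> \<le> C * (1 / real (Suc K) + 1 / real (Suc K))"
            using mn C by (intro mult_left_mono add_mono) (auto simp: frac_le)
          also have "\<dots> \<le> C * (e / (2 * (C + 1)) + e / (2 * (C + 1)))"
            using K C by (intro mult_left_mono) auto
          also have "\<dots> < e"
          proof -
            define x where "x = e / (2 * (C + 1))"
            have "0 < x" "x * (2 * (C + 1)) = e" using C e by (auto simp: x_def)
            then have "C * (x + x) < e" by (simp add: algebra_simps)
            then show ?thesis by (simp add: x_def)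
          qed
          finally show ?thesis using i wc[of m] wc[of n] by (simp add: dist_real_def)
        qed
        then show "\<exists>M. \<forall>m\<ge>M. \<forall>n\<ge>M. dist (w m $ i) (w n $ i) < e" by blast
      qed
      then have conv: "convergent (\<lambda>n. w n $ i)" if "i < p" for i using that Cauchy_convergent by blast
      define l where "l i = lim (\<lambda>n. w n $ i)" for i
      have l: "(\<lambda>n. w n $ i) \<longlonglongrightarrow> l i" if "i < p" for i
        using conv[OF that] unfolding l_def by (simp add: convergent_LIMSEQ_iff)
      define v where "v = Matrix.vec p l"
      have v: "v \<in> carrier_vec p" by (simp add: v_def)
      have [simp]: "dim_vec v = p" by (simp add: v_def)
      have vd: "v $ d = 0"
      proof -
        have "w n $ d = 0" for n using w(1)[of n] d by simp
        then show ?thesis using l[OF d] d LIMSEQ_unique[of "\<lambda>n. 0::real" 0 "l d"] by (simp add: v_def)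
      qed
      have "N (?e + v) \<le> 0"
      proof (rule LIMSEQ_le_const)
        have "(\<lambda>n. (\<Sum>i<p. \<bar>v $ i - w n $ i\<bar> * N (unit_vec p i))) \<longlonglongrightarrow> (\<Sum>i<p. \<bar>v $ i - v $ i\<bar> * N (unit_vec p i))"
          by (intro tendsto_intros) (use l in \<open>auto simp: v_def\<close>)
        then have "(\<lambda>n. 1 / real (Suc n) + (\<Sum>i<p. \<bar>v $ i - w n $ i\<bar> * N (unit_vec p i))) \<longlonglongrightarrow> 0 + (\<Sum>i<p. \<bar>v $ i - v $ i\<bar> * N (unit_vec p i))"
          by (intro tendsto_add LIMSEQ_Suc[OF lim_const_over_n]) auto
        then show "(\<lambda>n. 1 / real (Suc n) + (\<Sum>i<p. \<bar>v $ i - w n $ i\<bar> * N (unit_vec p i))) \<longlonglongrightarrow> 0" by simp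
        have "N (?e + v) \<le> 1 / real (Suc n) + (\<Sum>i<p. \<bar>v $ i - w n $ i\<bar> * N (unit_vec p i))" for n
        proof -
          have "?e + v = (?e + w n) + (v - w n)" using v wc[of n] by (intro eq_vecI) auto
          then have "N (?e + v) \<le> N (?e + w n) + N (v - w n)"
            using tri[of "?e + w n" "v - w n"] v wc[of n] by simp
          moreover have "N (v - w n) \<le> (\<Sum>i<p. \<bar>v $ i - w n $ i\<bar> * N (unit_vec p i))"
            using Nsum[of "v - w n"] v wc[of n] by simp
          ultimately show ?thesis using w(2)[of n] by linarith
        qed
        then show "\<exists>K. \<forall>n\<ge>K. N (?e + v) \<le> 1 / real (Suc n) + (\<Sum>i<p. \<bar>v $ i - w n $ i\<bar> * N (unit_vec p i))" by blast
      qed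
      then have "?e + v = 0\<^sub>v p" using nn[of "?e + v"] n0[of "?e + v"] v by auto
      then have "(?e + v) $ d = 0" using d by simp
      then show False using vd v d by simp
    qed
    then obtain \<delta> where \<delta>: "0 < \<delta>" "\<And>w. w \<in> ?V \<Longrightarrow> \<delta> \<le> N (?e + w)" by blast
    have ud: "\<bar>u $ d\<bar> \<le> N u / \<delta>" if u: "u \<in> carrier_vec p" "\<And>i. Suc d \<le> i \<Longrightarrow> i < p \<Longrightarrow> u $ i = 0" for u
    proof (cases "u $ d = 0")
      case True then show ?thesis using nn[OF u(1)] \<delta>(1) by simp
    next
      case False
      \<comment> \<open>Scaled so that \<open>u\<close> is \<open>u $ d\<close> times
        \<open>?e + ?w\<close>, with \<open>?w\<close> in the previous span.\<close>
      let ?w = "Matrix.vec p (\<lambda>i. if i = d then 0 else u $ i / u $ d)"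
      have [simp]: "dim_vec u = p" using u(1) by simp
      have "?w \<in> ?V" using u(2) by (auto simp: Suc_le_eq)
      moreover have "u = u $ d \<cdot>\<^sub>v (?e + ?w)" using u(1) False d by (intro eq_vecI) auto
      then have "N u = \<bar>u $ d\<bar> * N (?e + ?w)" using hom[of "?e + ?w" "u $ d"] by simp
      ultimately have "\<bar>u $ d\<bar> * \<delta> \<le> N u" using \<delta>(2)[of ?w] by (simp add: mult_left_mono)
      then show ?thesis using \<delta>(1) by (simp add: field_simps)
    qed
    \<comment> \<open>The first summand bounds the old coordinates after subtraction of the
      component along \<open>?e\<close>, whose norm is at most \<open>N u / \<delta> * N ?e\<close>;
      the second bounds the coordinate \<open>d\<close> itself.\<close>
    define C' where "C' = C * (1 + N ?e / \<delta>) + 1 / \<delta>"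
    have Ne: "0 \<le> N ?e" by (simp add: nn)
    show ?case
    proof (intro exI[of _ C'] conjI ballI impI allI)
      show "0 \<le> C'" using C \<delta>(1) Ne by (auto simp: C'_def)
      fix u :: "real Matrix.vec" and i :: nat
      assume u: "u \<in> carrier_vec p" "\<forall>i. Suc d \<le> i \<longrightarrow> i < p \<longrightarrow> u $ i = 0" and i: "i < p"
      have Nu: "0 \<le> N u" using nn u by simp
      have b: "\<bar>u $ d\<bar> \<le> N u / \<delta>" using ud u by blast
      show "\<bar>u $ i\<bar> \<le> C' * N u"
      proof (cases "i = d")
        case True
        have "1 / \<delta> * N u \<le> C' * N u"
          using C \<delta>(1) Ne Nu by (intro mult_right_mono) (auto simp: C'_def)
        then show ?thesis using b True by simp
      next
        case False
        let ?u = "u + (- (u $ d)) \<cdot>\<^sub>v ?e"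
        have 1: "\<bar>?u $ i\<bar> \<le> C * N ?u"
        proof (rule Cb[OF _ _ i])
          show "?u \<in> carrier_vec p" using u by simp
          fix j assume j: "d \<le> j" "j < p"
          then show "?u $ j = 0" using u by (cases "j = d") auto
        qed
        have "N ?u \<le> N u + \<bar>u $ d\<bar> * N ?e"
          using tri[of u "(- (u $ d)) \<cdot>\<^sub>v ?e"] hom[of ?e "- (u $ d)"] u by simp
        also have "\<dots> \<le> N u + N u / \<delta> * N ?e" using b Ne by (intro add_left_mono mult_right_mono)
        finally have "C * N ?u \<le> C * (N u + N u / \<delta> * N ?e)" using C by (intro mult_left_mono)
        also have "\<dots> \<le> C' * N u" using \<delta>(1) Nu by (simp add: C'_def field_simps)
        finally have "\<bar>?u $ i\<bar> \<le> C' * N u" using 1 by linarith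
        moreover have "unit_vec p d $ i = (0 :: real)" using False i d by (simp add: unit_vec_def)
        ultimately show ?thesis using u i by simp
      qed
    qed
  qed
  from this[of p] obtain C where C: "\<forall>u\<in>carrier_vec p. (\<forall>i. p \<le> i \<longrightarrow> i < p \<longrightarrow> u $ i = 0) \<longrightarrow> (\<forall>i<p. \<bar>u $ i\<bar> \<le> C * N u)"
    by auto
  have "\<forall>u\<in>carrier_vec p. \<forall>i<p. \<bar>u $ i\<bar> \<le> C * N u" using C by (meson not_less)
  then show ?thesis by blast
qed

text \<open>A real supremum is an upper bound only for a bounded set. The coordinate bound makes
  \<open>N (A *\<^sub>v v)\<close> bounded on the unit sphere; the rest is scaling of
  \<open>u\<close> to norm 1.\<close>

lemma mult_mat_vec_op_norm_le:
  assumes N: "is_norm p N" and A: "A \<in> carrier_mat p p" and u: "u \<in> carrier_vec p"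
  shows "N (A *\<^sub>v u) \<le> op_norm p N A * N u"
proof (cases "u = 0\<^sub>v p")
  case True
  then have "A *\<^sub>v u = 0\<^sub>v p" using A by (intro eq_vecI) auto
  then show ?thesis using True is_normD(2)[OF N u] by simp
next
  case False
  then have Nu: "0 < N u" using is_normD(1,2)[OF N u] by simp
  obtain C where C: "\<And>u i. u \<in> carrier_vec p \<Longrightarrow> i < p \<Longrightarrow> \<bar>u $ i\<bar> \<le> C * N u"
    using is_norm_coord_bound[OF N] by blast
  let ?U = "{u \<in> carrier_vec p. N u = 1}"
  define B where "B = (\<Sum>i<p. (\<Sum>j<p. \<bar>A $$ (i, j)\<bar> * C) * N (unit_vec p i))"
  have "N (A *\<^sub>v v) \<le> B" if "v \<in> ?U" for v
  proof -
    have v: "v \<in> carrier_vec p" "N v = 1" using that by auto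
    have "N (A *\<^sub>v v) \<le> (\<Sum>i<p. \<bar>(A *\<^sub>v v) $ i\<bar> * N (unit_vec p i))"
      by (rule is_norm_le_coord[OF N]) (use A v in auto)
    also have "\<dots> \<le> B" unfolding B_def
    proof (intro sum_mono mult_right_mono)
      fix i assume i: "i \<in> {..<p}"
      have "(A *\<^sub>v v) $ i = (\<Sum>j<p. A $$ (i, j) * v $ j)"
        using A v i by (auto simp: scalar_prod_def atLeast0LessThan intro!: sum.cong)
      also have "\<bar>\<dots>\<bar> \<le> (\<Sum>j<p. \<bar>A $$ (i, j)\<bar> * \<bar>v $ j\<bar>)" by (metis (no_types, lifting) abs_mult sum.cong sum_abs)
      also have "\<dots> \<le> (\<Sum>j<p. \<bar>A $$ (i, j)\<bar> * C)"
        using C[OF v(1)] v(2) by (intro sum_mono mult_left_mono) auto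
      finally show "\<bar>(A *\<^sub>v v) $ i\<bar> \<le> (\<Sum>j<p. \<bar>A $$ (i, j)\<bar> * C)" .
    qed (simp add: is_normD[OF N])
    finally show ?thesis .
  qed
  then have bdd: "bdd_above ((\<lambda>v. N (A *\<^sub>v v)) ` ?U)" by (intro bdd_aboveI2[where M = B])
  let ?v = "inverse (N u) \<cdot>\<^sub>v u"
  have v: "?v \<in> ?U" using Nu u is_normD(3)[OF N u] by simp
  have "A *\<^sub>v ?v = inverse (N u) \<cdot>\<^sub>v (A *\<^sub>v u)" using A u by (intro eq_vecI) auto
  then have "inverse (N u) * N (A *\<^sub>v u) = N (A *\<^sub>v ?v)"
    using Nu is_normD(3)[OF N, of "A *\<^sub>v u"] A u by simp
  also have "\<dots> \<le> op_norm p N A" unfolding op_norm_def by (rule cSUP_upper[OF v bdd])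
  finally show ?thesis using Nu by (simp add: field_simps)
qed

text \<open>The transpose of \<open>companion p c\<close> applied to \<open>f\<close>, divided by
  \<open>\<theta>\<close>: column \<open>j\<close> of the matrix holds \<open>c (Suc j)\<close> in
  row 0 and a one in row \<open>Suc j\<close>, if there is such a row.\<close>

definition companion_dual :: "nat \<Rightarrow> real \<Rightarrow> (nat \<Rightarrow> real) \<Rightarrow> (nat \<Rightarrow> real) \<Rightarrow> nat \<Rightarrow> real" where
  "companion_dual p \<theta> c f j = (f 0 * c (Suc j) + (if Suc j < p then f (Suc j) else 0)) / \<theta>"

text \<open>The dual unit ball of \<open>N\<close>, the action of the companion matrices on it being divided by a
  contraction factor \<open>\<theta>\<close>.\<close>

lemma companion_dual_ball:
  assumes N: "is_norm p N" and p: "p \<ge> 1"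
    and contr: "max (op_norm p N (companion p a)) (op_norm p N (companion p b)) < 1"
  obtains F \<theta> C \<delta> where "0 < \<theta>" "\<theta> < 1" "0 < \<delta>"
    "\<And>f i. f \<in> F \<Longrightarrow> i < p \<Longrightarrow> \<bar>f i\<bar> \<le> C"
    "\<And>i. i < p \<Longrightarrow> (\<lambda>j. if j = i then \<delta> else 0) \<in> F"
    "\<And>f. f \<in> F \<Longrightarrow> companion_dual p \<theta> a f \<in> F"
    "\<And>f. f \<in> F \<Longrightarrow> companion_dual p \<theta> b f \<in> F"
proof -
  \<comment> \<open>The lower bound \<open>1/2\<close> keeps the division by \<open>\<theta>\<close>
    meaningful when both operator norms vanish.\<close>
  define \<theta> where "\<theta> = max (1/2) (max (op_norm p N (companion p a)) (op_norm p N (companion p b)))"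
  define F where "F = {f :: nat \<Rightarrow> real. \<forall>u\<in>carrier_vec p. \<bar>\<Sum>i<p. f i * u $ i\<bar> \<le> N u}"
  obtain C where C: "\<And>u i. u \<in> carrier_vec p \<Longrightarrow> i < p \<Longrightarrow> \<bar>u $ i\<bar> \<le> C * N u"
    using is_norm_coord_bound[OF N] by blast
  \<comment> \<open>Chosen so that \<open>\<delta>\<close> times a coordinate functional has dual
    norm at most 1; \<open>\<bar>C\<bar> + 1\<close> makes it positive whatever the sign of
    \<open>C\<close>.\<close>
  define \<delta> where "\<delta> = 1 / (\<bar>C\<bar> + 1)"
  have \<theta>: "0 < \<theta>" "\<theta> < 1" using contr by (auto simp: \<theta>_def)
  have cl: "companion_dual p \<theta> c f \<in> F" if c: "op_norm p N (companion p c) \<le> \<theta>" and f: "f \<in> F" for c f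
  proof -
    have "\<bar>\<Sum>i<p. companion_dual p \<theta> c f i * u $ i\<bar> \<le> N u" if u: "u \<in> carrier_vec p" for u
    proof -
      let ?w = "companion p c *\<^sub>v u"
      have A: "companion p c \<in> carrier_mat p p" by (simp add: companion_def)
      have w: "?w \<in> carrier_vec p" using A u by simp
      have wi: "?w $ i = (if i = 0 then \<Sum>j<p. c (Suc j) * u $ j else u $ (i - 1))" if i: "i < p" for i
      proof -
        have "?w $ i = (\<Sum>j<p. companion p c $$ (i, j) * u $ j)"
          using A u i by (auto simp: scalar_prod_def atLeast0LessThan intro!: sum.cong)
        also have "\<dots> = (if i = 0 then \<Sum>j<p. c (Suc j) * u $ j else u $ (i - 1))"
        proof (cases i)
          case 0
          then show ?thesis using i by (auto simp: companion_def intro!: sum.cong)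
        next
          case (Suc k)
          then have "(\<Sum>j<p. companion p c $$ (i, j) * u $ j) = (\<Sum>j<p. if j = k then u $ j else 0)"
            using i by (intro sum.cong) (auto simp: companion_def)
          then show ?thesis using Suc i by simp
        qed
        finally show ?thesis .
      qed
      obtain q where q: "p = Suc q" using p by (cases p) auto
      have "(\<Sum>i<p. f i * ?w $ i) = f 0 * (\<Sum>j<p. c (Suc j) * u $ j) + (\<Sum>i<q. f (Suc i) * u $ i)"
      proof -
        have "?w $ 0 = (\<Sum>j<p. c (Suc j) * u $ j)" using wi[of 0] q by simp
        moreover have "?w $ Suc i = u $ i" if "i \<in> {..<q}" for i using wi[of "Suc i"] q that by simp
        moreover have "(\<Sum>i<p. f i * ?w $ i) = f 0 * ?w $ 0 + (\<Sum>i<q. f (Suc i) * ?w $ Suc i)"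
          unfolding q sum.lessThan_Suc_shift ..
        ultimately show ?thesis by simp
      qed
      also have "\<dots> = (\<Sum>j<p. (f 0 * c (Suc j) + (if Suc j < p then f (Suc j) else 0)) * u $ j)"
      proof -
        have "(\<Sum>i<q. f (Suc i) * u $ i) = (\<Sum>j<p. (if Suc j < p then f (Suc j) else 0) * u $ j)"
          unfolding q by simp
        then show ?thesis by (simp add: distrib_right sum.distrib sum_distrib_left mult.assoc)
      qed
      also have "\<dots> = \<theta> * (\<Sum>j<p. companion_dual p \<theta> c f j * u $ j)"
        using \<theta> by (simp add: companion_dual_def sum_distrib_left)
      finally have "\<theta> * \<bar>\<Sum>j<p. companion_dual p \<theta> c f j * u $ j\<bar> = \<bar>\<Sum>i<p. f i * ?w $ i\<bar>"
        using \<theta> by (simp add: abs_mult)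
      also have "\<dots> \<le> N ?w" using f w unfolding F_def by blast
      also have "\<dots> \<le> op_norm p N (companion p c) * N u" by (rule mult_mat_vec_op_norm_le[OF N A u])
      also have "\<dots> \<le> \<theta> * N u" by (rule mult_right_mono[OF c]) (simp add: is_normD[OF N u])
      finally show ?thesis using \<theta> by simp
    qed
    then show ?thesis by (simp add: F_def)
  qed
  show thesis
  proof (rule that[of \<theta> \<delta> F "\<Sum>i<p. N (unit_vec p i)"])
    show "0 < \<delta>" by (simp add: \<delta>_def)
    show "\<bar>f i\<bar> \<le> (\<Sum>i<p. N (unit_vec p i))" if f: "f \<in> F" and i: "i < p" for f i
    proof -
      have "(\<Sum>j<p. f j * unit_vec p i $ j) = (\<Sum>j<p. if j = i then f j else 0)"
        using i by (intro sum.cong) auto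
      then have "\<bar>f i\<bar> = \<bar>\<Sum>j<p. f j * unit_vec p i $ j\<bar>" using i by simp
      also have "\<dots> \<le> N (unit_vec p i)" using f by (simp add: F_def)
      also have "\<dots> \<le> (\<Sum>i<p. N (unit_vec p i))"
        using i by (intro member_le_sum) (auto simp: is_normD[OF N])
      finally show ?thesis .
    qed
    show "(\<lambda>j. if j = i then \<delta> else 0) \<in> F" if i: "i < p" for i
      unfolding F_def
    proof (intro CollectI ballI)
      fix u :: "real Matrix.vec" assume u: "u \<in> carrier_vec p"
      have "(\<Sum>j<p. (if j = i then \<delta> else 0) * u $ j) = (\<Sum>j<p. if j = i then \<delta> * u $ j else 0)"
        by (intro sum.cong) auto
      then have "\<bar>\<Sum>j<p. (if j = i then \<delta> else 0) * u $ j\<bar> = \<delta> * \<bar>u $ i\<bar>"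
        using i by (simp add: abs_mult \<delta>_def)
      also have "\<dots> \<le> \<delta> * ((\<bar>C\<bar> + 1) * N u)"
      proof (rule mult_left_mono)
        have "C * N u \<le> (\<bar>C\<bar> + 1) * N u" using is_normD(1)[OF N u] by (intro mult_right_mono) auto
        then show "\<bar>u $ i\<bar> \<le> (\<bar>C\<bar> + 1) * N u" using C[OF u i] by linarith
      qed (simp add: \<delta>_def)
      also have "\<dots> = N u" by (simp add: \<delta>_def)
      finally show "\<bar>\<Sum>j<p. (if j = i then \<delta> else 0) * u $ j\<bar> \<le> N u" .
    qed
    show "companion_dual p \<theta> a f \<in> F" "companion_dual p \<theta> b f \<in> F" if "f \<in> F" for f
      using that by (intro cl; simp add: \<theta>_def)+
  qed (rule \<theta>)+
qed

section \<open>Inverse matrices from injectivity\<close>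

lemma mat_inverse_of_injective:
  fixes A :: "'a :: field mat"
  assumes A: "A \<in> carrier_mat n n" and inj: "\<And>v. v \<in> carrier_vec n \<Longrightarrow> A *\<^sub>v v = 0\<^sub>v n \<Longrightarrow> v = 0\<^sub>v n"
  obtains B where "mat_inverse A = Some B" "B \<in> carrier_mat n n" "A * B = 1\<^sub>m n" "B * A = 1\<^sub>m n" "invertible_mat A"
proof -
  have "det A \<noteq> 0" using det_0_iff_vec_prod_zero[OF A] inj by blast
  then obtain B where B: "mat_inverse A = Some B"
    using det_non_zero_imp_unit[OF A, of "()"] mat_inverse(1)[OF A, of "()"] by (cases "mat_inverse A") auto
  have "A * B = 1\<^sub>m n" "B * A = 1\<^sub>m n" "B \<in> carrier_mat n n" using mat_inverse(2)[OF A B] by auto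
  moreover from this have "invertible_mat A"
    using A unfolding invertible_mat_def inverts_mat_def by auto
  ultimately show thesis using B that by blast
qed

text \<open>A vector in the kernel of \<open>L\<close> annihilates the quadratic form, so positivity
  on nonzero vectors gives injectivity.\<close>

lemma positive_definite_left_inverse:
  fixes L :: "nat \<Rightarrow> nat \<Rightarrow> real"
  assumes pos: "\<And>u. (\<exists>a<d. u a \<noteq> 0) \<Longrightarrow> 0 < (\<Sum>a<d. \<Sum>b<d. u a * L a b * u b)"
  obtains G where "\<And>a c. a < d \<Longrightarrow> c < d \<Longrightarrow> (\<Sum>b<d. G a b * L b c) = (if a = c then 1 else 0)"
proof -
  define A where "A = Matrix.mat d d (\<lambda>(a, b). L a b)"
  have A: "A \<in> carrier_mat d d" by (simp add: A_def)
  have mv: "(A *\<^sub>v v) $ a = (\<Sum>b<d. L a b * v $ b)" if "v \<in> carrier_vec d" "a < d" for v a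
    using that by (auto simp: A_def scalar_prod_def atLeast0LessThan intro!: sum.cong)
  obtain B where B: "B \<in> carrier_mat d d" "B * A = 1\<^sub>m d"
  proof (rule mat_inverse_of_injective[OF A])
    fix v assume v: "v \<in> carrier_vec d" "A *\<^sub>v v = 0\<^sub>v d"
    have "(\<Sum>a<d. \<Sum>b<d. v $ a * L a b * v $ b) = (\<Sum>a<d. v $ a * (A *\<^sub>v v) $ a)"
      using v(1) by (simp add: mv sum_distrib_left mult.assoc)
    also have "\<dots> = 0" using v(2) by simp
    finally show "v = 0\<^sub>v d" using pos[of "\<lambda>a. v $ a"] v(1) by (intro eq_vecI) fastforce+
  qed blast
  show thesis
  proof (rule that[of "\<lambda>a b. B $$ (a, b)"])
    fix a c assume ac: "a < d" "c < d"
    have "(B * A) $$ (a, c) = (\<Sum>b<d. B $$ (a, b) * L b c)"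
      using B(1) ac by (auto simp: A_def scalar_prod_def atLeast0LessThan intro!: sum.cong)
    then show "(\<Sum>b<d. B $$ (a, b) * L b c) = (if a = c then 1 else 0)" using B ac by simp
  qed
qed

section \<open>Martingale differences\<close>

lemma integrable_mult_of_squares:
  fixes f g :: "'a \<Rightarrow> real"
  assumes [measurable]: "f \<in> borel_measurable M" "g \<in> borel_measurable M"
    and f: "integrable M (\<lambda>x. (f x)\<^sup>2)" and g: "integrable M (\<lambda>x. (g x)\<^sup>2)"
  shows "integrable M (\<lambda>x. f x * g x)"
proof (rule Bochner_Integration.integrable_bound[OF Bochner_Integration.integrable_add[OF f g]])
  have "\<bar>f x * g x\<bar> \<le> (f x)\<^sup>2 + (g x)\<^sup>2" for x
  proof -
    have "0 \<le> (\<bar>f x\<bar> - \<bar>g x\<bar>)\<^sup>2" by simp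
    then have "2 * (\<bar>f x\<bar> * \<bar>g x\<bar>) \<le> (f x)\<^sup>2 + (g x)\<^sup>2" by (simp add: power2_diff)
    moreover have "0 \<le> \<bar>f x\<bar> * \<bar>g x\<bar>" by simp
    ultimately show ?thesis unfolding abs_mult by linarith
  qed
  then show "AE x in M. norm (f x * g x) \<le> norm ((f x)\<^sup>2 + (g x)\<^sup>2)" by auto
qed simp

lemma integrable_sum_square:
  fixes f :: "'i \<Rightarrow> 'a \<Rightarrow> real"
  assumes "finite I" "\<And>i. i \<in> I \<Longrightarrow> f i \<in> borel_measurable M"
    "\<And>i. i \<in> I \<Longrightarrow> integrable M (\<lambda>x. (f i x)\<^sup>2)"
  shows "integrable M (\<lambda>x. (\<Sum>i\<in>I. f i x)\<^sup>2)"
  unfolding power2_eq_square sum_product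
  by (intro Bochner_Integration.integrable_sum integrable_mult_of_squares assms)

lemma integrable_add_square:
  fixes f g :: "'a \<Rightarrow> real"
  assumes "f \<in> borel_measurable M" "g \<in> borel_measurable M"
    and "integrable M (\<lambda>x. (f x)\<^sup>2)" "integrable M (\<lambda>x. (g x)\<^sup>2)"
  shows "integrable M (\<lambda>x. (f x + g x)\<^sup>2)"
  unfolding power2_sum using integrable_mult_of_squares[OF assms] assms(3,4) by (simp add: mult.assoc)

lemma (in prob_space) integrable_of_square:
  fixes f :: "'a \<Rightarrow> real"
  assumes "f \<in> borel_measurable M" "integrable M (\<lambda>x. (f x)\<^sup>2)"
  shows "integrable M f"
  using integrable_mult_of_squares[of f M "\<lambda>_. 1"] assms by simp

text \<open>By monotone convergence the sum has finite expectation, hence is finite almost surely.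
  It turns bounds in mean into summability along paths.\<close>

lemma AE_summable_of_expectation:
  fixes f :: "nat \<Rightarrow> 'a \<Rightarrow> real"
  assumes int: "\<And>k. integrable M (f k)" and nonneg: "\<And>k x. x \<in> space M \<Longrightarrow> 0 \<le> f k x"
    and le: "\<And>k. (\<integral>x. f k x \<partial>M) \<le> b k" and b: "summable b"
  shows "AE x in M. summable (\<lambda>k. f k x)"
proof -
  have [measurable]: "f k \<in> borel_measurable M" for k using int by auto
  have nn: "(\<integral>\<^sup>+x. ennreal (f k x) \<partial>M) = ennreal (\<integral>x. f k x \<partial>M)" for k
    by (intro nn_integral_eq_integral int) (auto intro!: AE_I2 nonneg)
  have E0: "0 \<le> (\<integral>x. f k x \<partial>M)" for k by (intro Bochner_Integration.integral_nonneg nonneg)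
  then have sE: "summable (\<lambda>k. \<integral>x. f k x \<partial>M)"
    by (intro summable_comparison_test'[OF b, of 0]) (use le in auto)
  have "(\<integral>\<^sup>+x. (\<Sum>k. ennreal (f k x)) \<partial>M) = (\<Sum>k. \<integral>\<^sup>+x. ennreal (f k x) \<partial>M)"
    by (rule nn_integral_suminf) simp
  also have "\<dots> = ennreal (\<Sum>k. \<integral>x. f k x \<partial>M)"
    unfolding nn by (rule suminf_ennreal_eq[OF E0]) (rule summable_sums[OF sE])
  finally have "(\<integral>\<^sup>+x. (\<Sum>k. ennreal (f k x)) \<partial>M) \<noteq> \<infinity>" by simp
  then have "AE x in M. (\<Sum>k. ennreal (f k x)) \<noteq> \<infinity>"
    by (intro nn_integral_PInf_AE) simp_all
  then show ?thesis
    using AE_space by eventually_elim (auto intro!: summable_suminf_not_top nonneg)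
qed

locale filtration = prob_space M for M :: "'a measure" +
  fixes H :: "nat \<Rightarrow> 'a measure"
  assumes sub: "\<And>k. subalgebra M (H k)" and mono: "\<And>k m. k \<le> m \<Longrightarrow> subalgebra (H m) (H k)"
begin

lemma sigma_finite_sub: "sigma_finite_subalgebra M (H k)"
  by (rule finite_measure_subalgebra_is_sigma_finite)
     (simp add: finite_measure_subalgebra_def finite_measure_subalgebra_axioms_def sub finite_measure_axioms)

lemma H_mono: "f \<in> borel_measurable (H k) \<Longrightarrow> k \<le> m \<Longrightarrow> f \<in> borel_measurable (H m)"
  using measurable_from_subalg[OF mono] by blast

lemma H_M: "f \<in> borel_measurable (H k) \<Longrightarrow> f \<in> borel_measurable M"
  using measurable_from_subalg[OF sub] by blast

lemma space_H: "space (H k) = space M" using sub by (auto simp: subalgebra_def)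

text \<open>Time convention: \<open>\<xi> k\<close> is known at time \<open>Suc k\<close> and
  centred given time \<open>k\<close>, so coefficients measurable for \<open>H k\<close> are
  predictable. Square integrability is included because the estimates rest on orthogonality.\<close>

definition mds :: "(nat \<Rightarrow> 'a \<Rightarrow> real) \<Rightarrow> bool" where
  "mds \<xi> \<longleftrightarrow> (\<forall>k. \<xi> k \<in> borel_measurable (H (Suc k)) \<and> integrable M (\<lambda>x. (\<xi> k x)\<^sup>2) \<and>
     (AE x in M. real_cond_exp M (H k) (\<xi> k) x = 0))"

lemma mdsD:
  assumes "mds \<xi>"
  shows "\<xi> k \<in> borel_measurable (H (Suc k))" "\<xi> k \<in> borel_measurable M"
    "integrable M (\<lambda>x. (\<xi> k x)\<^sup>2)" "AE x in M. real_cond_exp M (H k) (\<xi> k) x = 0"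
  using assms unfolding mds_def by (auto intro: H_M)

lemma mds_mult:
  assumes \<xi>: "mds \<xi>" and c: "\<And>k. c k \<in> borel_measurable (H k)"
    and bnd: "\<And>k x. x \<in> space M \<Longrightarrow> \<bar>c k x\<bar> \<le> C k"
  shows "mds (\<lambda>k x. c k x * \<xi> k x)"
  unfolding mds_def
proof (intro allI conjI)
  fix k
  note [measurable] = mdsD(1,2)[OF \<xi>, of k] H_mono[OF c, of k "Suc k"] H_M[OF c, of k]
  show "(\<lambda>x. c k x * \<xi> k x) \<in> borel_measurable (H (Suc k))" by simp
  show i2: "integrable M (\<lambda>x. (c k x * \<xi> k x)\<^sup>2)"
  proof (rule Bochner_Integration.integrable_bound)
    show "integrable M (\<lambda>x. (C k)\<^sup>2 * (\<xi> k x)\<^sup>2)" using mdsD(3)[OF \<xi>] by simp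
    show "AE x in M. norm ((c k x * \<xi> k x)\<^sup>2) \<le> norm ((C k)\<^sup>2 * (\<xi> k x)\<^sup>2)"
    proof (rule AE_I2)
      fix x assume "x \<in> space M"
      then have "(c k x)\<^sup>2 \<le> (C k)\<^sup>2" using bnd[of x k] by (metis abs_ge_zero power2_abs power_mono)
      then show "norm ((c k x * \<xi> k x)\<^sup>2) \<le> norm ((C k)\<^sup>2 * (\<xi> k x)\<^sup>2)"
        by (auto simp: power_mult_distrib intro: mult_right_mono)
    qed
  qed simp
  have "integrable M (\<lambda>x. c k x * \<xi> k x)" by (rule integrable_of_square) (use i2 in auto)
  from sigma_finite_subalgebra.real_cond_exp_mult[OF sigma_finite_sub c _ this]
  have "AE x in M. real_cond_exp M (H k) (\<lambda>x. c k x * \<xi> k x) x = c k x * real_cond_exp M (H k) (\<xi> k) x"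
    by simp
  then show "AE x in M. real_cond_exp M (H k) (\<lambda>x. c k x * \<xi> k x) x = 0"
    using mdsD(4)[OF \<xi>, of k] by eventually_elim simp
qed

lemma mds_orthogonal:
  assumes \<xi>: "mds \<xi>" and Z: "Z \<in> borel_measurable (H k)" "integrable M (\<lambda>x. (Z x)\<^sup>2)"
  shows "(\<integral>x. Z x * \<xi> k x \<partial>M) = 0"
proof -
  have "integrable M (\<lambda>x. Z x * \<xi> k x)"
    by (intro integrable_mult_of_squares H_M[OF Z(1)] Z(2) mdsD[OF \<xi>])
  from sigma_finite_subalgebra.real_cond_exp_intg(2)[OF sigma_finite_sub this Z(1) mdsD(2)[OF \<xi>]]
  have "(\<integral>x. Z x * \<xi> k x \<partial>M) = (\<integral>x. Z x * real_cond_exp M (H k) (\<xi> k) x \<partial>M)" ..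
  also have "\<dots> = (\<integral>x. 0 \<partial>M)"
    by (intro integral_cong_AE) (use mdsD(4)[OF \<xi>, of k] H_M[OF Z(1)] in auto)
  finally show ?thesis by simp
qed

lemma mds_sum_measurable:
  assumes \<xi>: "mds \<xi>" and "finite J" "\<And>k. k \<in> J \<Longrightarrow> k < n"
  shows "(\<lambda>x. \<Sum>k\<in>J. \<xi> k x) \<in> borel_measurable (H n)"
proof (rule borel_measurable_sum)
  fix k assume "k \<in> J"
  then have "Suc k \<le> n" using assms(3) by force
  then show "\<xi> k \<in> borel_measurable (H n)" using H_mono[OF mdsD(1)[OF \<xi>]] by blast
qed

lemma mds_sum_square:
  assumes \<xi>: "mds \<xi>"
  shows "integrable M (\<lambda>x. (\<Sum>k=m..<n. \<xi> k x)\<^sup>2)" (is "?I n")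
    and "(\<integral>x. (\<Sum>k=m..<n. \<xi> k x)\<^sup>2 \<partial>M) = (\<Sum>k=m..<n. \<integral>x. (\<xi> k x)\<^sup>2 \<partial>M)" (is "?E n")
proof -
  show I: "?I n" for n
    by (intro integrable_sum_square) (auto intro: mdsD[OF \<xi>])
  show "?E n"
  proof (induction n)
    case 0 then show ?case by simp
  next
    case (Suc n)
    show ?case
    proof (cases "m \<le> n")
      case True
      let ?S = "\<lambda>x. \<Sum>k=m..<n. \<xi> k x"
      have S: "?S \<in> borel_measurable (H n)" by (rule mds_sum_measurable[OF \<xi>]) auto
      have "(\<integral>x. (\<Sum>k=m..<Suc n. \<xi> k x)\<^sup>2 \<partial>M) = (\<integral>x. (?S x)\<^sup>2 + 2 * (?S x * \<xi> n x) + (\<xi> n x)\<^sup>2 \<partial>M)"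
        using True by (simp add: power2_sum algebra_simps)
      also have "\<dots> = (\<integral>x. (?S x)\<^sup>2 \<partial>M) + 2 * (\<integral>x. ?S x * \<xi> n x \<partial>M) + (\<integral>x. (\<xi> n x)\<^sup>2 \<partial>M)"
      proof -
        have "integrable M (\<lambda>x. ?S x * \<xi> n x)"
          by (intro integrable_mult_of_squares H_M[OF S] I mdsD[OF \<xi>])
        then show ?thesis using I[of n] mdsD(3)[OF \<xi>, of n] by simp
      qed
      also have "(\<integral>x. ?S x * \<xi> n x \<partial>M) = 0" by (rule mds_orthogonal[OF \<xi> S I])
      finally show ?thesis using Suc True by simp
    qed simp
  qed
qed

text \<open>Kolmogorov's maximal inequality, by stopping the sums when they first reach \<open>\<delta>\<close>.\<close>

lemma mds_maximal_inequality:
  assumes \<xi>: "mds \<xi>" and l: "0 < \<delta>"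
  shows "prob {x \<in> space M. \<exists>j\<in>{m..n}. \<delta> \<le> \<bar>\<Sum>k=m..<j. \<xi> k x\<bar>}
    \<le> (\<Sum>k=m..<n. \<integral>x. (\<xi> k x)\<^sup>2 \<partial>M) / \<delta>\<^sup>2"
proof -
  define S where "S j x = (\<Sum>k=m..<j. \<xi> k x)" for j x
  \<comment> \<open>Equal to 1 as long as no sum up to index \<open>k\<close> has reached
    \<open>\<delta>\<close>. As \<open>S k\<close> contains only terms before \<open>k\<close>, this
    is known at time \<open>k\<close>, and the stopped differences \<open>\<zeta>\<close> are again
    martingale differences.\<close>
  define c where "c k = (\<lambda>x. if \<forall>j\<in>{m..k}. \<bar>S j x\<bar> < \<delta> then 1 else 0 :: real)" for k
  define \<zeta> where "\<zeta> = (\<lambda>k x. c k x * \<xi> k x)"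
  have SH: "S j \<in> borel_measurable (H k)" if "j \<le> k" for j k
    unfolding S_def by (rule H_mono[OF _ that]) (rule mds_sum_measurable[OF \<xi>], auto)
  have cH: "c k \<in> borel_measurable (H k)" for k
  proof -
    have "{x \<in> space (H k). \<forall>j\<in>{m..k}. \<bar>S j x\<bar> < \<delta>} \<in> sets (H k)"
    proof (intro sets.sets_Collect_finite_All)
      fix j assume "j \<in> {m..k}"
      then have [measurable]: "S j \<in> borel_measurable (H k)" by (intro SH) simp
      show "{x \<in> space (H k). \<bar>S j x\<bar> < \<delta>} \<in> sets (H k)" by measurable
    qed simp
    then show ?thesis unfolding c_def by (intro measurable_If) simp_all
  qed
  have \<zeta>: "mds \<zeta>" unfolding \<zeta>_def
    by (rule mds_mult[OF \<xi> cH, where C = "\<lambda>_. 1"]) (auto simp: c_def)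
  note [measurable] = mdsD(2)[OF \<zeta>] mdsD(2)[OF \<xi>]
  \<comment> \<open>After the first passage \<open>i\<close> the stopped sum stays at
    \<open>S i\<close>, so the terminal value at \<open>n\<close> records the passage, and Markov's
    inequality for its square applies.\<close>
  have stop: "\<delta> \<le> \<bar>\<Sum>k=m..<n. \<zeta> k x\<bar>" if j: "j \<in> {m..n}" "\<delta> \<le> \<bar>S j x\<bar>" for j x
  proof -
    define i where "i = (LEAST i. m \<le> i \<and> \<delta> \<le> \<bar>S i x\<bar>)"
    have i: "m \<le> i" "\<delta> \<le> \<bar>S i x\<bar>" and ij: "i \<le> j"
      using LeastI[of "\<lambda>i. m \<le> i \<and> \<delta> \<le> \<bar>S i x\<bar>" j] Least_le[of "\<lambda>i. m \<le> i \<and> \<delta> \<le> \<bar>S i x\<bar>" j] j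
      by (auto simp: i_def)
    have lt: "\<bar>S k x\<bar> < \<delta>" if "m \<le> k" "k < i" for k
      using not_less_Least[of k "\<lambda>i. m \<le> i \<and> \<delta> \<le> \<bar>S i x\<bar>"] that by (auto simp: i_def)
    have c1: "c k x = 1" if "k < i" for k using lt that by (auto simp: c_def)
    have c0: "c k x = 0" if "i \<le> k" for k using i that by (force simp: c_def not_less)
    have "(\<Sum>k=m..<n. \<zeta> k x) = (\<Sum>k=m..<i. \<zeta> k x) + (\<Sum>k=i..<n. \<zeta> k x)"
      using i ij j by (intro sum.atLeastLessThan_concat[symmetric]) auto
    also have "(\<Sum>k=m..<i. \<zeta> k x) = S i x" unfolding S_def \<zeta>_def by (intro sum.cong) (auto simp: c1)
    also have "(\<Sum>k=i..<n. \<zeta> k x) = 0" by (intro sum.neutral) (auto simp: \<zeta>_def c0)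
    finally show ?thesis using i by simp
  qed
  have "prob {x \<in> space M. \<exists>j\<in>{m..n}. \<delta> \<le> \<bar>S j x\<bar>} \<le> prob {x \<in> space M. \<delta>\<^sup>2 \<le> (\<Sum>k=m..<n. \<zeta> k x)\<^sup>2}"
  proof (rule finite_measure_mono)
    show "{x \<in> space M. \<exists>j\<in>{m..n}. \<delta> \<le> \<bar>S j x\<bar>} \<subseteq> {x \<in> space M. \<delta>\<^sup>2 \<le> (\<Sum>k=m..<n. \<zeta> k x)\<^sup>2}"
    proof safe
      fix x j assume j: "j \<in> {m..n}" "\<delta> \<le> \<bar>S j x\<bar>"
      from stop[OF this] show "\<delta>\<^sup>2 \<le> (\<Sum>k=m..<n. \<zeta> k x)\<^sup>2"
        using l abs_le_square_iff[of \<delta> "\<Sum>k=m..<n. \<zeta> k x"] by auto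
    qed
  qed measurable
  also have "\<dots> \<le> (\<integral>x. (\<Sum>k=m..<n. \<zeta> k x)\<^sup>2 \<partial>M) / \<delta>\<^sup>2"
    by (rule integral_Markov_inequality_measure[where A = "{}"]) (use l mds_sum_square[OF \<zeta>] in auto)
  also have "\<dots> \<le> (\<Sum>k=m..<n. \<integral>x. (\<xi> k x)\<^sup>2 \<partial>M) / \<delta>\<^sup>2"
  proof (rule divide_right_mono)
    have "(\<zeta> k x)\<^sup>2 \<le> (\<xi> k x)\<^sup>2" for k x by (auto simp: \<zeta>_def c_def)
    then show "(\<integral>x. (\<Sum>k=m..<n. \<zeta> k x)\<^sup>2 \<partial>M) \<le> (\<Sum>k=m..<n. \<integral>x. (\<xi> k x)\<^sup>2 \<partial>M)"
      unfolding mds_sum_square(2)[OF \<zeta>]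
      by (intro sum_mono integral_mono mdsD(3)[OF \<zeta>] mdsD(3)[OF \<xi>]) auto
  qed simp
  finally show ?thesis unfolding S_def .
qed

text \<open>The maximal inequality started at \<open>m\<close> bounds the probability that the sums
  ever move by \<open>e\<close> after \<open>m\<close> by a tail of the variance series. As these
  tails vanish, almost every path is Cauchy.\<close>

lemma mds_convergent:
  assumes \<xi>: "mds \<xi>" and s: "summable (\<lambda>k. \<integral>x. (\<xi> k x)\<^sup>2 \<partial>M)"
  shows "AE x in M. summable (\<lambda>k. \<xi> k x)"
proof -
  define v where "v k = (\<integral>x. (\<xi> k x)\<^sup>2 \<partial>M)" for k
  note [measurable] = mdsD(2)[OF \<xi>]
  have v0: "0 \<le> v k" for k unfolding v_def by simp
  have sv: "summable v" using s unfolding v_def .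
  define A where "A e m n = {x \<in> space M. \<exists>j\<in>{m..n}. e \<le> \<bar>\<Sum>k=m..<j. \<xi> k x\<bar>}" for e :: real and m n :: nat
  have A_sets [measurable]: "A e m n \<in> sets M" for e m n unfolding A_def by measurable
  have tail: "prob (\<Union>n. A e m n) \<le> (\<Sum>k. v (k + m)) / e\<^sup>2" if e: "0 < e" for e m
  proof (rule LIMSEQ_le_const2)
    show "(\<lambda>n. prob (A e m n)) \<longlonglongrightarrow> prob (\<Union>n. A e m n)"
      by (rule finite_Lim_measure_incseq) (auto simp: incseq_def A_def)
    have "prob (A e m n) \<le> (\<Sum>k. v (k + m)) / e\<^sup>2" for n
    proof -
      have "prob (A e m n) \<le> (\<Sum>k=m..<n. v k) / e\<^sup>2"
        unfolding A_def v_def by (rule mds_maximal_inequality[OF \<xi> e])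
      also have "(\<Sum>k=m..<n. v k) \<le> (\<Sum>k. v (k + m))"
      proof (cases "m \<le> n")
        case True
        have "(\<Sum>k=m..<n. v k) = (\<Sum>k<n-m. v (k + m))"
          using sum.shift_bounds_nat_ivl[of v 0 m "n - m"] True by (simp add: atLeast0LessThan)
        also have "\<dots> \<le> (\<Sum>k. v (k + m))"
          by (rule sum_le_suminf) (use sv v0 in \<open>auto simp: summable_iff_shift\<close>)
        finally show ?thesis .
      next
        case False
        then show ?thesis by (auto intro!: suminf_nonneg simp: summable_iff_shift sv v0)
      qed
      finally show ?thesis by (simp add: divide_right_mono)
    qed
    then show "\<exists>N. \<forall>n\<ge>N. prob (A e m n) \<le> (\<Sum>k. v (k + m)) / e\<^sup>2" by blast
  qed
  have null: "AE x in M. \<exists>m. x \<notin> (\<Union>n. A e m n)" if e: "0 < e" for e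
  proof -
    have "prob (\<Inter>m. \<Union>n. A e m n) \<le> 0"
    proof (rule LIMSEQ_le_const)
      have "(\<lambda>m. (\<Sum>k. v (k + m))) \<longlonglongrightarrow> 0" by (rule suminf_exist_split2[OF sv])
      then show "(\<lambda>m. (\<Sum>k. v (k + m)) / e\<^sup>2) \<longlonglongrightarrow> 0" using tendsto_divide_zero by blast
      have "prob (\<Inter>m. \<Union>n. A e m n) \<le> (\<Sum>k. v (k + m)) / e\<^sup>2" for m
        by (rule order_trans[OF _ tail[OF e, of m]]) (intro finite_measure_mono, auto)
      then show "\<exists>N. \<forall>n\<ge>N. prob (\<Inter>m. \<Union>n. A e m n) \<le> (\<Sum>k. v (k + n)) / e\<^sup>2" by blast
    qed
    then have "prob (\<Inter>m. \<Union>n. A e m n) = 0" by (simp add: measure_le_0_iff)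
    then have "(\<Inter>m. \<Union>n. A e m n) \<in> null_sets M"
      by (simp add: emeasure_eq_measure null_sets_def)
    from AE_not_in[OF this] show ?thesis by eventually_elim auto
  qed
  have "AE x in M. \<forall>i::nat. \<exists>m. x \<notin> (\<Union>n. A (1 / Suc i) m n)"
    unfolding AE_all_countable by (intro allI null) simp
  with AE_space show ?thesis
  proof eventually_elim
    case (elim x)
    show ?case
    proof (unfold summable_Cauchy, intro allI impI)
      fix e :: real assume "0 < e"
      then obtain i where i: "1 / real (Suc i) < e / 2"
        using nat_approx_posE[of "e/2"] by auto
      from elim(2) obtain m where m: "\<And>n. x \<notin> A (1 / Suc i) m n" by blast
      have b: "\<bar>\<Sum>k=m..<j. \<xi> k x\<bar> < e / 2" if "m \<le> j" for j
        using m[of j] that i elim(1) by (force simp: A_def)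
      show "\<exists>N. \<forall>j\<ge>N. \<forall>n. norm (\<Sum>k=j..<n. \<xi> k x) < e"
      proof (intro exI[of _ m] allI impI)
        fix j n assume j: "m \<le> j"
        show "norm (\<Sum>k=j..<n. \<xi> k x) < e"
        proof (cases "j \<le> n")
          case True
          have "(\<Sum>k=m..<j. \<xi> k x) + (\<Sum>k=j..<n. \<xi> k x) = (\<Sum>k=m..<n. \<xi> k x)"
            using j True by (rule sum.atLeastLessThan_concat)
          then show ?thesis using b[of j] b[of n] j True by auto
        qed (use \<open>0 < e\<close> in simp)
      qed
    qed
  qed
qed

lemma mds_weighted_square:
  assumes \<xi>: "mds \<xi>" and c: "c \<in> borel_measurable (H k)"
    and bnd: "\<And>x. x \<in> space M \<Longrightarrow> \<bar>c x\<bar> \<le> C"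
  shows "(\<integral>x. (c x * \<xi> k x)\<^sup>2 \<partial>M) = (\<integral>x. (c x)\<^sup>2 * real_cond_exp M (H k) (\<lambda>x. (\<xi> k x)\<^sup>2) x \<partial>M)"
    and "integrable M (\<lambda>x. (c x)\<^sup>2 * real_cond_exp M (H k) (\<lambda>x. (\<xi> k x)\<^sup>2) x)"
proof -
  note [measurable] = mdsD(2)[OF \<xi>, of k] H_M[OF c] c
  have "integrable M (\<lambda>x. (c x)\<^sup>2 * (\<xi> k x)\<^sup>2)"
  proof (rule Bochner_Integration.integrable_bound)
    show "integrable M (\<lambda>x. C\<^sup>2 * (\<xi> k x)\<^sup>2)" using mdsD(3)[OF \<xi>] by simp
    show "AE x in M. norm ((c x)\<^sup>2 * (\<xi> k x)\<^sup>2) \<le> norm (C\<^sup>2 * (\<xi> k x)\<^sup>2)"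
    proof (rule AE_I2)
      fix x assume "x \<in> space M"
      then have "(c x)\<^sup>2 \<le> C\<^sup>2" using bnd[of x] by (metis abs_ge_zero power2_abs power_mono)
      then show "norm ((c x)\<^sup>2 * (\<xi> k x)\<^sup>2) \<le> norm (C\<^sup>2 * (\<xi> k x)\<^sup>2)"
        by (auto simp: power_mult_distrib intro: mult_right_mono)
    qed
  qed simp
  from sigma_finite_subalgebra.real_cond_exp_intg[OF sigma_finite_sub this]
  show "(\<integral>x. (c x * \<xi> k x)\<^sup>2 \<partial>M) = (\<integral>x. (c x)\<^sup>2 * real_cond_exp M (H k) (\<lambda>x. (\<xi> k x)\<^sup>2) x \<partial>M)"
    "integrable M (\<lambda>x. (c x)\<^sup>2 * real_cond_exp M (H k) (\<lambda>x. (\<xi> k x)\<^sup>2) x)"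
    by (simp_all add: power_mult_distrib)
qed

text \<open>Localization: the coefficients are cut off once their sum of squares, or the conditional
  variance, exceeds \<open>K\<close>; almost surely some \<open>K\<close> cuts off nothing.\<close>

lemma mds_local_convergent:
  assumes \<eta>: "mds \<eta>" and c: "\<And>k. c k \<in> borel_measurable (H k)"
    and w: "AE x in M. \<exists>K. \<forall>k. real_cond_exp M (H k) (\<lambda>x. (\<eta> k x)\<^sup>2) x \<le> K"
    and s: "AE x in M. summable (\<lambda>k. (c k x)\<^sup>2)"
  shows "AE x in M. summable (\<lambda>k. c k x * \<eta> k x)"
proof -
  define v where "v k = real_cond_exp M (H k) (\<lambda>x. (\<eta> k x)\<^sup>2)" for k
  \<comment> \<open>Membership at \<open>k\<close> is decided by \<open>H k\<close>, so the cut off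
    coefficients remain predictable. The conditional variance may exceed \<open>K\<close> at one
    index and not at the next; indices are dropped one by one instead of stopping for good.\<close>
  define G where "G K k = {x \<in> space M. (\<Sum>j\<le>k. (c j x)\<^sup>2) \<le> real K \<and> v k x \<le> real K}" for K k :: nat
  define \<xi> where "\<xi> K = (\<lambda>k x. (indicator (G K k) x * c k x) * \<eta> k x)" for K
  have vH [measurable]: "v k \<in> borel_measurable (H k)" for k unfolding v_def by simp
  have GH: "G K k \<in> sets (H k)" for K k
  proof -
    have [measurable]: "c j \<in> borel_measurable (H k)" if "j \<in> {..k}" for j
      using H_mono[OF c, of j k] that by simp
    show ?thesis unfolding G_def space_H[of k, symmetric] by measurable
  qed
  have dH: "(\<lambda>x. indicator (G K k) x * c k x) \<in> borel_measurable (H k)" for K k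
    using GH c by simp
  have sq: "(c k x)\<^sup>2 \<le> real K" if "x \<in> G K k" for K k x
  proof -
    have "(c k x)\<^sup>2 \<le> (\<Sum>j\<le>k. (c j x)\<^sup>2)" by (rule member_le_sum) auto
    then show ?thesis using that by (auto simp: G_def)
  qed
  have bnd: "\<bar>indicator (G K k) x * c k x\<bar> \<le> sqrt (real K)" for K k x
    using sq[of x K k] real_sqrt_le_mono by (fastforce simp: indicator_def)
  have \<xi>: "mds (\<xi> K)" for K unfolding \<xi>_def
    by (rule mds_mult[OF \<eta> dH, where C = "\<lambda>_. sqrt (real K)"]) (rule bnd)
  \<comment> \<open>If index \<open>n\<close> is kept, the full sum of squares up to
    \<open>n\<close> is at most \<open>K\<close>; if it is dropped, nothing is added to the previous
    sum.\<close>
  have sumle: "(\<Sum>k<n. indicator (G K k) x * (c k x)\<^sup>2) \<le> real K" for n K x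
  proof (induction n)
    case (Suc n)
    show ?case
    proof (cases "x \<in> G K n")
      case True
      have "(\<Sum>k<Suc n. indicator (G K k) x * (c k x)\<^sup>2) \<le> (\<Sum>j<Suc n. (c j x)\<^sup>2)"
        by (intro sum_mono) (auto simp: indicator_def)
      then show ?thesis using True by (auto simp: G_def lessThan_Suc_atMost)
    qed (use Suc in simp)
  qed simp
  \<comment> \<open>In the bound \<open>K * K\<close> one factor comes from the conditional variance
    on the kept indices, the other from the sum of the kept squares.\<close>
  have "summable (\<lambda>k. \<integral>x. (\<xi> K k x)\<^sup>2 \<partial>M)" for K
  proof (rule bounded_imp_summable[where B = "real K * real K"])
    fix n
    define u where "u k x = indicator (G K k) x * (c k x)\<^sup>2" for k x
    have um [measurable]: "u k \<in> borel_measurable M" for k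
      unfolding u_def using GH[of K k] sub[of k] H_M[OF c, of k]
      by (auto simp: subalgebra_def intro!: borel_measurable_times borel_measurable_indicator)
    have u: "0 \<le> u k x" "u k x \<le> real K" for k x
      using sq[of x K k] by (auto simp: u_def indicator_def)
    have ui: "integrable M (u k)" for k
      by (rule integrable_const_bound[where B = "real K"]) (use u in auto)
    have "(\<integral>x. (\<xi> K k x)\<^sup>2 \<partial>M) \<le> (\<integral>x. real K * u k x \<partial>M)" for k
    proof -
      have *: "(indicator (G K k) x * c k x)\<^sup>2 * v k x \<le> real K * u k x" for x
        by (auto simp: indicator_def u_def G_def mult.commute[of _ "v k x"] intro: mult_right_mono)
      show ?thesis
        unfolding \<xi>_def mds_weighted_square(1)[OF \<eta> dH bnd]
        using mds_weighted_square(2)[OF \<eta> dH bnd] ui *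
        by (intro integral_mono) (auto simp: v_def)
    qed
    then have "(\<Sum>k<Suc n. \<integral>x. (\<xi> K k x)\<^sup>2 \<partial>M) \<le> (\<Sum>k<Suc n. \<integral>x. real K * u k x \<partial>M)" by (rule sum_mono)
    also have "\<dots> = (\<integral>x. real K * (\<Sum>k<Suc n. u k x) \<partial>M)"
      by (simp add: ui sum_distrib_left Bochner_Integration.integral_sum distrib_left)
    also have "\<dots> \<le> (\<integral>x. real K * real K \<partial>M)"
    proof (rule integral_mono)
      show "real K * (\<Sum>k<Suc n. u k x) \<le> real K * real K" for x
        using sumle[of K x "Suc n"] by (intro mult_left_mono) (auto simp: u_def)
    qed (auto simp: ui)
    also have "\<dots> = real K * real K" by (simp add: prob_space)
    finally show "(\<Sum>k\<le>n. \<integral>x. (\<xi> K k x)\<^sup>2 \<partial>M) \<le> real K * real K" by (simp add: lessThan_Suc_atMost)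
  qed simp
  from mds_convergent[OF \<xi> this] have "AE x in M. \<forall>K. summable (\<lambda>k. \<xi> K k x)"
    unfolding AE_all_countable by blast
  with w s AE_space show ?thesis
  proof eventually_elim
    case (elim x)
    obtain K1 where K1: "\<And>k. v k x \<le> K1" using elim(1) unfolding v_def by blast
    have le: "(\<Sum>j\<le>k. (c j x)\<^sup>2) \<le> (\<Sum>j. (c j x)\<^sup>2)" for k
      by (intro sum_le_suminf elim(2)) auto
    obtain K :: nat where "max K1 (\<Sum>j. (c j x)\<^sup>2) \<le> real K" using real_arch_simple by blast
    then have "x \<in> G K k" for k using K1[of k] le[of k] elim(3) unfolding G_def by simp
    then have "\<xi> K k x = c k x * \<eta> k x" for k unfolding \<xi>_def by simp
    moreover have "summable (\<lambda>k. \<xi> K k x)" using elim(4) by blast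
    ultimately show ?case by simp
  qed
qed

end

section \<open>Conditional independence\<close>

definition sigma_gen :: "'a measure \<Rightarrow> (nat \<Rightarrow> 'a \<Rightarrow> real) \<Rightarrow> nat set \<Rightarrow> 'a measure" where
  "sigma_gen M X J = sigma (space M) {X k -` B \<inter> space M | k B. k \<in> J \<and> B \<in> sets borel}"

lemma sigma_X_eq: "sigma_X M X n = sigma_gen M X (tree n)"
  by (simp add: sigma_X_def sigma_gen_def)

lemma space_sigma_gen [simp]: "space (sigma_gen M X J) = space M"
  unfolding sigma_gen_def by (rule space_measure_of) auto

lemma sets_sigma_gen:
  "sets (sigma_gen M X J) = sigma_sets (space M) {X k -` B \<inter> space M | k B. k \<in> J \<and> B \<in> sets borel}"
  unfolding sigma_gen_def by (rule sets_measure_of) auto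

lemma measurable_sigma_gen: "k \<in> J \<Longrightarrow> X k \<in> borel_measurable (sigma_gen M X J)"
  by (rule measurableI) (auto simp: sets_sigma_gen intro!: sigma_sets.Basic)

lemma sigma_gen_le:
  assumes "\<And>k. k \<in> J \<Longrightarrow> X k \<in> borel_measurable M'" "space M' = space M"
  shows "subalgebra M' (sigma_gen M X J)"
  unfolding subalgebra_def
proof
  show "sets (sigma_gen M X J) \<subseteq> sets M'"
    unfolding sets_sigma_gen assms(2)[symmetric]
    by (rule sets.sigma_sets_subset) (use assms(1) in \<open>auto simp: assms(2)[symmetric] intro: measurable_sets\<close>)
qed (simp add: assms)

lemma sigma_gen_mono: "J \<subseteq> J' \<Longrightarrow> subalgebra (sigma_gen M X J') (sigma_gen M X J)"
  by (rule sigma_gen_le) (auto intro: measurable_sigma_gen)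

text \<open>Conditional independence gives the claim for indicators of events in \<open>U k\<close>,
  tested on the intersections of a set of \<open>F\<close> with events in the other variables. These
  form an intersection-stable generator, so uniqueness of finite measures extends the identity to
  \<open>G\<close>, and a comparison of two laws of \<open>U k\<close> passes from indicators to
  \<open>f\<close>.\<close>

lemma cond_indep_vars_real_cond_exp:
  fixes f :: "'b \<Rightarrow> real" and U :: "'i \<Rightarrow> 'a \<Rightarrow> 'b"
  assumes M: "prob_space M" and F: "subalgebra M F" and G: "subalgebra M G" and FG: "subalgebra G F"
    and U: "\<And>i. i \<in> insert k K \<Longrightarrow> U i \<in> measurable M N"
    and indep: "cond_indep_vars M F N U I" and KI: "insert k K \<subseteq> I" "finite K" "k \<notin> K"
    and gen: "sets G \<subseteq> sigma_sets (space M) {A \<inter> {x \<in> space M. \<forall>m\<in>K. U m x \<in> B m} | A B. A \<in> sets F \<and> (\<forall>m\<in>K. B m \<in> sets N)}"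
    and f: "f \<in> borel_measurable N" and int: "integrable M (\<lambda>x. f (U k x))"
  shows "AE x in M. real_cond_exp M G (\<lambda>x. f (U k x)) x = real_cond_exp M F (\<lambda>x. f (U k x)) x"
proof -
  interpret prob_space M by (rule M)
  \<comment> \<open>A two-step filtration, set up to have \<open>F\<close> and \<open>G\<close>
    available as sigma-finite subalgebras.\<close>
  interpret filt: filtration M "\<lambda>n. if n = (0::nat) then F else G"
    by unfold_locales (use F G FG in \<open>auto simp: subalgebra_def\<close>)
  interpret SF: sigma_finite_subalgebra M F using filt.sigma_finite_sub[of 0] by simp
  interpret SG: sigma_finite_subalgebra M G using filt.sigma_finite_sub[of 1] by simp
  note [measurable] = U[of k, simplified]
  have FM: "A \<in> sets M" if "A \<in> sets F" for A using F that by (auto simp: subalgebra_def)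
  have GM: "A \<in> sets M" if "A \<in> sets G" for A using G that by (auto simp: subalgebra_def)
  define P where "P = {A \<inter> {x \<in> space M. \<forall>m\<in>K. U m x \<in> B m} | A B. A \<in> sets F \<and> (\<forall>m\<in>K. B m \<in> sets N)}"
  define Kset where "Kset B = {x \<in> space M. \<forall>m\<in>K. U m x \<in> B m}" for B
  have Kset: "Kset B \<in> sets M" if "\<And>m. m \<in> K \<Longrightarrow> B m \<in> sets N" for B
  proof -
    show ?thesis unfolding Kset_def
    proof (intro sets.sets_Collect_finite_All)
      fix m assume m: "m \<in> K"
      have "U m -` B m \<inter> space M \<in> sets M" by (rule measurable_sets) (use U m that in auto)
      also have "U m -` B m \<inter> space M = {x \<in> space M. U m x \<in> B m}" by auto
      finally show "{x \<in> space M. U m x \<in> B m} \<in> sets M" .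
    qed (rule KI)
  qed
  have P_eq: "P = {A \<inter> Kset B | A B. A \<in> sets F \<and> (\<forall>m\<in>K. B m \<in> sets N)}"
    unfolding P_def Kset_def ..
  have PM: "P \<subseteq> sets M" unfolding P_eq using FM Kset by auto
  have Pint: "Int_stable P"
  proof (rule Int_stableI)
    fix a b assume "a \<in> P" "b \<in> P"
    then obtain A B A' B' where *: "a = A \<inter> Kset B" "A \<in> sets F" "\<And>m. m \<in> K \<Longrightarrow> B m \<in> sets N"
      "b = A' \<inter> Kset B'" "A' \<in> sets F" "\<And>m. m \<in> K \<Longrightarrow> B' m \<in> sets N"
      unfolding P_eq by blast
    have "a \<inter> b = (A \<inter> A') \<inter> Kset (\<lambda>m. B m \<inter> B' m)" unfolding * by (auto simp: Kset_def)
    moreover have "A \<inter> A' \<in> sets F" "\<forall>m\<in>K. B m \<inter> B' m \<in> sets N" using * by auto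
    ultimately show "a \<inter> b \<in> P" unfolding P_eq
      by (intro CollectI exI[of _ "A \<inter> A'"] exI[of _ "\<lambda>m. B m \<inter> B' m"] conjI)
  qed
  have spP: "space M \<in> P"
  proof -
    have "space M = space M \<inter> Kset (\<lambda>m. space N)" using U by (auto simp: Kset_def dest: measurable_space)
    moreover have "space M \<in> sets F" using F by (metis sets.top subalgebra_def)
    ultimately show ?thesis unfolding P_eq by blast
  qed
  define ind where "ind B = (indicator (U k -` B \<inter> space M) :: 'a \<Rightarrow> real)" for B
  define q where "q B = real_cond_exp M F (ind B)" for B
  have indm [measurable]: "ind B \<in> borel_measurable M" if "B \<in> sets N" for B
    unfolding ind_def using that by measurable
  have indi: "integrable M (ind B)" if "B \<in> sets N" for B
    unfolding ind_def using that by (intro integrable_real_indicator) (auto simp: emeasure_eq_measure)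
  have qF [measurable]: "q B \<in> borel_measurable F" for B unfolding q_def by simp
  have qM [measurable]: "q B \<in> borel_measurable M" for B unfolding q_def by simp
  have qi: "integrable M (q B)" if "B \<in> sets N" for B
    unfolding q_def by (rule SF.real_cond_exp_int(1)[OF indi[OF that]])
  have q0: "AE x in M. 0 \<le> q B x" if "B \<in> sets N" for B
    unfolding q_def by (rule SF.real_cond_exp_pos) (use indm[OF that] in \<open>auto simp: ind_def\<close>)
  have bnd_int: "integrable M (\<lambda>x. indicator A x * g x)" if "A \<in> sets M" "integrable M g" for A and g :: "'a \<Rightarrow> real"
    using integrable_mult_indicator[OF that] by simp
  have base: "(\<integral>x. indicator a x * ind B x \<partial>M) = (\<integral>x. indicator a x * q B x \<partial>M)"
    if a: "a \<in> P" and B: "B \<in> sets N" for a B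
  proof -
    from a obtain A C where A: "a = A \<inter> Kset C" "A \<in> sets F" and C: "\<And>m. m \<in> K \<Longrightarrow> C m \<in> sets N"
      unfolding P_eq by blast
    \<comment> \<open>The empty family is separate: \<open>cond_indep_vars\<close> speaks of
      nonempty index sets, and an intersection over no index would be the whole type instead of
      \<open>space M\<close>.\<close>
    show ?thesis
    proof (cases "K = {}")
      case True
      then have "a = A" using A sets.sets_into_space[OF FM[OF A(2)]] by (auto simp: Kset_def)
      then show ?thesis
        using SF.real_cond_exp_intg(2)[of "indicator A" "ind B"] A(2) bnd_int[OF FM[OF A(2)] indi[OF B]] B
        unfolding q_def by simp
    next
      case False
      define D where "D = (\<lambda>m. if m = k then B else C m)"
      define pr where "pr = (\<lambda>m. real_cond_exp M F (indicator (U m -` C m \<inter> space M)))"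
      have KC: "Kset C = (\<Inter>m\<in>K. U m -` C m \<inter> space M)" using False by (auto simp: Kset_def)
      have ins: "(\<Inter>m\<in>insert k K. U m -` D m \<inter> space M) = Kset C \<inter> (U k -` B \<inter> space M)"
      proof -
        have "(\<Inter>m\<in>K. U m -` D m \<inter> space M) = Kset C"
          unfolding KC using KI(3) by (intro INF_cong) (auto simp: D_def)
        then show ?thesis by (auto simp: D_def)
      qed
      note indep' = indep[unfolded cond_indep_vars_def, rule_format]
      have 1: "AE x in M. real_cond_exp M F (indicator (Kset C)) x = (\<Prod>m\<in>K. pr m x)"
        unfolding KC pr_def by (rule indep') (use KI False C in auto)
      have "AE x in M. real_cond_exp M F (indicator (\<Inter>m\<in>insert k K. U m -` D m \<inter> space M)) x =
        (\<Prod>m\<in>insert k K. real_cond_exp M F (indicator (U m -` D m \<inter> space M)) x)"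
        by (rule indep') (use KI C B in \<open>auto simp: D_def\<close>)
      moreover have "(\<Prod>m\<in>insert k K. real_cond_exp M F (indicator (U m -` D m \<inter> space M)) x) = q B x * (\<Prod>m\<in>K. pr m x)" for x
        using KI by (auto simp: q_def ind_def pr_def D_def intro!: prod.cong)
      ultimately have 2: "AE x in M. real_cond_exp M F (indicator (Kset C \<inter> (U k -` B \<inter> space M))) x =
        q B x * (\<Prod>m\<in>K. pr m x)" unfolding ins by simp
      have E: "Kset C \<inter> (U k -` B \<inter> space M) \<in> sets M" using Kset[OF C] B by auto
      have "(\<integral>x. indicator a x * ind B x \<partial>M) = (\<integral>x. indicator A x * indicator (Kset C \<inter> (U k -` B \<inter> space M)) x \<partial>M)"
        by (intro Bochner_Integration.integral_cong) (auto simp: A ind_def indicator_def)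
      also have "\<dots> = (\<integral>x. indicator A x * real_cond_exp M F (indicator (Kset C \<inter> (U k -` B \<inter> space M))) x \<partial>M)"
      proof (rule SF.real_cond_exp_intg(2)[symmetric])
        have "integrable M (indicator (Kset C \<inter> (U k -` B \<inter> space M)) :: 'a \<Rightarrow> real)"
          by (rule integrable_real_indicator[OF E]) (simp add: emeasure_eq_measure)
        then show "integrable M (\<lambda>x. indicator A x * indicator (Kset C \<inter> (U k -` B \<inter> space M)) x :: real)"
          by (rule bnd_int[OF FM[OF A(2)]])
        show "indicator A \<in> borel_measurable F" by (rule borel_measurable_indicator[OF A(2)])
        show "indicator (Kset C \<inter> (U k -` B \<inter> space M)) \<in> borel_measurable M"
          by (rule borel_measurable_indicator[OF E])
      qed
      also have "\<dots> = (\<integral>x. (indicator A x * q B x) * real_cond_exp M F (indicator (Kset C)) x \<partial>M)"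
      proof (intro integral_cong_AE)
        have m1: "real_cond_exp M F u \<in> borel_measurable M" for u by (rule borel_measurable_cond_exp2)
        have m2: "(indicator A :: 'a \<Rightarrow> real) \<in> borel_measurable M"
          by (rule borel_measurable_indicator[OF FM[OF A(2)]])
        show "(\<lambda>x. indicator A x * real_cond_exp M F (indicator (Kset C \<inter> (U k -` B \<inter> space M))) x) \<in> borel_measurable M"
          by (rule borel_measurable_times[OF m2 m1])
        show "(\<lambda>x. (indicator A x * q B x) * real_cond_exp M F (indicator (Kset C)) x) \<in> borel_measurable M"
          by (rule borel_measurable_times[OF borel_measurable_times[OF m2 qM] m1])
        show "AE x in M. indicator A x * real_cond_exp M F (indicator (Kset C \<inter> (U k -` B \<inter> space M))) x =
          (indicator A x * q B x) * real_cond_exp M F (indicator (Kset C)) x"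
          using 1 2
        proof eventually_elim
          case (elim x)
          show ?case unfolding elim by (rule mult.assoc[symmetric])
        qed
      qed
      also have "\<dots> = (\<integral>x. (indicator A x * q B x) * indicator (Kset C) x \<partial>M)"
      proof (rule SF.real_cond_exp_intg(2))
        have "integrable M (\<lambda>x. indicator (Kset C) x * (indicator A x * q B x))"
          using A FM Kset[OF C] qi[OF B] by (intro bnd_int) auto
        then show "integrable M (\<lambda>x. indicator A x * q B x * indicator (Kset C) x)" by (simp add: mult.commute)
      qed (use A Kset[OF C] in auto)
      also have "\<dots> = (\<integral>x. indicator a x * q B x \<partial>M)"
        by (intro Bochner_Integration.integral_cong) (auto simp: A indicator_def)
      finally show ?thesis .
    qed
  qed
  have nn_eq: "emeasure (density M (\<lambda>x. ennreal (g x))) A = ennreal (\<integral>x. indicator A x * g x \<partial>M)"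
    if "integrable M g" "AE x in M. 0 \<le> g x" "A \<in> sets M" for g :: "'a \<Rightarrow> real" and A
  proof -
    have "emeasure (density M (\<lambda>x. ennreal (g x))) A = (\<integral>\<^sup>+x. ennreal (indicator A x * g x) \<partial>M)"
      using that by (subst emeasure_density) (auto simp: indicator_def intro!: nn_integral_cong)
    also have "\<dots> = ennreal (\<integral>x. indicator A x * g x \<partial>M)"
      using that by (intro nn_integral_eq_integral bnd_int) (auto elim!: eventually_mono)
    finally show ?thesis .
  qed
  \<comment> \<open>As functions of \<open>A\<close>, both sides are finite measures, with densities
    \<open>ind B\<close> and \<open>q B\<close>. They agree on the intersection-stable
    \<open>P\<close>, which contains the whole space, hence on \<open>G\<close>.\<close>
  have step1: "(\<integral>x. indicator A x * ind B x \<partial>M) = (\<integral>x. indicator A x * q B x \<partial>M)"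
    if A: "A \<in> sets G" and B: "B \<in> sets N" for A B
  proof -
    let ?S = "sigma (space M) P"
    have spS: "space ?S = space M" by (rule space_measure_of) (use PM sets.sets_into_space in auto)
    have setsS: "sets ?S = sigma_sets (space M) P" by (rule sets_measure_of) (use PM sets.sets_into_space in auto)
    have sub: "subalgebra (density M g) ?S" for g
      using sets.sigma_sets_subset[OF PM] spS setsS by (auto simp: subalgebra_def)
    let ?m1 = "restr_to_subalg (density M (\<lambda>x. ennreal (ind B x))) ?S"
    let ?m2 = "restr_to_subalg (density M (\<lambda>x. ennreal (q B x))) ?S"
    have ind0: "AE x in M. 0 \<le> ind B x" by (auto simp: ind_def)
    have em: "emeasure (restr_to_subalg (density M (\<lambda>x. ennreal (g x))) ?S) C = ennreal (\<integral>x. indicator C x * g x \<partial>M)"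
      if "integrable M g" "AE x in M. 0 \<le> g x" "C \<in> sigma_sets (space M) P" for g C
    proof -
      have "C \<in> sets ?S" using that(3) setsS by simp
      moreover have "C \<in> sets M" using that(3) sets.sigma_sets_subset[OF PM] by auto
      ultimately show ?thesis using emeasure_restr_to_subalg[OF sub] nn_eq[OF that(1,2)] by simp
    qed
    have "?m1 = ?m2"
    proof (rule measure_eqI_generator_eq[OF Pint, where \<Omega> = "space M" and A = "\<lambda>_. space M"])
      fix C assume "C \<in> P"
      then show "emeasure ?m1 C = emeasure ?m2 C"
        using em[OF indi[OF B] ind0, of C] em[OF qi[OF B] q0[OF B], of C] base[OF _ B] by auto
    next
      show "sets ?m1 = sigma_sets (space M) P" "sets ?m2 = sigma_sets (space M) P"
        using sub setsS by (simp_all add: sets_restr_to_subalg)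
      show "emeasure ?m1 (space M) \<noteq> \<infinity>" for i :: nat
        using em[OF indi[OF B] ind0, of "space M"] spP by (auto simp: sigma_sets.Basic)
    qed (use PM sets.sets_into_space spP in auto)
    moreover have "A \<in> sigma_sets (space M) P" using A gen unfolding P_def by blast
    ultimately have "ennreal (\<integral>x. indicator A x * ind B x \<partial>M) = ennreal (\<integral>x. indicator A x * q B x \<partial>M)"
      using em[OF indi[OF B] ind0, of A] em[OF qi[OF B] q0[OF B], of A] by simp
    moreover have "0 \<le> (\<integral>x. indicator A x * ind B x \<partial>M)" by (auto simp: ind_def)
    moreover have "0 \<le> (\<integral>x. indicator A x * q B x \<partial>M)"
      by (rule integral_nonneg_AE) (use q0[OF B] in \<open>auto elim!: eventually_mono\<close>)
    ultimately show ?thesis by simp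
  qed
  define fU where "fU x = f (U k x)" for x
  have fUm [measurable]: "fU \<in> borel_measurable M" unfolding fU_def using f by measurable
  have fUi: "integrable M fU" using int unfolding fU_def .
  have "AE x in M. real_cond_exp M G fU x = real_cond_exp M F fU x"
  proof (rule SG.real_cond_exp_charact)
    show "integrable M (real_cond_exp M F fU)" by (rule SF.real_cond_exp_int(1)[OF fUi])
    show "real_cond_exp M F fU \<in> borel_measurable G"
      by (rule measurable_from_subalg[OF FG borel_measurable_cond_exp])
    fix A assume A: "A \<in> sets G"
    note AM [measurable] = GM[OF A]
    \<comment> \<open>With \<open>h\<close> the conditional probability of \<open>A\<close> given
      \<open>F\<close>, \<open>U k\<close> has the same law under the densities
      \<open>indicator A\<close> and \<open>h\<close>. Integrating \<open>f\<close> against both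
      laws replaces an approximation by simple functions.\<close>
    define h where "h = real_cond_exp M F (indicator A :: 'a \<Rightarrow> real)"
    have hF [measurable]: "h \<in> borel_measurable F" and hM [measurable]: "h \<in> borel_measurable M"
      unfolding h_def by (rule borel_measurable_cond_exp, rule borel_measurable_cond_exp2)
    have iA: "integrable M (indicator A :: 'a \<Rightarrow> real)"
      by (rule integrable_real_indicator[OF AM]) (simp add: emeasure_eq_measure)
    have hi: "integrable M h" unfolding h_def by (rule SF.real_cond_exp_int(1)[OF iA])
    have h0: "AE x in M. 0 \<le> h x" unfolding h_def by (rule SF.real_cond_exp_pos) auto
    have h1: "AE x in M. h x \<le> 1"
      unfolding h_def by (rule SF.real_cond_exp_le_c) (use iA in \<open>auto simp: indicator_def\<close>)
    have hint: "integrable M (\<lambda>x. h x * g x)" if "integrable M g" for g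
    proof (rule Bochner_Integration.integrable_bound[OF that])
      show "AE x in M. norm (h x * g x) \<le> norm (g x)"
        using h0 h1 by eventually_elim (auto simp: abs_mult intro: mult_left_le_one_le)
    qed (use that in auto)
    let ?n1 = "distr (density M (\<lambda>x. ennreal (indicator A x))) N (U k)"
    let ?n2 = "distr (density M (\<lambda>x. ennreal (h x))) N (U k)"
    have "?n1 = ?n2"
    proof (rule measure_eqI)
      fix B assume "B \<in> sets ?n1"
      then have B: "B \<in> sets N" by simp
      have V: "U k -` B \<inter> space M \<in> sets M" using B by measurable
      have "emeasure ?n1 B = ennreal (\<integral>x. indicator (U k -` B \<inter> space M) x * indicator A x \<partial>M)"
        using V B nn_eq[OF iA _ V] by (subst emeasure_distr) auto
      also have "(\<integral>x. indicator (U k -` B \<inter> space M) x * indicator A x \<partial>M) = (\<integral>x. indicator A x * ind B x \<partial>M)"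
        by (simp add: ind_def mult.commute)
      also have "\<dots> = (\<integral>x. indicator A x * q B x \<partial>M)" by (rule step1[OF A B])
      also have "\<dots> = (\<integral>x. q B x * h x \<partial>M)"
        unfolding h_def
        by (subst SF.real_cond_exp_intg(2)) (use bnd_int[OF AM qi[OF B]] in \<open>auto simp: mult.commute\<close>)
      also have "\<dots> = (\<integral>x. h x * ind B x \<partial>M)"
        unfolding q_def using hint[OF indi[OF B]] B
        by (subst SF.real_cond_exp_intg(2)[symmetric]) (auto simp: mult.commute)
      also have "ennreal \<dots> = emeasure ?n2 B"
        using V B nn_eq[OF hi h0 V] by (subst emeasure_distr) (auto simp: ind_def mult.commute)
      finally show "emeasure ?n1 B = emeasure ?n2 B" .
    qed simp
    then have "(\<integral>y. f y \<partial>?n1) = (\<integral>y. f y \<partial>?n2)" by simp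
    then have *: "(\<integral>x. indicator A x * fU x \<partial>M) = (\<integral>x. h x * fU x \<partial>M)"
      using f h0 by (simp add: integral_distr integral_density fU_def)
    have Fi: "integrable M (\<lambda>x. h x * real_cond_exp M F fU x)"
      by (rule hint[OF SF.real_cond_exp_int(1)[OF fUi]])
    have "(\<integral>x. h x * fU x \<partial>M) = (\<integral>x. h x * real_cond_exp M F fU x \<partial>M)"
      by (rule SF.real_cond_exp_intg(2)[symmetric]) (use hint[OF fUi] in auto)
    also have "\<dots> = (\<integral>x. real_cond_exp M F fU x * real_cond_exp M F (indicator A) x \<partial>M)"
      by (simp add: h_def mult.commute)
    also have "\<dots> = (\<integral>x. real_cond_exp M F fU x * indicator A x \<partial>M)"
      by (rule SF.real_cond_exp_intg(2)) (use bnd_int[OF AM SF.real_cond_exp_int(1)[OF fUi]] in \<open>auto simp: mult.commute\<close>)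
    finally show "(\<integral>x\<in>A. fU x \<partial>M) = (\<integral>x\<in>A. real_cond_exp M F fU x \<partial>M)"
      using * by (simp add: set_lebesgue_integral_def mult.commute)
  qed (rule fUi)
  then show ?thesis unfolding fU_def .
qed

section \<open>The bifurcating autoregressive process\<close>

lemma gen_set_eq: "gen_set n = {2 ^ n..<2 ^ Suc n}"
proof -
  have "Suc (2 ^ (n + 1) - 1) = 2 ^ Suc n" by simp
  then show ?thesis unfolding gen_set_def by (metis atLeastLessThanSuc_atLeastAtMost)
qed

lemma finite_gen_set [simp]: "finite (gen_set n)" by (simp add: gen_set_eq)

lemma card_gen_set: "card (gen_set n) = 2 ^ n" by (simp add: gen_set_eq)

lemma UN_gen_set: "(\<Union>l<n. gen_set l) = {1..<2 ^ n}"
proof (induction n)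
  case (Suc n)
  have "(\<Union>l<Suc n. gen_set l) = {1..<2 ^ n} \<union> {2 ^ n..<2 ^ Suc n}"
    by (simp add: lessThan_Suc Suc gen_set_eq[of n] Un_commute)
  also have "\<dots> = {1..<2 ^ Suc n}" by (intro ivl_disj_un) auto
  finally show ?case .
qed simp

lemma gen_set_disjoint: "l \<noteq> m \<Longrightarrow> gen_set l \<inter> gen_set m = {}"
proof -
  have "gen_set l \<inter> gen_set m = {}" if "l < m" for l m
  proof -
    have "(2::nat) ^ Suc l \<le> 2 ^ m" using that by (intro power_increasing) auto
    then show ?thesis by (auto simp: gen_set_eq)
  qed
  then show "l \<noteq> m \<Longrightarrow> gen_set l \<inter> gen_set m = {}" by (metis Int_commute nat_neq_iff)
qed

lemma sum_gen_set: "(\<Sum>l<n. \<Sum>k\<in>gen_set l. f k) = (\<Sum>k=1..<2 ^ n. f k)"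
  unfolding UN_gen_set[symmetric]
  by (rule sum.UNION_disjoint[symmetric]) (auto simp: gen_set_disjoint)

lemma tree_eq: "tree n = {1..<2 ^ Suc n}"
  unfolding tree_def UN_gen_set[symmetric] by (simp add: lessThan_Suc_atMost)

lemma tree_from_eq: "tree_from n q = {2 ^ q..<2 ^ Suc n}"
proof -
  have "Suc 0 \<le> x" if "2 ^ q \<le> x" for x :: nat by (rule order_trans[OF _ that]) simp
  then show ?thesis unfolding tree_from_def tree_eq by auto
qed

lemma gen_set_exists: "1 \<le> k \<Longrightarrow> \<exists>l. k \<in> gen_set l"
proof -
  assume "1 \<le> k"
  moreover have "k < 2 ^ k" by (rule less_exp)
  ultimately have "k \<in> (\<Union>l<k. gen_set l)" unfolding UN_gen_set by simp
  then show ?thesis by blast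
qed

lemma generation_eq: "k \<in> gen_set l \<Longrightarrow> generation k = l"
  unfolding generation_def
  by (rule the_equality) (use gen_set_disjoint in blast)+

lemma gen_set_generation: "1 \<le> k \<Longrightarrow> k \<in> gen_set (generation k)"
  using gen_set_exists generation_eq by blast

lemma gen_set_double: "k \<in> gen_set l \<Longrightarrow> i < 2 \<Longrightarrow> 2 * k + i \<in> gen_set (Suc l)"
  by (auto simp: gen_set_eq)

lemma gen_set_ge: "k \<in> gen_set l \<Longrightarrow> q \<le> l \<Longrightarrow> 2 ^ q \<le> k"
proof -
  assume k: "k \<in> gen_set l" and q: "q \<le> l"
  have "(2::nat) ^ q \<le> 2 ^ l" using q by (intro power_increasing) auto
  moreover have "2 ^ l \<le> k" using k by (simp add: gen_set_eq)
  ultimately show ?thesis by (rule order_trans)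
qed

lemma generation_ge: "2 ^ q \<le> k \<Longrightarrow> q \<le> generation k"
proof (rule ccontr)
  assume k: "2 ^ q \<le> k" and "\<not> q \<le> generation k"
  then have "(2::nat) ^ Suc (generation k) \<le> 2 ^ q" by (intro power_increasing) auto
  moreover have "1 \<le> k" using k by (meson order_trans one_le_power one_le_numeral)
  ultimately show False using gen_set_generation[of k] k by (auto simp: gen_set_eq)
qed

section \<open>The process and its martingale structure\<close>

locale bar_process = prob_space M for M :: "'a measure" +
  fixes p :: nat and a b :: "nat \<Rightarrow> real" and X eps :: "nat \<Rightarrow> 'a \<Rightarrow> real" and v \<rho> :: real
  assumes p: "p \<ge> 1"
    and X_rv: "\<And>n. n \<ge> 1 \<Longrightarrow> X n \<in> borel_measurable M"
    and eps_rv: "\<And>n. n \<ge> 2 ^ p \<Longrightarrow> eps n \<in> borel_measurable M"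
    and BAR_even: "\<And>n \<omega>. n \<ge> 2 ^ (p - 1) \<Longrightarrow> \<omega> \<in> space M \<Longrightarrow>
        X (2 * n) \<omega> = a 0 + (\<Sum>k=1..p. a k * X (n div 2 ^ (k - 1)) \<omega>) + eps (2 * n) \<omega>"
    and BAR_odd: "\<And>n \<omega>. n \<ge> 2 ^ (p - 1) \<Longrightarrow> \<omega> \<in> space M \<Longrightarrow>
        X (2 * n + 1) \<omega> = b 0 + (\<Sum>k=1..p. b k * X (n div 2 ^ (k - 1)) \<omega>) + eps (2 * n + 1) \<omega>"
    and X_init: "\<And>k. 1 \<le> k \<Longrightarrow> k \<le> 2 ^ p - 1 \<Longrightarrow> integrable M (\<lambda>\<omega>. (X k \<omega>)\<^sup>2)"
    and contraction: "\<exists>N. is_norm p N \<and> max (op_norm p N (companion p a)) (op_norm p N (companion p b)) < 1"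
    and v_pos: "0 < v"
    and eps_L2: "\<And>n k. n \<ge> p - 1 \<Longrightarrow> k \<in> gen_set (n + 1) \<Longrightarrow> integrable M (\<lambda>\<omega>. (eps k \<omega>)\<^sup>2)"
    and eps_mean: "\<And>n k. n \<ge> p - 1 \<Longrightarrow> k \<in> gen_set (n + 1) \<Longrightarrow>
        AE \<omega> in M. real_cond_exp M (sigma_X M X n) (eps k) \<omega> = 0"
    and eps_var: "\<And>n k. n \<ge> p - 1 \<Longrightarrow> k \<in> gen_set (n + 1) \<Longrightarrow>
        AE \<omega> in M. real_cond_exp M (sigma_X M X n) (\<lambda>\<omega>. (eps k \<omega>)\<^sup>2) \<omega> = v"
    and eps_cov: "\<And>n k l. n \<ge> p - 1 \<Longrightarrow> k \<in> gen_set (n + 1) \<Longrightarrow> l \<in> gen_set (n + 1) \<Longrightarrow>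
        k \<noteq> l \<Longrightarrow> k div 2 = l div 2 \<Longrightarrow>
        AE \<omega> in M. real_cond_exp M (sigma_X M X n) (\<lambda>\<omega>. eps k \<omega> * eps l \<omega>) \<omega> = \<rho>"
    and eps_indep: "\<And>n. n \<ge> p - 1 \<Longrightarrow>
        cond_indep_vars M (sigma_X M X n) borel (siblings eps) (gen_set n)"
    and eps_L4: "\<And>n k. n \<ge> p - 1 \<Longrightarrow> k \<in> gen_set (n + 1) \<Longrightarrow> integrable M (\<lambda>\<omega>. eps k \<omega> ^ 4)"
    and eps_sup4: "AE \<omega> in M.
        (SUP n\<in>{p - 1..}. SUP k\<in>gen_set (n + 1).
           nn_cond_exp M (sigma_X M X n) (\<lambda>\<omega>. ennreal (eps k \<omega> ^ 4)) \<omega>) < \<infinity>"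
begin

text \<open>\<open>y c k\<close> is the \<open>c\<close>-th entry of \<open>Y\<^sub>k\<close>, and \<open>e i k\<close> is \<open>\<epsilon>\<^bsub>2k+i\<^esub>\<close>; both are set to zero below
  generation \<open>p - 1\<close>, which makes \<open>e i\<close> a martingale difference sequence over all indices.\<close>

definition par :: "nat \<Rightarrow> nat \<Rightarrow> real" where "par i = (if i = 0 then a else b)"

definition y :: "nat \<Rightarrow> nat \<Rightarrow> 'a \<Rightarrow> real" where
  "y c k \<omega> = (if 2 ^ (p - 1) \<le> k then if c = 0 then 1 else X (k div 2 ^ (c - 1)) \<omega> else 0)"

definition e :: "nat \<Rightarrow> nat \<Rightarrow> 'a \<Rightarrow> real" where
  "e i k \<omega> = (if 2 ^ (p - 1) \<le> k then eps (2 * k + i) \<omega> else 0)"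

definition \<Gamma> :: "nat \<Rightarrow> nat \<Rightarrow> real" where "\<Gamma> i j = (if i = j then v else \<rho>)"

text \<open>At \<open>k = 2 ^ l\<close> this is the sigma-field of the generations up to
  \<open>l\<close>; each further step adds the two daughters of one mother.\<close>

definition H :: "nat \<Rightarrow> 'a measure" where "H k = sigma_gen M X {1..<2 * k}"

lemma BAR:
  assumes "2 ^ (p - 1) \<le> k" "i < 2" "\<omega> \<in> space M"
  shows "X (2 * k + i) \<omega> = (\<Sum>c\<le>p. par i c * y c k \<omega>) + e i k \<omega>"
proof -
  have "(\<Sum>c\<le>p. par i c * y c k \<omega>) = par i 0 + (\<Sum>c=1..p. par i c * X (k div 2 ^ (c - 1)) \<omega>)"
  proof -
    have "{..p} = insert 0 {1..p}" by auto
    then show ?thesis using assms(1) by (auto simp: y_def intro!: sum.cong)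
  qed
  moreover have "i = 0 \<or> i = 1" using assms(2) by auto
  ultimately show ?thesis
    using BAR_even[OF assms(1,3)] BAR_odd[OF assms(1,3)] assms(1) by (auto simp: par_def e_def)
qed

sublocale filtration M H
proof
  show "subalgebra M (H k)" for k unfolding H_def by (rule sigma_gen_le) (use X_rv in auto)
  show "subalgebra (H m) (H k)" if "k \<le> m" for k m unfolding H_def
    by (rule sigma_gen_mono) (use that in auto)
qed

lemma div_power_pos: "2 ^ (p - 1) \<le> (k :: nat) \<Longrightarrow> c < p \<Longrightarrow> 1 \<le> k div 2 ^ c"
proof -
  assume k: "2 ^ (p - 1) \<le> k" "c < p"
  have "(2::nat) ^ c \<le> 2 ^ (p - 1)" using k by (intro power_increasing) auto
  then have "(2::nat) ^ c \<le> k" using k(1) by (rule order_trans)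
  then have "2 ^ c div 2 ^ c \<le> k div 2 ^ c" by (rule div_le_mono)
  then show ?thesis by simp
qed

text \<open>The range \<open>k < 2 * n\<close> goes beyond \<open>n\<close>: with
  \<open>n = 2 ^ l\<close> it covers all of generation \<open>l\<close>, as needed for events and
  coefficients that are fixed at the start of a generation.\<close>

lemma y_measurable_gen: 
  assumes "c \<le> p" "k < 2 * n" shows "y c k \<in> borel_measurable (H n)"
proof (cases "2 ^ (p - 1) \<le> k \<and> c \<noteq> 0")
  case True
  then have "1 \<le> k div 2 ^ (c - 1)" using assms by (intro div_power_pos) auto
  moreover have "k div 2 ^ (c - 1) < 2 * n" using assms(2) by (meson div_le_dividend le_less_trans)
  ultimately have "X (k div 2 ^ (c - 1)) \<in> borel_measurable (H n)"
    unfolding H_def by (intro measurable_sigma_gen) simp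
  moreover have "y c k = X (k div 2 ^ (c - 1))" using True by (auto simp: y_def)
  ultimately show ?thesis by simp
next
  case False
  then have "y c k = (\<lambda>_. if 2 ^ (p - 1) \<le> k then 1 else 0)" by (auto simp: y_def)
  then show ?thesis by simp
qed

lemma y_measurable: "c \<le> p \<Longrightarrow> y c k \<in> borel_measurable (H k)"
proof -
  assume c: "c \<le> p"
  show ?thesis
  proof (cases "k = 0")
    case True
    then have "y c k = (\<lambda>_. 0)" by (auto simp: y_def)
    then show ?thesis by simp
  qed (use c in \<open>intro y_measurable_gen; simp\<close>)
qed

lemma y_M: "c \<le> p \<Longrightarrow> y c k \<in> borel_measurable M"
  by (rule H_M[OF y_measurable])

text \<open>The autoregression solved for the innovation: a daughter minus the linear predictor
  formed from her mother's vector.\<close>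

lemma e_measurable:
  assumes i: "i < 2" shows "e i k \<in> borel_measurable (H (Suc k))"
proof (cases "2 ^ (p - 1) \<le> k")
  case True
  have k: "1 \<le> k" using True by (meson order_trans one_le_power one_le_numeral)
  have [measurable]: "X (2 * k + i) \<in> borel_measurable (H (Suc k))"
    unfolding H_def by (rule measurable_sigma_gen) (use i k in auto)
  have [measurable]: "y c k \<in> borel_measurable (H (Suc k))" if "c \<in> {..p}" for c
    using that by (intro y_measurable_gen) auto
  have "(\<lambda>\<omega>. X (2 * k + i) \<omega> - (\<Sum>c\<le>p. par i c * y c k \<omega>)) \<in> borel_measurable (H (Suc k))"
    by measurable
  then show ?thesis
    by (rule measurable_cong[THEN iffD1, rotated]) (use BAR[OF True i] in \<open>auto simp: space_H\<close>)
next
  case False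
  then have "e i k = (\<lambda>_. 0)" by (auto simp: e_def)
  then show ?thesis by simp
qed

lemma e_M: "i < 2 \<Longrightarrow> e i k \<in> borel_measurable M"
  by (rule H_M[OF e_measurable])

lemma subalgebra_sigma_X: "subalgebra M (sigma_X M X l)"
  unfolding sigma_X_eq by (rule sigma_gen_le) (use X_rv in \<open>auto simp: tree_eq\<close>)

lemma siblings_measurable: "2 ^ (p - 1) \<le> k \<Longrightarrow> siblings eps k \<in> borel_measurable M"
proof -
  assume k: "2 ^ (p - 1) \<le> k"
  have "2 ^ p \<le> 2 * k" using k p by (cases p) auto
  then have "eps (2 * k) \<in> borel_measurable M" "eps (2 * k + 1) \<in> borel_measurable M"
    by (auto intro!: eps_rv)
  then show ?thesis unfolding siblings_def by (intro borel_measurable_Pair) auto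
qed

text \<open>Within generation \<open>l\<close>, the daughters of the mothers
  \<open>2 ^ l..<k\<close> are sums of a predictor known at generation \<open>l\<close> and an
  innovation. So \<open>H k\<close> is generated by that past and the earlier sibling pairs, the
  form in which conditional independence can be applied.\<close>

lemma H_sets_subset:
  assumes k: "k \<in> gen_set l" and l: "p - 1 \<le> l"
  shows "sets (H k) \<subseteq> sigma_sets (space M) {A \<inter> {x \<in> space M. \<forall>m\<in>{2 ^ l..<k}. siblings eps m x \<in> B m} | A B.
    A \<in> sets (sigma_X M X l) \<and> (\<forall>m\<in>{2 ^ l..<k}. B m \<in> sets borel)}"
proof -
  let ?F = "sigma_X M X l"
  define P where "P = {A \<inter> {x \<in> space M. \<forall>m\<in>{2 ^ l..<k}. siblings eps m x \<in> B m} | A B.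
    A \<in> sets ?F \<and> (\<forall>m\<in>{2 ^ l..<k}. B m \<in> sets borel)}"
  define Q where "Q = sigma (space M) P"
  have FM: "A \<in> sets M" if "A \<in> sets ?F" for A using subalgebra_sigma_X[of l] that by (auto simp: subalgebra_def)
  have spF: "space ?F = space M" using subalgebra_sigma_X[of l] by (auto simp: subalgebra_def)
  have Psub: "P \<subseteq> Pow (space M)" unfolding P_def by auto
  have spQ: "space Q = space M" unfolding Q_def by (rule space_measure_of[OF Psub])
  have setsQ: "sets Q = sigma_sets (space M) P" unfolding Q_def by (rule sets_measure_of[OF Psub])
  have FQ: "subalgebra Q ?F" unfolding subalgebra_def
  proof
    show "sets ?F \<subseteq> sets Q"
    proof
      fix A assume A: "A \<in> sets ?F"
      have "A \<in> P" unfolding P_def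
      proof (intro CollectI exI conjI)
        show "A = A \<inter> {x \<in> space M. \<forall>m\<in>{2 ^ l..<k}. siblings eps m x \<in> UNIV}"
          using sets.sets_into_space[OF FM[OF A]] by blast
        show "A \<in> sets ?F" by (rule A)
      qed simp
      then show "A \<in> sets Q" unfolding setsQ by (rule sigma_sets.Basic)
    qed
  qed (simp add: spQ spF)
  have XQ: "X j \<in> borel_measurable Q" if "j \<in> tree l" for j
  proof -
    have "X j \<in> borel_measurable ?F" unfolding sigma_X_eq by (rule measurable_sigma_gen[OF that])
    then show ?thesis by (rule measurable_from_subalg[OF FQ])
  qed
  have UQ: "siblings eps m \<in> measurable Q borel" if m: "m \<in> {2 ^ l..<k}" for m
  proof (rule measurableI)
    fix B :: "(real \<times> real) set" assume B: "B \<in> sets borel"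
    have "siblings eps m -` B \<inter> space M \<in> P" unfolding P_def
    proof (intro CollectI exI conjI)
      show "siblings eps m -` B \<inter> space M =
        space M \<inter> {x \<in> space M. \<forall>m'\<in>{2 ^ l..<k}. siblings eps m' x \<in> (if m' = m then B else UNIV)}"
        using m by auto
      show "space M \<in> sets ?F" using sets.top[of ?F] by (simp add: spF)
      show "\<forall>m'\<in>{2 ^ l..<k}. (if m' = m then B else UNIV) \<in> sets borel" using B by simp
    qed
    then show "siblings eps m -` B \<inter> space Q \<in> sets Q" unfolding setsQ spQ by (rule sigma_sets.Basic)
  qed simp
  have "subalgebra Q (H k)" unfolding H_def
  proof (rule sigma_gen_le)
    fix j assume j: "j \<in> {1..<2 * k}"
    show "X j \<in> borel_measurable Q"
    proof (cases "j < 2 ^ Suc l")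
      case True then show ?thesis using j by (intro XQ) (auto simp: tree_eq)
    next
      case False
      define m i where "m = j div 2" and "i = j mod 2"
      have ji: "j = 2 * m + i" "i < 2" by (auto simp: m_def i_def)
      have m: "m \<in> {2 ^ l..<k}" using j False by (auto simp: m_def)
      have "k < 2 ^ Suc l" using k by (simp add: gen_set_eq)
      then have ml: "m \<in> gen_set l" using m by (simp add: gen_set_eq)
      have mp: "2 ^ (p - 1) \<le> m" by (rule gen_set_ge[OF ml l])
      have yQ: "y c m \<in> borel_measurable Q" if "c \<in> {..p}" for c
      proof -
        have "y c m \<in> borel_measurable (H (2 ^ l))" using ml that by (intro y_measurable_gen) (auto simp: gen_set_eq)
        moreover have "H (2 ^ l) = ?F" unfolding H_def sigma_X_eq tree_eq by simp
        ultimately have "y c m \<in> borel_measurable ?F" by simp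
        then show ?thesis by (rule measurable_from_subalg[OF FQ])
      qed
      have "eps (2 * m + i) = (\<lambda>\<omega>. if i = 0 then fst (siblings eps m \<omega>) else snd (siblings eps m \<omega>))"
        using ji(2) by (auto simp: siblings_def less_2_cases_iff)
      moreover have "(\<lambda>\<omega>. fst (siblings eps m \<omega>)) \<in> borel_measurable Q" "(\<lambda>\<omega>. snd (siblings eps m \<omega>)) \<in> borel_measurable Q"
        using UQ[OF m] by (auto intro!: borel_measurable_continuous_on[where g = "siblings eps m"] continuous_intros)
      ultimately have eQ: "eps (2 * m + i) \<in> borel_measurable Q" by (cases "i = 0") auto
      have "(\<lambda>\<omega>. (\<Sum>c\<le>p. par i c * y c m \<omega>) + eps (2 * m + i) \<omega>) \<in> borel_measurable Q"
        using yQ by (intro borel_measurable_add[OF borel_measurable_sum eQ] borel_measurable_times) auto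
      then show ?thesis
        by (rule measurable_cong[THEN iffD1, rotated]) (use BAR[OF mp ji(2)] mp in \<open>auto simp: spQ ji(1) e_def\<close>)
    qed
  qed (rule spQ)
  then show ?thesis unfolding P_def[symmetric] by (simp add: subalgebra_def setsQ)
qed

text \<open>The passage from hypotheses conditional on whole generations to the filtration indexed
  by mothers. Conditional independence of the sibling pairs enters the argument here.\<close>

lemma cond_exp_siblings:
  assumes k: "k \<in> gen_set l" and l: "p - 1 \<le> l"
    and f: "f \<in> borel_measurable borel" and int: "integrable M (\<lambda>x. f (siblings eps k x) :: real)"
  shows "AE x in M. real_cond_exp M (H k) (\<lambda>x. f (siblings eps k x)) x =
    real_cond_exp M (sigma_X M X l) (\<lambda>x. f (siblings eps k x)) x"
proof (rule cond_indep_vars_real_cond_exp[where U = "siblings eps" and f = f and K = "{2 ^ l..<k}" and I = "gen_set l" and N = borel])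
  show "subalgebra (H k) (sigma_X M X l)" unfolding H_def sigma_X_eq
    by (rule sigma_gen_mono) (use k in \<open>auto simp: tree_eq gen_set_eq\<close>)
  show ins: "insert k {2 ^ l..<k} \<subseteq> gen_set l" using k by (auto simp: gen_set_eq)
  fix i assume "i \<in> insert k {2 ^ l..<k}"
  then have "i \<in> gen_set l" using ins by blast
  then show "siblings eps i \<in> borel_measurable M" by (intro siblings_measurable gen_set_ge[OF _ l])
next
qed (use prob_space_axioms subalgebra_sigma_X sub eps_indep[OF l] H_sets_subset[OF k l] f int in \<open>simp_all\<close>)

lemma generation_p:
  assumes "2 ^ (p - 1) \<le> k"
  shows "k \<in> gen_set (generation k)" "p - 1 \<le> generation k"
proof -
  have "1 \<le> k" using assms by (meson order_trans one_le_power one_le_numeral)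
  then show "k \<in> gen_set (generation k)" by (rule gen_set_generation)
  show "p - 1 \<le> generation k" by (rule generation_ge[OF assms])
qed

lemma e_integrable_square: "i < 2 \<Longrightarrow> integrable M (\<lambda>x. (e i k x)\<^sup>2)"
  and e_integrable_4: "i < 2 \<Longrightarrow> integrable M (\<lambda>x. e i k x ^ 4)"
proof -
  assume i: "i < 2"
  have "integrable M (\<lambda>x. (e i k x)\<^sup>2) \<and> integrable M (\<lambda>x. e i k x ^ 4)"
  proof (cases "2 ^ (p - 1) \<le> k")
    case True
    note g = generation_p[OF True]
    show ?thesis
      using eps_L2[OF g(2), of "2 * k + i"] eps_L4[OF g(2), of "2 * k + i"] gen_set_double[OF g(1) i] True
      by (simp add: e_def)
  qed (simp add: e_def)
  then show "integrable M (\<lambda>x. (e i k x)\<^sup>2)" "integrable M (\<lambda>x. e i k x ^ 4)" by auto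
qed

text \<open>Makes each innovation of a pair, and their products and powers, functions of the pair,
  to which \<open>cond_exp_siblings\<close> applies.\<close>

definition coord :: "nat \<Rightarrow> real \<times> real \<Rightarrow> real" where
  "coord i z = (if i = 0 then fst z else snd z)"

lemma coord_measurable [measurable]: "coord i \<in> borel_measurable borel"
proof -
  have "fst \<in> borel_measurable (borel :: (real \<times> real) measure)" "snd \<in> borel_measurable (borel :: (real \<times> real) measure)"
    by (auto intro!: borel_measurable_continuous_onI continuous_intros)
  then show ?thesis unfolding coord_def by (cases "i = 0") auto
qed

lemma coord_siblings: "i < 2 \<Longrightarrow> coord i (siblings eps k x) = eps (2 * k + i) x"
  by (auto simp: coord_def siblings_def less_2_cases_iff)

lemma e_mean:
  assumes i: "i < 2" shows "AE x in M. real_cond_exp M (H k) (e i k) x = 0"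
proof (cases "2 ^ (p - 1) \<le> k")
  case True
  note g = generation_p[OF True]
  have e: "e i k = (\<lambda>x. coord i (siblings eps k x))" using True i by (auto simp: e_def coord_siblings)
  have "AE x in M. real_cond_exp M (H k) (e i k) x = real_cond_exp M (sigma_X M X (generation k)) (e i k) x"
    unfolding e by (rule cond_exp_siblings[OF g coord_measurable])
      (use integrable_of_square[OF e_M[OF i] e_integrable_square[OF i], of k] in \<open>simp add: e\<close>)
  moreover have "e i k = eps (2 * k + i)" using True by (auto simp: e_def)
  then have "AE x in M. real_cond_exp M (sigma_X M X (generation k)) (e i k) x = 0"
    using eps_mean[OF g(2), of "2 * k + i"] gen_set_double[OF g(1) i] by simp
  ultimately show ?thesis by eventually_elim simp
next
  case False
  then have "e i k = (\<lambda>x. 0)" by (auto simp: e_def)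
  then show ?thesis
    using sigma_finite_subalgebra.real_cond_exp_F_meas[OF sigma_finite_sub, of "\<lambda>x. 0" k] by simp
qed

lemma e_cov:
  assumes i: "i < 2" and j: "j < 2"
  shows "AE x in M. real_cond_exp M (H k) (\<lambda>x. e i k x * e j k x) x = (if 2 ^ (p - 1) \<le> k then \<Gamma> i j else 0)"
proof (cases "2 ^ (p - 1) \<le> k")
  case True
  note g = generation_p[OF True]
  have e: "e i k = (\<lambda>x. coord i (siblings eps k x))" "e j k = (\<lambda>x. coord j (siblings eps k x))"
    using True i j by (auto simp: e_def coord_siblings)
  have int: "integrable M (\<lambda>x. e i k x * e j k x)"
    by (intro integrable_mult_of_squares e_M e_integrable_square i j)
  have 1: "AE x in M. real_cond_exp M (H k) (\<lambda>x. e i k x * e j k x) x =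
    real_cond_exp M (sigma_X M X (generation k)) (\<lambda>x. e i k x * e j k x) x"
    unfolding e by (rule cond_exp_siblings[OF g, of "\<lambda>z. coord i z * coord j z"])
      (use int in \<open>simp_all add: e\<close>)
  have e': "e i k = eps (2 * k + i)" "e j k = eps (2 * k + j)" using True by (auto simp: e_def)
  have "AE x in M. real_cond_exp M (sigma_X M X (generation k)) (\<lambda>x. e i k x * e j k x) x = \<Gamma> i j"
  proof (cases "i = j")
    case True
    then show ?thesis using eps_var[OF g(2), of "2 * k + i"] gen_set_double[OF g(1) i]
      by (simp add: \<Gamma>_def e' power2_eq_square)
  next
    case False
    have "(2 * k + i) div 2 = (2 * k + j) div 2" using i j by simp
    then show ?thesis using eps_cov[OF g(2), of "2 * k + i" "2 * k + j"] gen_set_double[OF g(1) i] gen_set_double[OF g(1) j] False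
      by (simp add: \<Gamma>_def e')
  qed
  with 1 show ?thesis by eventually_elim (use True in simp)
next
  case False
  then have "(\<lambda>x. e i k x * e j k x) = (\<lambda>x. 0)" by (auto simp: e_def)
  then show ?thesis
    using sigma_finite_subalgebra.real_cond_exp_F_meas[OF sigma_finite_sub, of "\<lambda>x. 0" k] False by simp
qed

text \<open>The random bound is the almost surely finite supremum in the hypothesis, carried over
  from the sigma-fields of generations to \<open>H k\<close>; the countably many exceptional null
  sets are collected first.\<close>

lemma e_4_bounded: "AE x in M. \<exists>K. \<forall>k. \<forall>i<2. real_cond_exp M (H k) (\<lambda>x. e i k x ^ 4) x \<le> K"
proof -
  have *: "AE x in M. 2 ^ (p - 1) \<le> k \<longrightarrow> i < 2 \<longrightarrow> real_cond_exp M (H k) (\<lambda>x. e i k x ^ 4) x \<le>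
    enn2real (nn_cond_exp M (sigma_X M X (generation k)) (\<lambda>x. ennreal (eps (2 * k + i) x ^ 4)) x)" for k i :: nat
  proof (cases "2 ^ (p - 1) \<le> k \<and> i < 2")
    case True
    then have i: "i < 2" and k: "2 ^ (p - 1) \<le> k" by auto
    note g = generation_p[OF k]
    have e: "e i k = (\<lambda>x. coord i (siblings eps k x))" using k i by (auto simp: e_def coord_siblings)
    have "AE x in M. real_cond_exp M (H k) (\<lambda>x. e i k x ^ 4) x =
      real_cond_exp M (sigma_X M X (generation k)) (\<lambda>x. e i k x ^ 4) x"
      unfolding e by (rule cond_exp_siblings[OF g, of "\<lambda>z. coord i z ^ 4"])
        (use e_integrable_4[OF i, of k] in \<open>simp_all add: e\<close>)
    \<comment> \<open>\<open>real_cond_exp\<close> is the difference of the conditional expectations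
      of positive and negative part; dropping the second leaves the one that the hypothesis
      bounds.\<close>
    moreover have "real_cond_exp M (sigma_X M X (generation k)) (\<lambda>x. e i k x ^ 4) x \<le>
      enn2real (nn_cond_exp M (sigma_X M X (generation k)) (\<lambda>x. ennreal (eps (2 * k + i) x ^ 4)) x)" for x
      using k by (simp add: real_cond_exp_def e_def)
    ultimately show ?thesis by (auto elim!: eventually_mono)
  qed auto
  have "AE x in M. real_cond_exp M (H k) (\<lambda>x. e i k x ^ 4) x \<le> 0" if "\<not> 2 ^ (p - 1) \<le> k" for i k :: nat
  proof -
    have "(\<lambda>x. e i k x ^ 4) = (\<lambda>x. 0)" using that by (auto simp: e_def)
    then show ?thesis
      using sigma_finite_subalgebra.real_cond_exp_F_meas[OF sigma_finite_sub, of "\<lambda>x. 0" k] by auto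
  qed
  then have **: "AE x in M. \<not> 2 ^ (p - 1) \<le> k \<longrightarrow> real_cond_exp M (H k) (\<lambda>x. e i k x ^ 4) x \<le> 0" for i k :: nat
    by (cases "2 ^ (p - 1) \<le> k") auto
  have "AE x in M. \<forall>k i. (2 ^ (p - 1) \<le> k \<longrightarrow> i < 2 \<longrightarrow> real_cond_exp M (H k) (\<lambda>x. e i k x ^ 4) x \<le>
    enn2real (nn_cond_exp M (sigma_X M X (generation k)) (\<lambda>x. ennreal (eps (2 * k + i) x ^ 4)) x)) \<and>
    (\<not> 2 ^ (p - 1) \<le> k \<longrightarrow> real_cond_exp M (H k) (\<lambda>x. e i k x ^ 4) x \<le> 0)"
    unfolding AE_all_countable by (intro allI AE_conjI * **)
  with eps_sup4 show ?thesis
  proof eventually_elim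
    case (elim x)
    define S where "S = (SUP n\<in>{p - 1..}. SUP k\<in>gen_set (n + 1).
       nn_cond_exp M (sigma_X M X n) (\<lambda>\<omega>. ennreal (eps k \<omega> ^ 4)) x)"
    have S: "S < \<infinity>" using elim(1) by (simp add: S_def)
    have "real_cond_exp M (H k) (\<lambda>x. e i k x ^ 4) x \<le> enn2real S" if i: "i < 2" for k i
    proof (cases "2 ^ (p - 1) \<le> k")
      case True
      note g = generation_p[OF True]
      have "nn_cond_exp M (sigma_X M X (generation k)) (\<lambda>\<omega>. ennreal (eps (2 * k + i) \<omega> ^ 4)) x \<le>
        (SUP k'\<in>gen_set (generation k + 1). nn_cond_exp M (sigma_X M X (generation k)) (\<lambda>\<omega>. ennreal (eps k' \<omega> ^ 4)) x)"
        by (rule SUP_upper) (use gen_set_double[OF g(1) i] in simp)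
      also have "\<dots> \<le> S" unfolding S_def by (rule SUP_upper) (use g in simp)
      finally have "enn2real (nn_cond_exp M (sigma_X M X (generation k)) (\<lambda>\<omega>. ennreal (eps (2 * k + i) \<omega> ^ 4)) x) \<le> enn2real S"
        using S by (intro enn2real_mono) auto
      then show ?thesis using elim(2) True i by (meson order_trans)
    next
      case False
      have "0 \<le> enn2real S" by simp
      then show ?thesis using elim(2) False by (meson order_trans)
    qed
    then show ?case by blast
  qed
qed

lemma mds_e: "i < 2 \<Longrightarrow> mds (e i)"
  unfolding mds_def by (auto intro: e_measurable e_integrable_square e_mean)

lemma e_var_bounded:
  assumes i: "i < 2"
  shows "AE x in M. \<exists>K. \<forall>k. real_cond_exp M (H k) (\<lambda>x. (e i k x)\<^sup>2) x \<le> K"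
proof -
  have "AE x in M. \<forall>k. real_cond_exp M (H k) (\<lambda>x. e i k x * e i k x) x = (if 2 ^ (p - 1) \<le> k then \<Gamma> i i else 0)"
    unfolding AE_all_countable by (intro allI e_cov i)
  then show ?thesis
  proof eventually_elim
    case (elim x)
    have "real_cond_exp M (H k) (\<lambda>x. (e i k x)\<^sup>2) x \<le> v" for k
      using elim v_pos by (auto simp: power2_eq_square \<Gamma>_def)
    then show ?case by blast
  qed
qed

text \<open>Centred at its conditional mean given \<open>H k\<close>, which is zero below generation
  \<open>p - 1\<close> because \<open>e\<close> vanishes there.\<close>

definition ecov :: "nat \<Rightarrow> nat \<Rightarrow> nat \<Rightarrow> 'a \<Rightarrow> real" where
  "ecov i j k x = e i k x * e j k x - (if 2 ^ (p - 1) \<le> k then \<Gamma> i j else 0)"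

lemma ecov_square_le: "(ecov i j k x)\<^sup>2 \<le> e i k x ^ 4 + e j k x ^ 4 + 2 * (\<Gamma> i j)\<^sup>2"
proof -
  have "(s - t)\<^sup>2 \<le> 2 * s\<^sup>2 + 2 * t\<^sup>2" for s t :: real
    using zero_le_power2[of "s + t"] by (simp add: power2_diff power2_sum)
  then have "(ecov i j k x)\<^sup>2 \<le> 2 * (e i k x * e j k x)\<^sup>2 + 2 * (if 2 ^ (p - 1) \<le> k then \<Gamma> i j else 0)\<^sup>2"
    unfolding ecov_def by blast
  also have "2 * (e i k x * e j k x)\<^sup>2 \<le> e i k x ^ 4 + e j k x ^ 4"
    using zero_le_power2[of "(e i k x)\<^sup>2 - (e j k x)\<^sup>2"] by (simp add: power2_diff power_mult_distrib)
  finally show ?thesis by (auto split: if_splits intro: order_trans)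
qed

lemma mds_ecov:
  assumes i: "i < 2" and j: "j < 2" shows "mds (ecov i j)"
  unfolding mds_def
proof (intro allI conjI)
  fix k
  note [measurable] = e_measurable[OF i, of k] e_measurable[OF j, of k] e_M[OF i, of k] e_M[OF j, of k]
  show "ecov i j k \<in> borel_measurable (H (Suc k))" unfolding ecov_def by measurable
  have m: "ecov i j k \<in> borel_measurable M" unfolding ecov_def by measurable
  show "integrable M (\<lambda>x. (ecov i j k x)\<^sup>2)"
  proof (rule Bochner_Integration.integrable_bound)
    show "integrable M (\<lambda>x. e i k x ^ 4 + e j k x ^ 4 + 2 * (\<Gamma> i j)\<^sup>2)"
      using e_integrable_4[OF i, of k] e_integrable_4[OF j, of k] by auto
    show "AE x in M. norm ((ecov i j k x)\<^sup>2) \<le> norm (e i k x ^ 4 + e j k x ^ 4 + 2 * (\<Gamma> i j)\<^sup>2)"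
      using ecov_square_le[of i j k] by (auto simp: order_trans[OF _ abs_ge_self])
  qed (use m in simp)
  have int: "integrable M (\<lambda>x. e i k x * e j k x)"
    by (intro integrable_mult_of_squares e_M e_integrable_square i j)
  let ?c = "if 2 ^ (p - 1) \<le> k then \<Gamma> i j else 0"
  have "AE x in M. real_cond_exp M (H k) (\<lambda>x. e i k x * e j k x - ?c) x =
    real_cond_exp M (H k) (\<lambda>x. e i k x * e j k x) x - real_cond_exp M (H k) (\<lambda>x. ?c) x"
    by (rule sigma_finite_subalgebra.real_cond_exp_diff[OF sigma_finite_sub int]) simp
  moreover have "AE x in M. real_cond_exp M (H k) (\<lambda>x. ?c) x = ?c"
    by (rule sigma_finite_subalgebra.real_cond_exp_F_meas[OF sigma_finite_sub]) simp_all
  ultimately show "AE x in M. real_cond_exp M (H k) (ecov i j k) x = 0"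
    using e_cov[OF i j, of k] unfolding ecov_def by eventually_elim simp
qed

lemma ecov_var_bounded:
  assumes i: "i < 2" and j: "j < 2"
  shows "AE x in M. \<exists>K. \<forall>k. real_cond_exp M (H k) (\<lambda>x. (ecov i j k x)\<^sup>2) x \<le> K"
proof -
  have "AE x in M. real_cond_exp M (H k) (\<lambda>x. (ecov i j k x)\<^sup>2) x \<le>
    real_cond_exp M (H k) (\<lambda>x. e i k x ^ 4) x + real_cond_exp M (H k) (\<lambda>x. e j k x ^ 4) x + 2 * (\<Gamma> i j)\<^sup>2" for k
  proof -
    interpret S: sigma_finite_subalgebra M "H k" by (rule sigma_finite_sub)
    note i4 = e_integrable_4[OF i, of k] and j4 = e_integrable_4[OF j, of k]
    have ij: "integrable M (\<lambda>x. e i k x ^ 4 + e j k x ^ 4)" using i4 j4 by simp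
    have c: "integrable M (\<lambda>x. 2 * (\<Gamma> i j)\<^sup>2)" by simp
    have ijc: "integrable M (\<lambda>x. e i k x ^ 4 + e j k x ^ 4 + 2 * (\<Gamma> i j)\<^sup>2)" using ij c by simp
    have "AE x in M. real_cond_exp M (H k) (\<lambda>x. (ecov i j k x)\<^sup>2) x \<le>
      real_cond_exp M (H k) (\<lambda>x. e i k x ^ 4 + e j k x ^ 4 + 2 * (\<Gamma> i j)\<^sup>2) x"
      by (rule S.real_cond_exp_mono) (use mdsD(3)[OF mds_ecov[OF i j], of k] ijc ecov_square_le in auto)
    moreover have "AE x in M. real_cond_exp M (H k) (\<lambda>x. e i k x ^ 4 + e j k x ^ 4 + 2 * (\<Gamma> i j)\<^sup>2) x =
      real_cond_exp M (H k) (\<lambda>x. e i k x ^ 4 + e j k x ^ 4) x + real_cond_exp M (H k) (\<lambda>x. 2 * (\<Gamma> i j)\<^sup>2) x"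
      by (rule S.real_cond_exp_add[OF ij c])
    moreover have "AE x in M. real_cond_exp M (H k) (\<lambda>x. e i k x ^ 4 + e j k x ^ 4) x =
      real_cond_exp M (H k) (\<lambda>x. e i k x ^ 4) x + real_cond_exp M (H k) (\<lambda>x. e j k x ^ 4) x"
      by (rule S.real_cond_exp_add[OF i4 j4])
    moreover have "AE x in M. real_cond_exp M (H k) (\<lambda>x. 2 * (\<Gamma> i j)\<^sup>2) x = 2 * (\<Gamma> i j)\<^sup>2"
      by (rule S.real_cond_exp_F_meas[OF c]) simp
    ultimately show ?thesis by eventually_elim linarith
  qed
  then have "AE x in M. \<forall>k. real_cond_exp M (H k) (\<lambda>x. (ecov i j k x)\<^sup>2) x \<le>
    real_cond_exp M (H k) (\<lambda>x. e i k x ^ 4) x + real_cond_exp M (H k) (\<lambda>x. e j k x ^ 4) x + 2 * (\<Gamma> i j)\<^sup>2"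
    unfolding AE_all_countable by blast
  with e_4_bounded show ?thesis
  proof eventually_elim
    case (elim x)
    then obtain K where K: "\<And>k i. i < 2 \<Longrightarrow> real_cond_exp M (H k) (\<lambda>x. e i k x ^ 4) x \<le> K" by blast
    have "real_cond_exp M (H k) (\<lambda>x. (ecov i j k x)\<^sup>2) x \<le> K + K + 2 * (\<Gamma> i j)\<^sup>2" for k
    proof -
      have "real_cond_exp M (H k) (\<lambda>x. (ecov i j k x)\<^sup>2) x \<le>
        real_cond_exp M (H k) (\<lambda>x. e i k x ^ 4) x + real_cond_exp M (H k) (\<lambda>x. e j k x ^ 4) x + 2 * (\<Gamma> i j)\<^sup>2"
        using elim(2) by blast
      then show ?thesis using K[OF i, of k] K[OF j, of k] by linarith
    qed
    then show ?case by blast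
  qed
qed

end

section \<open>Empirical moments\<close>

lemma convergent_divide_const:
  fixes s :: "nat \<Rightarrow> real"
  shows "convergent s \<Longrightarrow> convergent (\<lambda>n. s n / c)"
  unfolding divide_inverse by (intro convergent_mult convergent_const)

lemma summable_gen_set:
  fixes f :: "nat \<Rightarrow> real"
  assumes "summable f" shows "summable (\<lambda>l. \<Sum>k\<in>gen_set l. f k)"
proof -
  obtain s where s: "(\<lambda>n. \<Sum>k<n. f k) \<longlonglongrightarrow> s" using summable_LIMSEQ[OF assms] by blast
  have "filterlim (\<lambda>n. 2 ^ n :: nat) at_top sequentially"
    by (rule filterlim_subseq) (auto simp: strict_mono_def)
  from filterlim_compose[OF s this] have "(\<lambda>n. (\<Sum>k<2 ^ n. f k) - f 0) \<longlonglongrightarrow> s - f 0"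
    by (intro tendsto_diff tendsto_const)
  moreover have "(\<Sum>l<n. \<Sum>k\<in>gen_set l. f k) = (\<Sum>k<2 ^ n. f k) - f 0" for n
  proof -
    have "{..<2 ^ n} = insert 0 {1..<2 ^ n :: nat}" by auto
    then show ?thesis by (simp add: sum_gen_set)
  qed
  ultimately show ?thesis by (auto simp: summable_def sums_def)
qed

lemma summable_of_gen_set:
  fixes f :: "nat \<Rightarrow> real"
  assumes s: "summable (\<lambda>l. \<Sum>k\<in>gen_set l. f k)" and f: "\<And>k. 0 \<le> f k"
  shows "summable f"
proof (rule bounded_imp_summable[OF f])
  fix n
  have "(\<Sum>k\<le>n. f k) \<le> (\<Sum>k\<in>insert 0 {1..<2 ^ Suc n}. f k)"
  proof (rule sum_mono2)
    have "n < 2 ^ Suc n" by (rule less_trans[OF lessI less_exp])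
    then show "{..n} \<subseteq> insert 0 {1..<2 ^ Suc n}" by auto
  qed (use f in auto)
  also have "\<dots> = f 0 + (\<Sum>l<Suc n. \<Sum>k\<in>gen_set l. f k)" by (subst sum.insert) (auto simp: sum_gen_set)
  also have "(\<Sum>l<Suc n. \<Sum>k\<in>gen_set l. f k) \<le> (\<Sum>l. \<Sum>k\<in>gen_set l. f k)"
    by (rule sum_le_suminf[OF s]) (auto intro: sum_nonneg f)
  finally show "(\<Sum>k\<le>n. f k) \<le> f 0 + (\<Sum>l. \<Sum>k\<in>gen_set l. f k)" by simp
qed

lemma sum_gen_set_Suc: "(\<Sum>k\<in>gen_set (Suc l). f k) = (\<Sum>k\<in>gen_set l. f (2 * k) + f (2 * k + 1 :: nat))"
proof -
  have "gen_set (Suc l) = (\<lambda>k. 2 * k) ` gen_set l \<union> (\<lambda>k. 2 * k + 1) ` gen_set l" (is "_ = ?E \<union> ?O")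
  proof (rule subset_antisym; rule subsetI)
    fix j assume j: "j \<in> gen_set (Suc l)"
    have "j div 2 \<in> gen_set l" using j by (auto simp: gen_set_eq)
    moreover have "j = 2 * (j div 2) \<or> j = 2 * (j div 2) + 1" by presburger
    ultimately show "j \<in> ?E \<union> ?O" by blast
  qed (auto simp: gen_set_eq)
  moreover have "?E \<inter> ?O = {}" by auto presburger
  ultimately have "(\<Sum>k\<in>gen_set (Suc l). f k) = sum f ?E + sum f ?O" by (simp add: sum.union_disjoint)
  then show ?thesis by (simp add: sum.reindex inj_on_def sum.distrib)
qed

text \<open>With \<open>A\<close>, \<open>B\<close> two functionals at the mothers and
  \<open>E\<close> the innovations, the mean of products over daughters is reduced to products at
  the mothers, first moments, and means containing innovations.\<close>

lemma sum_affine_products: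
  fixes A B E :: "'i \<Rightarrow> real"
  shows "(\<Sum>k\<in>G. (t * A k + f * (s + E k)) * (t * B k + h * (s + E k))) / c =
    t\<^sup>2 * ((\<Sum>k\<in>G. A k * B k) / c) +
    t * (h * (s * ((\<Sum>k\<in>G. A k) / c) + (\<Sum>k\<in>G. A k * E k) / c)) +
    t * (f * (s * ((\<Sum>k\<in>G. B k) / c) + (\<Sum>k\<in>G. B k * E k) / c)) +
    (f * h) * ((\<Sum>k\<in>G. s\<^sup>2) / c + 2 * s * ((\<Sum>k\<in>G. E k) / c) + (\<Sum>k\<in>G. E k * E k) / c)"
proof -
  have "(\<Sum>k\<in>G. (t * A k + f * (s + E k)) * (t * B k + h * (s + E k))) =
    (\<Sum>k\<in>G. t\<^sup>2 * (A k * B k) + ((t * h * s) * A k + (t * h) * (A k * E k)) + ((t * f * s) * B k + (t * f) * (B k * E k)) +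
      ((f * h) * s\<^sup>2 + (f * h * 2 * s) * E k + (f * h) * (E k * E k)))"
    by (intro sum.cong refl) (simp add: power2_eq_square algebra_simps)
  also have "\<dots> = t\<^sup>2 * (\<Sum>k\<in>G. A k * B k) + ((t * h * s) * (\<Sum>k\<in>G. A k) + (t * h) * (\<Sum>k\<in>G. A k * E k)) +
      ((t * f * s) * (\<Sum>k\<in>G. B k) + (t * f) * (\<Sum>k\<in>G. B k * E k)) +
      ((f * h) * (\<Sum>k\<in>G. s\<^sup>2) + (f * h * 2 * s) * (\<Sum>k\<in>G. E k) + (f * h) * (\<Sum>k\<in>G. E k * E k))"
    unfolding sum.distrib sum_distrib_left ..
  finally show ?thesis by (simp add: add_divide_distrib algebra_simps)
qed

context bar_process
begin

section \<open>Second moments of the process, uniformly over the tree\<close>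

lemma X_L2: "1 \<le> k \<Longrightarrow> integrable M (\<lambda>x. (X k x)\<^sup>2)"
proof (induction k rule: less_induct)
  case (less k)
  show ?case
  proof (cases "k \<le> 2 ^ p - 1")
    case True then show ?thesis using X_init less.prems by blast
  next
    case False
    define m i where "m = k div 2" and "i = k mod 2"
    have ki: "k = 2 * m + i" "i < 2" by (auto simp: m_def i_def)
    have "(2::nat) ^ p = 2 * 2 ^ (p - 1)" using p by (cases p) auto
    then have m: "2 ^ (p - 1) \<le> m" using False by (auto simp: m_def)
    have "1 \<le> m" by (rule order_trans[OF _ m]) simp
    then have mk: "m < k" using ki by simp
    have y2: "integrable M (\<lambda>x. (y c m x)\<^sup>2)" if "c \<le> p" for c
    proof (cases "c = 0")
      case False
      then have "1 \<le> m div 2 ^ (c - 1)" using that by (intro div_power_pos m) auto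
      moreover have "m div 2 ^ (c - 1) < k" using mk by (meson div_le_dividend le_less_trans)
      ultimately show ?thesis using less.IH[of "m div 2 ^ (c - 1)"] False m by (simp add: y_def)
    qed (use m in \<open>simp add: y_def\<close>)
    have "integrable M (\<lambda>x. (\<Sum>c\<in>{..p}. par i c * y c m x)\<^sup>2)"
      by (intro integrable_sum_square) (use y2 y_M in \<open>auto simp: power_mult_distrib\<close>)
    from integrable_add_square[OF _ e_M[OF ki(2)] this e_integrable_square[OF ki(2), of m]]
    have "integrable M (\<lambda>x. ((\<Sum>c\<le>p. par i c * y c m x) + e i m x)\<^sup>2)" using y_M by simp
    then show ?thesis
      by (rule Bochner_Integration.integrable_cong[OF refl, THEN iffD1, rotated])
         (simp add: BAR[OF m ki(2)] ki(1))
  qed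
qed

lemma y_L2: "c \<le> p \<Longrightarrow> integrable M (\<lambda>x. (y c k x)\<^sup>2)"
proof (cases "2 ^ (p - 1) \<le> k \<and> c \<noteq> 0")
  case True
  assume "c \<le> p"
  then have "1 \<le> k div 2 ^ (c - 1)" using True by (intro div_power_pos) auto
  then show ?thesis using X_L2 True by (simp add: y_def)
next
  case False
  then have "y c k = (\<lambda>_. if 2 ^ (p - 1) \<le> k then 1 else 0)" by (auto simp: y_def)
  then show ?thesis by simp
qed

lemma e_square_le: "i < 2 \<Longrightarrow> (\<integral>x. (e i k x)\<^sup>2 \<partial>M) \<le> v"
proof -
  assume i: "i < 2"
  let ?c = "if 2 ^ (p - 1) \<le> k then \<Gamma> i i else 0"
  have "integrable M (\<lambda>x. e i k x * e i k x)" using e_integrable_square[OF i] by (simp add: power2_eq_square)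
  from sigma_finite_subalgebra.real_cond_exp_int(2)[OF sigma_finite_sub this, of k]
  have "(\<integral>x. (e i k x)\<^sup>2 \<partial>M) = (\<integral>x. real_cond_exp M (H k) (\<lambda>x. e i k x * e i k x) x \<partial>M)"
    by (simp add: power2_eq_square)
  also have "\<dots> = (\<integral>x. ?c \<partial>M)" by (intro integral_cong_AE) (use e_cov[OF i i, of k] in auto)
  also have "\<dots> \<le> v" using v_pos by (auto simp: prob_space \<Gamma>_def)
  finally show ?thesis .
qed

definition lin :: "(nat \<Rightarrow> real) \<Rightarrow> nat \<Rightarrow> 'a \<Rightarrow> real" where
  "lin f k x = (\<Sum>j<p. f j * X (k div 2 ^ j) x)"

text \<open>Testing the companion recursion by \<open>f\<close> moves the matrix to the functional:
  the mother is tested by the dual functional, and intercept and innovation enter through the entry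
  \<open>f 0\<close> of the newest coordinate.\<close>

lemma lin_step:
  assumes m: "2 ^ (p - 1) \<le> m" and i: "i < 2" and x: "x \<in> space M" and \<theta>: "0 < \<theta>"
  shows "lin f (2 * m + i) x = \<theta> * lin (companion_dual p \<theta> (par i) f) m x + f 0 * (par i 0 + e i m x)"
proof -
  obtain q where q: "p = Suc q" using p by (cases p) auto
  have d: "(2 * m + i) div 2 ^ Suc j = m div 2 ^ j" for j
    using i by (simp add: div_mult2_eq)
  have shift: "(\<Sum>j<p. h j) = h 0 + (\<Sum>j<q. h (Suc j))" for h :: "nat \<Rightarrow> real"
    unfolding q by (rule sum.lessThan_Suc_shift)
  have "lin f (2 * m + i) x = f 0 * X (2 * m + i) x + (\<Sum>j<q. f (Suc j) * X (m div 2 ^ j) x)"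
    unfolding lin_def shift d by simp
  also have "(\<Sum>j<q. f (Suc j) * X (m div 2 ^ j) x) = (\<Sum>j<p. (if Suc j < p then f (Suc j) else 0) * X (m div 2 ^ j) x)"
    unfolding q by simp
  also have "X (2 * m + i) x = par i 0 + e i m x + (\<Sum>j<p. par i (Suc j) * X (m div 2 ^ j) x)"
    unfolding BAR[OF m i x] lessThan_Suc_atMost[symmetric] sum.lessThan_Suc_shift using m by (simp add: y_def)
  finally have "lin f (2 * m + i) x = f 0 * (par i 0 + e i m x) +
      (\<Sum>j<p. (f 0 * par i (Suc j) + (if Suc j < p then f (Suc j) else 0)) * X (m div 2 ^ j) x)"
    by (simp add: algebra_simps sum.distrib sum_distrib_left)
  also have "(\<Sum>j<p. (f 0 * par i (Suc j) + (if Suc j < p then f (Suc j) else 0)) * X (m div 2 ^ j) x) =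
      \<theta> * lin (companion_dual p \<theta> (par i) f) m x"
    using \<theta> by (simp add: lin_def companion_dual_def sum_distrib_left)
  finally show ?thesis by simp
qed

lemma lin_unit: "j < p \<Longrightarrow> lin (\<lambda>i. if i = j then \<delta> else 0) k x = \<delta> * X (k div 2 ^ j) x"
proof -
  assume j: "j < p"
  have "lin (\<lambda>i. if i = j then \<delta> else 0) k x = (\<Sum>i<p. if i = j then \<delta> * X (k div 2 ^ j) x else 0)"
    unfolding lin_def by (intro sum.cong) auto
  then show ?thesis using j by simp
qed

lemma dual_ball:
  obtains F \<theta> C \<delta> where "0 < \<theta>" "\<theta> < 1" "0 < \<delta>"
    "\<And>f i. f \<in> F \<Longrightarrow> i < p \<Longrightarrow> \<bar>f i\<bar> \<le> C"
    "\<And>i. i < p \<Longrightarrow> (\<lambda>j. if j = i then \<delta> else 0) \<in> F"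
    "\<And>f i. f \<in> F \<Longrightarrow> i < 2 \<Longrightarrow> companion_dual p \<theta> (par i) f \<in> F"
proof -
  obtain N where N: "is_norm p N" "max (op_norm p N (companion p a)) (op_norm p N (companion p b)) < 1"
    using contraction by blast
  obtain F \<theta> C \<delta> where *: "0 < \<theta>" "\<theta> < 1" "0 < \<delta>"
    "\<And>f i. f \<in> F \<Longrightarrow> i < p \<Longrightarrow> \<bar>f i\<bar> \<le> C"
    "\<And>i. i < p \<Longrightarrow> (\<lambda>j. if j = i then \<delta> else 0) \<in> F"
    "\<And>f. f \<in> F \<Longrightarrow> companion_dual p \<theta> a f \<in> F"
    "\<And>f. f \<in> F \<Longrightarrow> companion_dual p \<theta> b f \<in> F"
    by (rule companion_dual_ball[OF N(1) p N(2)]) blast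
  show thesis
    by (rule that[of \<theta> \<delta> F C]) (use * in \<open>auto simp: par_def\<close>)
qed

text \<open>Induction from mother to daughter, over all functionals of the dual ball at once because
  each step changes the functional. The contraction factor \<open>\<theta>\<close> leaves room for
  the innovation, whose second moment is at most \<open>v\<close>.\<close>

lemma y_second_moment_bounded: "\<exists>K. 0 \<le> K \<and> (\<forall>k c. c \<le> p \<longrightarrow> (\<integral>x. (y c k x)\<^sup>2 \<partial>M) \<le> K)"
proof -
  obtain F \<theta> C \<delta> where \<theta>: "0 < \<theta>" "\<theta> < 1" and \<delta>: "0 < \<delta>"
    and C: "\<And>f i. f \<in> F \<Longrightarrow> i < p \<Longrightarrow> \<bar>f i\<bar> \<le> C"
    and unit: "\<And>i. i < p \<Longrightarrow> (\<lambda>j. if j = i then \<delta> else 0) \<in> F"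
    and cl: "\<And>f i. f \<in> F \<Longrightarrow> i < 2 \<Longrightarrow> companion_dual p \<theta> (par i) f \<in> F"
    by (rule dual_ball) blast
  define B where "B = 2 * (a 0)\<^sup>2 + 2 * (b 0)\<^sup>2 + 2 * v"
  have B0: "0 \<le> B" using v_pos by (simp add: B_def)
  \<comment> \<open>The level preserved by
    \<open>t \<mapsto> \<theta> * t + C\<^sup>2 * B / (1 - \<theta>)\<close>, the recursion obtained
    below for the second moments.\<close>
  define K1 where "K1 = C\<^sup>2 * B / (1 - \<theta>)\<^sup>2"
  define K0 where "K0 = real p * C\<^sup>2 * (\<Sum>j=1..2 ^ p - 1. \<integral>x. (X j x)\<^sup>2 \<partial>M)"
  define K where "K = max K0 K1"
  have linM: "lin f k \<in> borel_measurable M" and lin2: "integrable M (\<lambda>x. (lin f k x)\<^sup>2)" if "2 ^ (p - 1) \<le> k" for f k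
  proof -
    have "1 \<le> k div 2 ^ j" if "j \<in> {..<p}" for j using that \<open>2 ^ (p - 1) \<le> k\<close> by (intro div_power_pos) auto
    then show "lin f k \<in> borel_measurable M" "integrable M (\<lambda>x. (lin f k x)\<^sup>2)"
      unfolding lin_def using X_rv X_L2
      by (auto intro!: integrable_sum_square borel_measurable_sum borel_measurable_times simp: power_mult_distrib)
  qed
  have main: "(\<integral>x. (lin f k x)\<^sup>2 \<partial>M) \<le> K" if "f \<in> F" "2 ^ (p - 1) \<le> k" for f k
    using that
  proof (induction k arbitrary: f rule: less_induct)
    case (less k)
    show ?case
    proof (cases "k < 2 ^ p")
      case True
      have idx: "k div 2 ^ j \<in> {1..2 ^ p - 1}" if "j < p" for j
      proof -
        have "1 \<le> k div 2 ^ j" using less.prems that by (intro div_power_pos) auto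
        moreover have "k div 2 ^ j < 2 ^ p" using True by (meson div_le_dividend le_less_trans)
        ultimately show ?thesis by auto
      qed
      have "(lin f k x)\<^sup>2 \<le> (\<Sum>j<p. real p * C\<^sup>2 * (X (k div 2 ^ j) x)\<^sup>2)" for x
      proof -
        have "(lin f k x)\<^sup>2 \<le> real p * (\<Sum>j<p. (f j * X (k div 2 ^ j) x)\<^sup>2)"
          unfolding lin_def using sum_squared_le_sum_of_squares[of "\<lambda>j. f j * X (k div 2 ^ j) x" "{..<p}"] by (simp add: mult.commute)
        also have "\<dots> \<le> real p * (\<Sum>j<p. C\<^sup>2 * (X (k div 2 ^ j) x)\<^sup>2)"
        proof (intro mult_left_mono sum_mono)
          fix j assume "j \<in> {..<p}"
          then have "(f j)\<^sup>2 \<le> C\<^sup>2" using C[OF less.prems(1), of j] abs_le_square_iff[of "f j" C] by auto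
          then show "(f j * X (k div 2 ^ j) x)\<^sup>2 \<le> C\<^sup>2 * (X (k div 2 ^ j) x)\<^sup>2"
            unfolding power_mult_distrib by (intro mult_right_mono) auto
        qed simp
        finally show ?thesis by (simp add: sum_distrib_left mult.assoc)
      qed
      then have "(\<integral>x. (lin f k x)\<^sup>2 \<partial>M) \<le> (\<integral>x. (\<Sum>j<p. real p * C\<^sup>2 * (X (k div 2 ^ j) x)\<^sup>2) \<partial>M)"
        using lin2[OF less.prems(2)] idx X_L2
        by (intro integral_mono) auto
      also have "\<dots> = real p * C\<^sup>2 * (\<Sum>j<p. \<integral>x. (X (k div 2 ^ j) x)\<^sup>2 \<partial>M)"
        using idx X_L2 by (subst Bochner_Integration.integral_sum) (auto simp: sum_distrib_left)
      \<comment> \<open>The ancestors of \<open>k\<close> are distinct, so the sum over them is part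
        of the sum over all initial states.\<close>
      also have "(\<Sum>j<p. \<integral>x. (X (k div 2 ^ j) x)\<^sup>2 \<partial>M) = (\<Sum>i\<in>(\<lambda>j. k div 2 ^ j) ` {..<p}. \<integral>x. (X i x)\<^sup>2 \<partial>M)"
      proof (subst sum.reindex)
        have "k div 2 ^ j' < k div 2 ^ j" if "j < j'" "j' < p" for j j'
        proof -
          have "k div 2 ^ j' = (k div 2 ^ j) div 2 ^ (j' - j)"
            using that by (simp add: div_mult2_eq[symmetric] power_add[symmetric])
          moreover have "1 < (2::nat) ^ (j' - j)" using that by (intro one_less_power) auto
          moreover have "1 \<le> k div 2 ^ j" using idx[of j] that by simp
          ultimately show ?thesis by (simp add: div_less_dividend)
        qed
        then show "inj_on (\<lambda>j. k div 2 ^ j) {..<p}"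
          by (intro inj_onI) (metis lessThan_iff nat_neq_iff)
      qed simp
      also have "\<dots> \<le> (\<Sum>j=1..2 ^ p - 1. \<integral>x. (X j x)\<^sup>2 \<partial>M)"
        using idx by (intro sum_mono2) auto
      finally have "(\<integral>x. (lin f k x)\<^sup>2 \<partial>M) \<le> K0" by (simp add: K0_def mult_left_mono)
      then show ?thesis by (simp add: K_def)
    next
      case False
      define m i where "m = k div 2" and "i = k mod 2"
      have ki: "k = 2 * m + i" "i < 2" by (auto simp: m_def i_def)
      have "(2::nat) ^ p = 2 * 2 ^ (p - 1)" using p by (cases p) auto
      then have m: "2 ^ (p - 1) \<le> m" using False by (auto simp: m_def)
      have "1 \<le> m" by (rule order_trans[OF _ m]) simp
      then have mk: "m < k" using ki by simp
      let ?g = "companion_dual p \<theta> (par i) f"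
      \<comment> \<open>Convexity of the square for the weights \<open>\<theta>\<close> and
        \<open>1 - \<theta>\<close>, at the points \<open>s\<close> and
        \<open>t / (1 - \<theta>)\<close>.\<close>
      have conv: "(\<theta> * s + t)\<^sup>2 \<le> \<theta> * s\<^sup>2 + t\<^sup>2 / (1 - \<theta>)" for s t :: real
      proof -
        have "\<theta> * s\<^sup>2 + t\<^sup>2 / (1 - \<theta>) - (\<theta> * s + t)\<^sup>2 = \<theta> / (1 - \<theta>) * ((1 - \<theta>) * s - t)\<^sup>2"
          using \<theta> by (simp add: divide_simps) (simp add: power2_eq_square algebra_simps)
        moreover have "0 \<le> \<theta> / (1 - \<theta>) * ((1 - \<theta>) * s - t)\<^sup>2" using \<theta> by simp
        ultimately show ?thesis by linarith
      qed
      have f0: "(f 0)\<^sup>2 \<le> C\<^sup>2" using C[OF less.prems(1), of 0] p abs_le_square_iff[of "f 0" C] by auto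
      have pb: "(par i 0)\<^sup>2 \<le> (a 0)\<^sup>2 + (b 0)\<^sup>2" by (simp add: par_def)
      have "(lin f k x)\<^sup>2 \<le> \<theta> * (lin ?g m x)\<^sup>2 + C\<^sup>2 * (2 * (a 0)\<^sup>2 + 2 * (b 0)\<^sup>2 + 2 * (e i m x)\<^sup>2) / (1 - \<theta>)" if x: "x \<in> space M" for x
      proof -
        have "(lin f k x)\<^sup>2 \<le> \<theta> * (lin ?g m x)\<^sup>2 + (f 0 * (par i 0 + e i m x))\<^sup>2 / (1 - \<theta>)"
          unfolding ki(1) lin_step[OF m ki(2) x \<theta>(1)] by (rule conv)
        also have "(f 0 * (par i 0 + e i m x))\<^sup>2 \<le> C\<^sup>2 * (2 * (a 0)\<^sup>2 + 2 * (b 0)\<^sup>2 + 2 * (e i m x)\<^sup>2)"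
          unfolding power_mult_distrib
        proof (intro mult_mono f0)
          have "(par i 0 + e i m x)\<^sup>2 \<le> 2 * (par i 0)\<^sup>2 + 2 * (e i m x)\<^sup>2"
            using zero_le_power2[of "par i 0 - e i m x"] by (simp add: power2_diff power2_sum)
          then show "(par i 0 + e i m x)\<^sup>2 \<le> 2 * (a 0)\<^sup>2 + 2 * (b 0)\<^sup>2 + 2 * (e i m x)\<^sup>2" using pb by simp
        qed auto
        finally show ?thesis using \<theta> by (simp add: divide_right_mono)
      qed
      then have "(\<integral>x. (lin f k x)\<^sup>2 \<partial>M) \<le>
        (\<integral>x. \<theta> * (lin ?g m x)\<^sup>2 + C\<^sup>2 * (2 * (a 0)\<^sup>2 + 2 * (b 0)\<^sup>2 + 2 * (e i m x)\<^sup>2) / (1 - \<theta>) \<partial>M)"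
        using lin2[OF less.prems(2)] lin2[OF m] e_integrable_square[OF ki(2)] by (intro integral_mono) auto
      also have "\<dots> = \<theta> * (\<integral>x. (lin ?g m x)\<^sup>2 \<partial>M) + C\<^sup>2 * (2 * (a 0)\<^sup>2 + 2 * (b 0)\<^sup>2 + 2 * (\<integral>x. (e i m x)\<^sup>2 \<partial>M)) / (1 - \<theta>)"
        using lin2[OF m] e_integrable_square[OF ki(2)] by (simp add: prob_space)
      also have "\<dots> \<le> \<theta> * K + C\<^sup>2 * B / (1 - \<theta>)"
        using less.IH[OF mk cl[OF less.prems(1) ki(2)] m] e_square_le[OF ki(2), of m] \<theta>
        by (intro add_mono mult_left_mono divide_right_mono) (auto simp: B_def)
      also have "C\<^sup>2 * B / (1 - \<theta>) = (1 - \<theta>) * K1" using \<theta> by (simp add: K1_def power2_eq_square)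
      also have "\<theta> * K + (1 - \<theta>) * K1 \<le> \<theta> * K + (1 - \<theta>) * K" using \<theta> by (intro add_left_mono mult_left_mono) (auto simp: K_def)
      finally show ?thesis by (simp add: algebra_simps)
    qed
  qed
  show ?thesis
  proof (intro exI[of _ "max 1 (\<bar>K\<bar> / \<delta>\<^sup>2)"] conjI allI impI)
    fix k c assume c: "c \<le> p"
    show "(\<integral>x. (y c k x)\<^sup>2 \<partial>M) \<le> max 1 (\<bar>K\<bar> / \<delta>\<^sup>2)"
    proof (cases "2 ^ (p - 1) \<le> k \<and> c \<noteq> 0")
      case True
      then have j: "c - 1 < p" using c by (cases c) auto
      have "(\<lambda>x. (lin (\<lambda>i. if i = c - 1 then \<delta> else 0) k x)\<^sup>2) = (\<lambda>x. \<delta>\<^sup>2 * (y c k x)\<^sup>2)"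
        unfolding lin_unit[OF j] using True by (simp add: y_def power_mult_distrib)
      then have "\<delta>\<^sup>2 * (\<integral>x. (y c k x)\<^sup>2 \<partial>M) \<le> K" using main[OF unit[OF j], of k] True by simp
      then have "(\<integral>x. (y c k x)\<^sup>2 \<partial>M) \<le> K / \<delta>\<^sup>2" using \<delta> by (simp add: field_simps)
      also have "\<dots> \<le> \<bar>K\<bar> / \<delta>\<^sup>2" by (intro divide_right_mono) auto
      finally show ?thesis by simp
    next
      case False
      then have "(\<lambda>x. (y c k x)\<^sup>2) = (\<lambda>x. if 2 ^ (p - 1) \<le> k then 1 else 0)" by (auto simp: y_def)
      then show ?thesis by (simp add: prob_space le_max_iff_disj)
    qed
  qed simp
qed

lemma mds_gen_summable:
  assumes \<eta>: "mds \<eta>" and w: "AE x in M. \<exists>K. \<forall>k. real_cond_exp M (H k) (\<lambda>x. (\<eta> k x)\<^sup>2) x \<le> K"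
    and c: "\<And>k. c k \<in> borel_measurable (H k)"
    and s: "AE x in M. summable (\<lambda>l. \<Sum>k\<in>gen_set l. (c k x)\<^sup>2)"
  shows "AE x in M. summable (\<lambda>l. \<Sum>k\<in>gen_set l. c k x * \<eta> k x)"
proof -
  have "AE x in M. summable (\<lambda>k. c k x * \<eta> k x)"
    by (rule mds_local_convergent[OF \<eta> c w]) (use s in \<open>auto elim!: eventually_mono intro: summable_of_gen_set\<close>)
  then show ?thesis by (auto elim!: eventually_mono intro: summable_gen_set)
qed

section \<open>Laws of large numbers within a generation\<close>

definition mean_ye :: "'a \<Rightarrow> nat \<Rightarrow> nat \<Rightarrow> nat \<Rightarrow> real" where
  "mean_ye x i c l = (\<Sum>k\<in>gen_set l. y c k x * e i k x) / 2 ^ l"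

definition mean_ee :: "'a \<Rightarrow> nat \<Rightarrow> nat \<Rightarrow> nat \<Rightarrow> real" where
  "mean_ee x i j l = (\<Sum>k\<in>gen_set l. e i k x * e j k x) / 2 ^ l"

definition mean_yy :: "'a \<Rightarrow> nat \<Rightarrow> nat \<Rightarrow> nat \<Rightarrow> real" where
  "mean_yy x c d l = (\<Sum>k\<in>gen_set l. y c k x * y d k x) / 2 ^ l"

text \<open>With coefficients \<open>y / 2 ^ l\<close> the expected sum of squared coefficients over
  generation \<open>l\<close> is at most \<open>K / 2 ^ l\<close>. The martingale series converges,
  so its blocks, which are the means in question, tend to zero.\<close>

lemma mean_ye_tendsto:
  assumes i: "i < 2" and c: "c \<le> p"
  shows "AE x in M. mean_ye x i c \<longlonglongrightarrow> 0"
proof -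
  obtain K where K: "\<And>k c. c \<le> p \<Longrightarrow> (\<integral>x. (y c k x)\<^sup>2 \<partial>M) \<le> K" using y_second_moment_bounded by blast
  define w where "w k x = y c k x / 2 ^ generation k" for k x
  have wg: "w k x = y c k x / 2 ^ l" if "k \<in> gen_set l" for k l x
    using generation_eq[OF that] by (simp add: w_def)
  have "AE x in M. summable (\<lambda>l. \<Sum>k\<in>gen_set l. (y c k x / 2 ^ l)\<^sup>2)"
  proof (rule AE_summable_of_expectation)
    show "integrable M (\<lambda>x. \<Sum>k\<in>gen_set l. (y c k x / 2 ^ l)\<^sup>2)" for l
      using y_L2[OF c] by (auto simp: power_divide)
    show "(\<integral>x. (\<Sum>k\<in>gen_set l. (y c k x / 2 ^ l)\<^sup>2) \<partial>M) \<le> K * (1 / 2) ^ l" for l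
    proof -
      have "(\<integral>x. (\<Sum>k\<in>gen_set l. (y c k x / 2 ^ l)\<^sup>2) \<partial>M) = (\<Sum>k\<in>gen_set l. (\<integral>x. (y c k x)\<^sup>2 \<partial>M) / (2 ^ l)\<^sup>2)"
        using y_L2[OF c] by (subst Bochner_Integration.integral_sum) (auto simp: power_divide)
      also have "\<dots> \<le> (\<Sum>k\<in>gen_set l. K / (2 ^ l)\<^sup>2)" by (intro sum_mono divide_right_mono K c) auto
      also have "\<dots> = K * (1 / 2) ^ l" by (simp add: card_gen_set power2_eq_square field_simps)
      finally show ?thesis .
    qed
    show "summable (\<lambda>l. K * (1 / 2) ^ l)" by (intro summable_mult summable_geometric) simp
  qed (auto intro: sum_nonneg)
  then have s: "AE x in M. summable (\<lambda>l. \<Sum>k\<in>gen_set l. (w k x)\<^sup>2)" using wg by simp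
  have "AE x in M. summable (\<lambda>l. \<Sum>k\<in>gen_set l. w k x * e i k x)"
    by (rule mds_gen_summable[OF mds_e[OF i] e_var_bounded[OF i] _ s]) (use y_measurable[OF c] in \<open>simp add: w_def\<close>)
  then show ?thesis
  proof eventually_elim
    case (elim x)
    have "(\<Sum>k\<in>gen_set l. w k x * e i k x) = mean_ye x i c l" for l
      unfolding mean_ye_def sum_divide_distrib by (intro sum.cong) (auto simp: wg)
    then show ?case using summable_LIMSEQ_zero[OF elim] by simp
  qed
qed

text \<open>The coefficients \<open>1 / 2 ^ l\<close> have squares summing to
  \<open>1 / 2 ^ l\<close> over a generation; the fourth moments of the innovations enter through
  the conditional variances of \<open>ecov\<close>.\<close>

lemma mean_ee_tendsto:
  assumes i: "i < 2" and j: "j < 2"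
  shows "AE x in M. mean_ee x i j \<longlonglongrightarrow> \<Gamma> i j"
proof -
  define w where "w k x = (1 :: real) / 2 ^ generation k" for k :: nat and x :: 'a
  have wg: "w k x = 1 / 2 ^ l" if "k \<in> gen_set l" for k l x
    using generation_eq[OF that] by (simp add: w_def)
  have "(\<Sum>k\<in>gen_set l. (w k x)\<^sup>2) = (1 / 2) ^ l" for l x
  proof -
    have "(\<Sum>k\<in>gen_set l. (w k x)\<^sup>2) = (\<Sum>k\<in>gen_set l. (1 / 2 ^ l)\<^sup>2)" by (intro sum.cong) (auto simp: wg)
    then show ?thesis by (simp add: card_gen_set power2_eq_square field_simps)
  qed
  then have s: "AE x in M. summable (\<lambda>l. \<Sum>k\<in>gen_set l. (w k x)\<^sup>2)" by (simp add: summable_geometric)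
  have "AE x in M. summable (\<lambda>l. \<Sum>k\<in>gen_set l. w k x * ecov i j k x)"
    by (rule mds_gen_summable[OF mds_ecov[OF i j] ecov_var_bounded[OF i j] _ s]) (simp add: w_def)
  then show ?thesis
  proof eventually_elim
    case (elim x)
    have "(\<Sum>k\<in>gen_set l. w k x * ecov i j k x) + \<Gamma> i j = mean_ee x i j l" if l: "p - 1 \<le> l" for l
    proof -
      have "(\<Sum>k\<in>gen_set l. w k x * ecov i j k x) = (\<Sum>k\<in>gen_set l. e i k x * e j k x / 2 ^ l - \<Gamma> i j / 2 ^ l)"
        using gen_set_ge[OF _ l] by (intro sum.cong) (auto simp: wg ecov_def diff_divide_distrib)
      also have "\<dots> = mean_ee x i j l - \<Gamma> i j"
        by (simp add: sum_subtractf mean_ee_def sum_divide_distrib card_gen_set)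
      finally show ?thesis by simp
    qed
    then have "\<forall>\<^sub>F l in sequentially. (\<Sum>k\<in>gen_set l. w k x * ecov i j k x) + \<Gamma> i j = mean_ee x i j l"
      unfolding eventually_sequentially by blast
    moreover have "(\<lambda>l. (\<Sum>k\<in>gen_set l. w k x * ecov i j k x) + \<Gamma> i j) \<longlonglongrightarrow> 0 + \<Gamma> i j"
      by (intro tendsto_add tendsto_const summable_LIMSEQ_zero[OF elim])
    ultimately show ?case using Lim_transform_eventually by fastforce
  qed
qed

text \<open>The almost sure facts from which convergence of all empirical second moments follows
  path by path, by a deterministic recursion.\<close>

definition good :: "'a \<Rightarrow> bool" where
  "good x \<longleftrightarrow> x \<in> space M \<and> (\<forall>i<2. \<forall>c\<le>p. mean_ye x i c \<longlonglongrightarrow> 0) \<and> (\<forall>i<2. \<forall>j<2. mean_ee x i j \<longlonglongrightarrow> \<Gamma> i j)"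

lemma AE_good: "AE x in M. good x"
proof -
  have "AE x in M. \<forall>i\<in>{..<2}. \<forall>c\<in>{..p}. mean_ye x i c \<longlonglongrightarrow> 0"
    by (intro AE_finite_allI finite_lessThan finite_atMost mean_ye_tendsto) auto
  moreover have "AE x in M. \<forall>i\<in>{..<2}. \<forall>j\<in>{..<2}. mean_ee x i j \<longlonglongrightarrow> \<Gamma> i j"
    by (intro AE_finite_allI finite_lessThan mean_ee_tendsto) auto
  ultimately show ?thesis using AE_space by eventually_elim (auto simp: good_def)
qed

lemma sum_2: "(\<Sum>i<2. f i) = f 0 + f (Suc 0)" for f :: "nat \<Rightarrow> real"
  by (simp add: numeral_2_eq_2)

text \<open>First moments \<open>q1\<close> come before second moments \<open>q2\<close>, as they
  occur in the remainder of the latter. Averaging \<open>lin_step\<close> over the two daughters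
  gives the contraction \<open>\<theta>\<close> on the dual ball, and for products
  \<open>\<theta>\<^sup>2\<close> on pairs of functionals; the remainders converge because the means
  with innovations do.\<close>

lemma good_mean_yy_convergent:
  assumes g: "good x" and c: "c \<le> p" and d: "d \<le> p"
  shows "convergent (mean_yy x c d)"
proof -
  obtain F \<theta> C \<delta> where \<theta>: "0 < \<theta>" "\<theta> < 1" and \<delta>: "0 < \<delta>"
    and C: "\<And>f i. f \<in> F \<Longrightarrow> i < p \<Longrightarrow> \<bar>f i\<bar> \<le> C"
    and unit: "\<And>i. i < p \<Longrightarrow> (\<lambda>j. if j = i then \<delta> else 0) \<in> F"
    and cl: "\<And>f i. f \<in> F \<Longrightarrow> i < 2 \<Longrightarrow> companion_dual p \<theta> (par i) f \<in> F"
    by (rule dual_ball) blast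
  have x: "x \<in> space M" and ye: "\<And>i c. i < 2 \<Longrightarrow> c \<le> p \<Longrightarrow> convergent (mean_ye x i c)"
    and ee: "\<And>i j. i < 2 \<Longrightarrow> j < 2 \<Longrightarrow> convergent (mean_ee x i j)"
    using g unfolding good_def convergent_def by blast+
  define g where "g i f = companion_dual p \<theta> (par i) f" for i f
  have gF: "\<And>f i. f \<in> F \<Longrightarrow> i < 2 \<Longrightarrow> g i f \<in> F" using cl by (simp add: g_def)
  have ls: "lin f (2 * m + i) x = \<theta> * lin (g i f) m x + f 0 * (par i 0 + e i m x)"
    if "i < 2" "m \<in> gen_set l" "p - 1 \<le> l" for f m i l
    unfolding g_def by (rule lin_step[OF gen_set_ge[OF that(2,3)] that(1) x \<theta>(1)])
  \<comment> \<open>A bound free of \<open>f\<close>, for the generations up to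
    \<open>p - 1\<close>, which the recursion does not reach.\<close>
  define Bl where "Bl l k = (\<Sum>j<p. C * \<bar>X (k div 2 ^ j) x\<bar>)" for l k :: nat
  have linb: "\<bar>lin f k x\<bar> \<le> Bl l k" if "f \<in> F" for f k l
    unfolding lin_def Bl_def
    by (rule order_trans[OF sum_abs]) (use C[OF that] in \<open>auto simp: abs_mult intro!: sum_mono mult_right_mono\<close>)
  have Bl0: "0 \<le> Bl l k" for l k using order_trans[OF abs_ge_zero linb[OF unit[of 0]]] p by simp
  have f0: "\<bar>f 0\<bar> \<le> C" if "f \<in> F" for f using C[OF that] p by simp
  have y0: "y 0 k x * e i k x = e i k x" for k i by (simp add: y_def e_def)
  define q1 where "q1 l f = (\<Sum>k\<in>gen_set l. lin f k x) / 2 ^ l" for l f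
  define q2 where "q2 l fh = (\<Sum>k\<in>gen_set l. lin (fst fh) k x * lin (snd fh) k x) / 2 ^ l" for l fh
  define nu where "nu i l f = (\<Sum>j<p. f j * mean_ye x i (Suc j) l)" for i l f
  have nu: "(\<Sum>k\<in>gen_set l. lin f k x * e i k x) / 2 ^ l = nu i l f" for i l f
  proof -
    have "lin f k x * e i k x = (\<Sum>j<p. f j * (y (Suc j) k x * e i k x))" for k
      unfolding lin_def sum_distrib_right by (intro sum.cong) (auto simp: y_def e_def)
    then have "(\<Sum>k\<in>gen_set l. lin f k x * e i k x) = (\<Sum>j<p. f j * (\<Sum>k\<in>gen_set l. y (Suc j) k x * e i k x))"
      by (simp add: sum.swap[of _ "{..<p}"] sum_distrib_left)
    then show ?thesis by (simp add: nu_def mean_ye_def flip: sum_divide_distrib)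
  qed
  have me: "(\<Sum>k\<in>gen_set l. e i k x) / 2 ^ l = mean_ye x i 0 l" for i l by (simp add: mean_ye_def y0)
  define r1 where "r1 l f = f 0 * (\<Sum>i<2. (par i 0 + mean_ye x i 0 l) / 2)" for l :: nat and f :: "nat \<Rightarrow> real"
  have F0: "unif_Cauchy_bdd F (\<lambda>l f. f 0)" by (rule unif_Cauchy_bdd_const) (rule f0)
  have r1: "unif_Cauchy_bdd F r1" unfolding r1_def
    by (intro unif_Cauchy_bdd_mult F0 unif_Cauchy_bdd_seq convergent_sum convergent_divide_const convergent_add convergent_const ye) auto
  have card: "(\<Sum>k\<in>gen_set l. s) / 2 ^ l = s" for l and s :: real by (simp add: card_gen_set)
  have q1: "unif_Cauchy_bdd F q1"
  proof (rule unif_Cauchy_bdd_contraction[OF _ _ _ less_imp_le[OF \<theta>(1)] \<theta>(2) r1])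
    fix l f assume l: "p - 1 \<le> l" and f: "f \<in> F"
    have "q1 (Suc l) f = (\<Sum>k\<in>gen_set l. (\<Sum>i<2. \<theta> * lin (g i f) k x + f 0 * (par i 0 + e i k x))) / 2 ^ Suc l"
      unfolding q1_def sum_gen_set_Suc sum_2
      by (intro arg_cong[where f = "\<lambda>z. z / _"] sum.cong refl arg_cong2[where f = "(+)"])
         (use ls[of 0 _ l f] ls[of 1 _ l f] l in auto)
    also have "\<dots> = (\<Sum>i<2. \<theta> * (q1 l (g i f) / 2) + f 0 * (((\<Sum>k\<in>gen_set l. par i 0) / 2 ^ l + (\<Sum>k\<in>gen_set l. e i k x) / 2 ^ l) / 2))"
      unfolding q1_def by (simp add: sum_2 sum.distrib sum_distrib_left[symmetric] field_simps)
    also have "\<dots> = \<theta> * ((q1 l (g 0 f) + q1 l (g 1 f)) / 2) + r1 l f"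
      unfolding card me r1_def by (simp add: sum_2 algebra_simps add_divide_distrib)
    finally show "q1 (Suc l) f = \<theta> * ((q1 l (g 0 f) + q1 l (g 1 f)) / 2) + r1 l f" .
  next
    fix l f assume l: "l \<le> p - 1" and f: "f \<in> F"
    have "\<bar>q1 l f\<bar> \<le> (\<Sum>k\<in>gen_set l. Bl l k)"
    proof -
      have "\<bar>\<Sum>k\<in>gen_set l. lin f k x\<bar> \<le> (\<Sum>k\<in>gen_set l. Bl l k)"
        by (rule order_trans[OF sum_abs]) (intro sum_mono linb f)
      moreover have "\<bar>q1 l f\<bar> \<le> \<bar>\<Sum>k\<in>gen_set l. lin f k x\<bar>" unfolding q1_def by (simp add: divide_le_eq mult_le_cancel_left1)
      ultimately show ?thesis by linarith
    qed
    also have "\<dots> \<le> (\<Sum>l\<le>p - 1. \<Sum>k\<in>gen_set l. Bl l k)"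
      using l by (intro member_le_sum) (auto intro!: sum_nonneg Bl0)
    finally show "\<bar>q1 l f\<bar> \<le> (\<Sum>l\<le>p - 1. \<Sum>k\<in>gen_set l. Bl l k)" .
  qed (use gF in auto)
  \<comment> \<open>In the cross terms a functional at the mother meets the intercept, which yields
    \<open>q1\<close>, and the innovation, which yields \<open>nu\<close>; the squared innovation
    yields \<open>mean_ee\<close>. The factor \<open>1 / 2\<close> averages the two
    daughters.\<close>
  define r2 where "r2 l fh = (\<Sum>i<2. (\<theta> * (snd fh 0 * (par i 0 * q1 l (g i (fst fh)) + nu i l (g i (fst fh)))) +
      \<theta> * (fst fh 0 * (par i 0 * q1 l (g i (snd fh)) + nu i l (g i (snd fh)))) +
      (fst fh 0 * snd fh 0) * ((par i 0)\<^sup>2 + 2 * par i 0 * mean_ye x i 0 l + mean_ee x i i l)) * (1 / 2))" for l fh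
  have nuC: "unif_Cauchy_bdd F (\<lambda>l f. nu i l f)" if "i < 2" for i unfolding nu_def
    by (intro unif_Cauchy_bdd_sum unif_Cauchy_bdd_mult unif_Cauchy_bdd_seq ye)
       (use C that in \<open>auto intro!: unif_Cauchy_bdd_const\<close>)
  have cst: "unif_Cauchy_bdd F' (\<lambda>l f. s)" for F' :: "'b set" and s :: real by (rule unif_Cauchy_bdd_const[of _ _ "\<bar>s\<bar>"]) simp
  have entry0: "unif_Cauchy_bdd (F \<times> F) (\<lambda>l fh. fst fh 0)" "unif_Cauchy_bdd (F \<times> F) (\<lambda>l fh. snd fh 0)"
    by (rule unif_Cauchy_bdd_const, use f0 in force)+
  have r2: "unif_Cauchy_bdd (F \<times> F) r2" unfolding r2_def
  proof (intro unif_Cauchy_bdd_sum unif_Cauchy_bdd_add unif_Cauchy_bdd_mult cst entry0)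
    fix i :: nat assume "i \<in> {..<2}"
    then have i: "i < 2" by simp
    show "unif_Cauchy_bdd (F \<times> F) (\<lambda>l fh. q1 l (g i (fst fh)))" "unif_Cauchy_bdd (F \<times> F) (\<lambda>l fh. q1 l (g i (snd fh)))"
      by (rule unif_Cauchy_bdd_compose[OF q1], use gF i in force)+
    show "unif_Cauchy_bdd (F \<times> F) (\<lambda>l fh. nu i l (g i (fst fh)))" "unif_Cauchy_bdd (F \<times> F) (\<lambda>l fh. nu i l (g i (snd fh)))"
      by (rule unif_Cauchy_bdd_compose[OF nuC[OF i]], use gF i in force)+
    show "unif_Cauchy_bdd (F \<times> F) (\<lambda>l fh. mean_ye x i 0 l)" "unif_Cauchy_bdd (F \<times> F) (\<lambda>l fh. mean_ee x i i l)"
      by (rule unif_Cauchy_bdd_seq, use ye ee i in blast)+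
  qed simp
  have \<theta>2: "0 \<le> \<theta>\<^sup>2" "\<theta>\<^sup>2 < 1" using \<theta> by (simp_all add: abs_square_less_1)
  have q2: "unif_Cauchy_bdd (F \<times> F) q2"
  proof (rule unif_Cauchy_bdd_contraction[OF _ _ _ \<theta>2 r2])
    fix l fh assume l: "p - 1 \<le> l" and fh: "fh \<in> F \<times> F"
    obtain f h where fhe: "fh = (f, h)" by (cases fh)
    have "q2 (Suc l) fh = (\<Sum>k\<in>gen_set l. (\<Sum>i<2. (\<theta> * lin (g i f) k x + f 0 * (par i 0 + e i k x)) * (\<theta> * lin (g i h) k x + h 0 * (par i 0 + e i k x)))) / 2 ^ Suc l"
      unfolding q2_def sum_gen_set_Suc sum_2 fhe fst_conv snd_conv
      by (intro arg_cong[where f = "\<lambda>z. z / _"] sum.cong refl arg_cong2[where f = "(+)"] arg_cong2[where f = "(*)"])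
         (use ls[of 0 _ l f] ls[of 1 _ l f] ls[of 0 _ l h] ls[of 1 _ l h] l in auto)
    also have "\<dots> = (\<Sum>i<2. (\<Sum>k\<in>gen_set l. (\<theta> * lin (g i f) k x + f 0 * (par i 0 + e i k x)) * (\<theta> * lin (g i h) k x + h 0 * (par i 0 + e i k x))) / 2 ^ l * (1 / 2))"
      by (simp add: sum_2 sum.distrib add_divide_distrib)
    also have "\<dots> = (\<Sum>i<2. \<theta>\<^sup>2 * (q2 l (g i f, g i h) / 2) + (\<theta> * (h 0 * (par i 0 * q1 l (g i f) + nu i l (g i f))) +
      \<theta> * (f 0 * (par i 0 * q1 l (g i h) + nu i l (g i h))) +
      (f 0 * h 0) * ((par i 0)\<^sup>2 + 2 * par i 0 * mean_ye x i 0 l + mean_ee x i i l)) * (1 / 2))"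
    proof (rule sum.cong)
      fix i :: nat assume "i \<in> {..<2}"
      have "(\<Sum>k\<in>gen_set l. (\<theta> * lin (g i f) k x + f 0 * (par i 0 + e i k x)) * (\<theta> * lin (g i h) k x + h 0 * (par i 0 + e i k x))) / 2 ^ l =
        \<theta>\<^sup>2 * q2 l (g i f, g i h) + \<theta> * (h 0 * (par i 0 * q1 l (g i f) + nu i l (g i f))) +
          \<theta> * (f 0 * (par i 0 * q1 l (g i h) + nu i l (g i h))) +
          (f 0 * h 0) * ((par i 0)\<^sup>2 + 2 * par i 0 * mean_ye x i 0 l + mean_ee x i i l)"
        unfolding sum_affine_products card me nu q1_def[symmetric] mean_ee_def[symmetric] by (simp add: q2_def)
      then show "(\<Sum>k\<in>gen_set l. (\<theta> * lin (g i f) k x + f 0 * (par i 0 + e i k x)) * (\<theta> * lin (g i h) k x + h 0 * (par i 0 + e i k x))) / 2 ^ l * (1 / 2) =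
        \<theta>\<^sup>2 * (q2 l (g i f, g i h) / 2) + (\<theta> * (h 0 * (par i 0 * q1 l (g i f) + nu i l (g i f))) +
        \<theta> * (f 0 * (par i 0 * q1 l (g i h) + nu i l (g i h))) +
        (f 0 * h 0) * ((par i 0)\<^sup>2 + 2 * par i 0 * mean_ye x i 0 l + mean_ee x i i l)) * (1 / 2)"
        by (simp add: field_simps)
    qed simp
    also have "\<dots> = \<theta>\<^sup>2 * ((q2 l (g 0 f, g 0 h) + q2 l (g 1 f, g 1 h)) / 2) + r2 l fh"
      unfolding r2_def fhe fst_conv snd_conv sum.distrib by (simp add: sum_2 field_simps)
    finally show "q2 (Suc l) fh = \<theta>\<^sup>2 * ((q2 l (map_prod (g 0) (g 0) fh) + q2 l (map_prod (g 1) (g 1) fh)) / 2) + r2 l fh"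
      by (simp add: fhe)
  next
    fix l fh assume l: "l \<le> p - 1" and "fh \<in> F \<times> F"
    then obtain f h where fh: "fh = (f, h)" "f \<in> F" "h \<in> F" by auto
    have "\<bar>q2 l fh\<bar> \<le> (\<Sum>k\<in>gen_set l. Bl l k * Bl l k)"
    proof -
      have "\<bar>\<Sum>k\<in>gen_set l. lin f k x * lin h k x\<bar> \<le> (\<Sum>k\<in>gen_set l. Bl l k * Bl l k)"
        by (rule order_trans[OF sum_abs]) (auto simp: abs_mult intro!: sum_mono mult_mono linb fh Bl0)
      moreover have "\<bar>q2 l fh\<bar> \<le> \<bar>\<Sum>k\<in>gen_set l. lin f k x * lin h k x\<bar>"
        unfolding q2_def fh by (simp add: divide_le_eq mult_le_cancel_left1)
      ultimately show ?thesis by linarith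
    qed
    also have "\<dots> \<le> (\<Sum>l\<le>p - 1. \<Sum>k\<in>gen_set l. Bl l k * Bl l k)"
      using l by (intro member_le_sum) (auto intro!: sum_nonneg Bl0 mult_nonneg_nonneg)
    finally show "\<bar>q2 l fh\<bar> \<le> (\<Sum>l\<le>p - 1. \<Sum>k\<in>gen_set l. Bl l k * Bl l k)" .
  qed (use gF in auto)
  \<comment> \<open>The scaled coordinate functionals lie in the ball; dividing by
    \<open>\<delta>\<close> or its square recovers the entries of the moment matrix.\<close>
  define un where "un j = (\<lambda>i :: nat. if i = j then \<delta> else 0)" for j
  have un: "un j \<in> F" "lin (un j) k x = \<delta> * X (k div 2 ^ j) x" if "j < p" for j k
    unfolding un_def using unit[OF that] lin_unit[OF that] by auto
  have conv: "convergent s" if "convergent t" "\<And>l. p - 1 \<le> l \<Longrightarrow> s l = t l" for s t :: "nat \<Rightarrow> real"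
  proof -
    have "\<forall>\<^sub>F l in sequentially. t l = s l" using that(2) unfolding eventually_sequentially by (intro exI[of _ "p - 1"]) auto
    then show ?thesis using that(1) Lim_transform_eventually unfolding convergent_def by blast
  qed
  have q1c: "convergent (\<lambda>l. q1 l (un j) / \<delta>)" if "j < p" for j
    by (intro convergent_divide_const unif_Cauchy_bdd_convergent[OF q1 un(1)[OF that]])
  have q2c: "convergent (\<lambda>l. q2 l (un j, un i) / \<delta>\<^sup>2)" if "j < p" "i < p" for i j
    by (intro convergent_divide_const unif_Cauchy_bdd_convergent[OF q2]) (use un that in auto)
  show ?thesis
  proof (cases "c = 0"; cases "d = 0")
    assume cd: "c = 0" "d = 0"
    show ?thesis
      by (rule conv[OF convergent_const[of 1]]) (use cd gen_set_ge in \<open>simp add: mean_yy_def y_def card_gen_set\<close>)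
  next
    assume cd: "c = 0" "d \<noteq> 0"
    have "mean_yy x c d l = q1 l (un (d - 1)) / \<delta>" if "p - 1 \<le> l" for l
      using cd d \<delta> gen_set_ge[OF _ that] un(2)[of "d - 1"]
      by (simp add: mean_yy_def y_def q1_def sum_distrib_left[symmetric])
    then show ?thesis using conv[OF q1c[of "d - 1"]] cd d by simp
  next
    assume cd: "c \<noteq> 0" "d = 0"
    have "mean_yy x c d l = q1 l (un (c - 1)) / \<delta>" if "p - 1 \<le> l" for l
      using cd c \<delta> gen_set_ge[OF _ that] un(2)[of "c - 1"]
      by (simp add: mean_yy_def y_def q1_def sum_distrib_left[symmetric])
    then show ?thesis using conv[OF q1c[of "c - 1"]] cd c by simp
  next
    assume cd: "c \<noteq> 0" "d \<noteq> 0"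
    have "mean_yy x c d l = q2 l (un (c - 1), un (d - 1)) / \<delta>\<^sup>2" if "p - 1 \<le> l" for l
    proof -
      have "lin (un (c - 1)) k x * lin (un (d - 1)) k x = \<delta>\<^sup>2 * (y c k x * y d k x)" if "k \<in> gen_set l" for k
        using cd c d un(2)[of "c - 1"] un(2)[of "d - 1"] gen_set_ge[OF that \<open>p - 1 \<le> l\<close>]
        by (simp add: y_def power2_eq_square)
      then show ?thesis using \<delta> by (simp add: mean_yy_def q2_def sum_distrib_left[symmetric])
    qed
    then show ?thesis using conv[OF q2c[of "c - 1" "d - 1"]] cd c d by simp
  qed
qed

text \<open>Reads a functional of the daughter's vector at the mother: the intercept stays, the
  weight of the newborn is dropped, the later weights move down by one. The mother's oldest
  coordinate gets weight 0, since it is not part of the daughter's vector.\<close>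

definition shift :: "(nat \<Rightarrow> real) \<Rightarrow> nat \<Rightarrow> real" where
  "shift u c = (if c = 0 then u 0 else if c < p then u (Suc c) else 0)"

lemma sum_y_double:
  assumes m: "2 ^ (p - 1) \<le> m" and i: "i < 2"
  shows "(\<Sum>c\<le>p. u c * y c (2 * m + i) x) = u 1 * X (2 * m + i) x + (\<Sum>c\<le>p. shift u c * y c m x)"
proof -
  obtain q where q: "p = Suc q" using p by (cases p) auto
  have d: "(2 * m + i) div 2 ^ Suc j = m div 2 ^ j" for j using i by (simp add: div_mult2_eq)
  have m2: "2 ^ (p - 1) \<le> 2 * m + i" using m by simp
  have "(\<Sum>c\<le>p. u c * y c (2 * m + i) x) = u 0 + (u 1 * X (2 * m + i) x + (\<Sum>c<q. u (Suc (Suc c)) * X (m div 2 ^ c) x))"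
  proof -
    have "(\<Sum>c\<le>p. h c) = h 0 + (h 1 + (\<Sum>c<q. h (Suc (Suc c))))" for h :: "nat \<Rightarrow> real"
      unfolding lessThan_Suc_atMost[symmetric] sum.lessThan_Suc_shift q by simp
    then show ?thesis using m2 d by (simp add: y_def)
  qed
  moreover have "(\<Sum>c\<le>p. shift u c * y c m x) = u 0 + (\<Sum>c<p. shift u (Suc c) * X (m div 2 ^ c) x)"
    unfolding lessThan_Suc_atMost[symmetric] sum.lessThan_Suc_shift y_def using m by (simp add: shift_def)
  moreover have "(\<Sum>c<p. shift u (Suc c) * X (m div 2 ^ c) x) = (\<Sum>c<q. u (Suc (Suc c)) * X (m div 2 ^ c) x)"
  proof -
    have "(\<Sum>c<p. h c) = (\<Sum>c<q. h c) + h q" for h :: "nat \<Rightarrow> real" unfolding q by simp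
    moreover have "shift u (Suc c) = u (Suc (Suc c))" if "c < q" for c
    proof -
      have "Suc c < p" using that q by simp
      then show ?thesis by (simp add: shift_def)
    qed
    moreover have "\<not> Suc q < p" using q by simp
    then have "shift u (Suc q) = 0" by (simp add: shift_def)
    ultimately show ?thesis by simp
  qed
  ultimately show ?thesis by simp
qed

text \<open>Positivity by descent along the coordinates. If \<open>u 1 \<noteq> 0\<close>, the
  innovation contributes \<open>(u 1)\<^sup>2 * v\<close> to the limiting form; if
  \<open>u 1 = 0\<close>, the form at \<open>u\<close> equals the form at \<open>shift u\<close>,
  whose first nonzero weight after the intercept stands one place earlier; if only the intercept is
  left, the form is \<open>(u 0)\<^sup>2\<close>.\<close>

lemma good_limit:
  assumes g: "good x"
  obtains L where "\<And>c d. c \<le> p \<Longrightarrow> d \<le> p \<Longrightarrow> mean_yy x c d \<longlonglongrightarrow> L c d"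
    and "\<And>u. (\<exists>c<Suc p. u c \<noteq> 0) \<Longrightarrow> 0 < (\<Sum>c<Suc p. \<Sum>d<Suc p. u c * L c d * u d)"
proof -
  have x: "x \<in> space M" and ye: "\<And>i c. i < 2 \<Longrightarrow> c \<le> p \<Longrightarrow> mean_ye x i c \<longlonglongrightarrow> 0"
    and ee: "\<And>i j. i < 2 \<Longrightarrow> j < 2 \<Longrightarrow> mean_ee x i j \<longlonglongrightarrow> \<Gamma> i j"
    using g unfolding good_def by blast+
  define L where "L c d = lim (mean_yy x c d)" for c d
  have L: "mean_yy x c d \<longlonglongrightarrow> L c d" if "c \<le> p" "d \<le> p" for c d
    using good_mean_yy_convergent[OF g that] by (simp add: L_def convergent_LIMSEQ_iff)
  define Q where "Q u l = (\<Sum>k\<in>gen_set l. (\<Sum>c\<le>p. u c * y c k x)\<^sup>2) / 2 ^ l" for u l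
  define qL where "qL u = (\<Sum>c\<le>p. \<Sum>d\<le>p. u c * L c d * u d)" for u
  have QL: "Q u \<longlonglongrightarrow> qL u" for u
  proof -
    have "Q u l = (\<Sum>c\<le>p. \<Sum>d\<le>p. u c * mean_yy x c d l * u d)" for l
    proof -
      have "(\<Sum>k\<in>gen_set l. (\<Sum>c\<le>p. u c * y c k x)\<^sup>2) = (\<Sum>k\<in>gen_set l. \<Sum>c\<le>p. \<Sum>d\<le>p. u c * (y c k x * y d k x) * u d)"
        unfolding power2_eq_square sum_product by (intro sum.cong refl) (simp add: algebra_simps)
      also have "\<dots> = (\<Sum>c\<le>p. \<Sum>k\<in>gen_set l. \<Sum>d\<le>p. u c * (y c k x * y d k x) * u d)" by (rule sum.swap)
      also have "\<dots> = (\<Sum>c\<le>p. \<Sum>d\<le>p. \<Sum>k\<in>gen_set l. u c * (y c k x * y d k x) * u d)"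
        by (intro sum.cong refl sum.swap)
      also have "\<dots> = (\<Sum>c\<le>p. \<Sum>d\<le>p. u c * (\<Sum>k\<in>gen_set l. y c k x * y d k x) * u d)"
        by (simp add: sum_distrib_left sum_distrib_right)
      finally show ?thesis by (simp add: Q_def mean_yy_def flip: sum_divide_distrib)
    qed
    then have "Q u = (\<lambda>l. \<Sum>c\<le>p. \<Sum>d\<le>p. u c * mean_yy x c d l * u d)" by (rule ext)
    then show ?thesis unfolding qL_def by (auto intro!: tendsto_intros L)
  qed
  have step: "Q u (Suc l) = (\<Sum>i<2. (\<Sum>k\<in>gen_set l. (u 1 * X (2 * k + i) x + (\<Sum>c\<le>p. shift u c * y c k x))\<^sup>2) / 2 ^ l / 2)"
    if l: "p - 1 \<le> l" for u l
  proof -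
    have "Q u (Suc l) = (\<Sum>k\<in>gen_set l. (\<Sum>i<2. (u 1 * X (2 * k + i) x + (\<Sum>c\<le>p. shift u c * y c k x))\<^sup>2)) / 2 ^ Suc l"
      unfolding Q_def sum_gen_set_Suc sum_2
      by (intro arg_cong[where f = "\<lambda>z. z / _"] sum.cong refl arg_cong2[where f = "(+)"])
         (use sum_y_double[OF gen_set_ge[OF _ l], of _ 0 u x] sum_y_double[OF gen_set_ge[OF _ l], of _ 1 u x] in auto)
    then show ?thesis by (simp add: sum_2 sum.distrib add_divide_distrib)
  qed
  have pos: "0 < qL u" if "1 \<le> j" "j \<le> p" "u j \<noteq> 0" "\<And>c. 1 \<le> c \<Longrightarrow> c < j \<Longrightarrow> u c = 0" for j u
    using that
  proof (induction j arbitrary: u rule: less_induct)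
    case (less j)
    show ?case
    proof (cases "j = 1")
      case True
      define w where "w i c = u 1 * par i c + shift u c" for i c
      \<comment> \<open>A lower bound that drops the square of the predictor and keeps its product
        with the innovation, which vanishes in the mean.\<close>
      define lo where "lo l = (\<Sum>i<2. ((u 1)\<^sup>2 * mean_ee x i i l + 2 * u 1 * (\<Sum>c\<le>p. w i c * mean_ye x i c l)) / 2)" for l
      have "lo l \<le> Q u (Suc l)" if l: "p - 1 \<le> l" for l
      proof -
        have "(u 1)\<^sup>2 * mean_ee x i i l + 2 * u 1 * (\<Sum>c\<le>p. w i c * mean_ye x i c l) \<le>
          (\<Sum>k\<in>gen_set l. (u 1 * X (2 * k + i) x + (\<Sum>c\<le>p. shift u c * y c k x))\<^sup>2) / 2 ^ l" if i: "i < 2" for i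
        proof -
          have "(\<Sum>c\<le>p. w i c * (\<Sum>k\<in>gen_set l. y c k x * e i k x)) = (\<Sum>k\<in>gen_set l. \<Sum>c\<le>p. w i c * (y c k x * e i k x))"
            unfolding sum_distrib_left by (rule sum.swap)
          also have "\<dots> = (\<Sum>k\<in>gen_set l. e i k x * (\<Sum>c\<le>p. w i c * y c k x))"
            unfolding sum_distrib_left by (intro sum.cong refl) (simp add: algebra_simps)
          finally have "(u 1)\<^sup>2 * (\<Sum>k\<in>gen_set l. e i k x * e i k x) + 2 * u 1 * (\<Sum>c\<le>p. w i c * (\<Sum>k\<in>gen_set l. y c k x * e i k x)) =
            (\<Sum>k\<in>gen_set l. (u 1)\<^sup>2 * (e i k x * e i k x) + 2 * u 1 * (e i k x * (\<Sum>c\<le>p. w i c * y c k x)))"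
            by (simp add: sum.distrib sum_distrib_left)
          also have "\<dots> \<le> (\<Sum>k\<in>gen_set l. (u 1 * X (2 * k + i) x + (\<Sum>c\<le>p. shift u c * y c k x))\<^sup>2)"
          proof (rule sum_mono)
            fix k assume k: "k \<in> gen_set l"
            have "u 1 * X (2 * k + i) x + (\<Sum>c\<le>p. shift u c * y c k x) = u 1 * e i k x + (\<Sum>c\<le>p. w i c * y c k x)"
              unfolding BAR[OF gen_set_ge[OF k l] i x] w_def
              by (simp add: algebra_simps sum.distrib sum_distrib_left)
            moreover have "s\<^sup>2 * (t * t) + 2 * s * (t * r) \<le> (s * t + r)\<^sup>2" for s t r :: real
              by (simp add: power2_eq_square algebra_simps)
            ultimately show "(u 1)\<^sup>2 * (e i k x * e i k x) + 2 * u 1 * (e i k x * (\<Sum>c\<le>p. w i c * y c k x)) \<le>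
              (u 1 * X (2 * k + i) x + (\<Sum>c\<le>p. shift u c * y c k x))\<^sup>2" by (simp only:)
          qed
          finally have "((u 1)\<^sup>2 * (\<Sum>k\<in>gen_set l. e i k x * e i k x) + 2 * u 1 * (\<Sum>c\<le>p. w i c * (\<Sum>k\<in>gen_set l. y c k x * e i k x))) / 2 ^ l \<le>
            (\<Sum>k\<in>gen_set l. (u 1 * X (2 * k + i) x + (\<Sum>c\<le>p. shift u c * y c k x))\<^sup>2) / 2 ^ l"
            by (rule divide_right_mono) simp
          then show ?thesis unfolding mean_ee_def mean_ye_def by (simp add: add_divide_distrib flip: sum_divide_distrib)
        qed
        then show ?thesis unfolding lo_def step[OF l] by (intro sum_mono divide_right_mono) auto
      qed
      then have "\<exists>N. \<forall>l\<ge>N. lo l \<le> Q u (Suc l)" by blast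
      moreover have "lo \<longlonglongrightarrow> (\<Sum>i<2. ((u 1)\<^sup>2 * \<Gamma> i i + 2 * u 1 * (\<Sum>c\<le>p. w i c * 0)) / 2)"
        unfolding lo_def by (intro tendsto_intros ye ee) auto
      moreover have "(\<lambda>l. Q u (Suc l)) \<longlonglongrightarrow> qL u" using QL by (rule LIMSEQ_Suc)
      ultimately have "(\<Sum>i<2. ((u 1)\<^sup>2 * \<Gamma> i i + 2 * u 1 * (\<Sum>c\<le>p. w i c * 0)) / 2) \<le> qL u"
        by (intro LIMSEQ_le) auto
      moreover have "(\<Sum>i<2. ((u 1)\<^sup>2 * \<Gamma> i i + 2 * u 1 * (\<Sum>c\<le>p. w i c * 0)) / 2) = (u 1)\<^sup>2 * v"
        by (simp add: sum_2 \<Gamma>_def)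
      moreover have "0 < (u 1)\<^sup>2 * v" using less.prems True v_pos by simp
      ultimately show ?thesis by simp
    next
      case False
      then have u1: "u 1 = 0" using less.prems by (intro less.prems(4)) auto
      have "Q u (Suc l) = Q (shift u) l" if "p - 1 \<le> l" for l
        unfolding step[OF that] u1 by (simp add: sum_2 Q_def)
      then have "\<forall>\<^sub>F l in sequentially. Q u (Suc l) = Q (shift u) l" unfolding eventually_sequentially by blast
      with LIMSEQ_Suc[OF QL[of u]] have "Q (shift u) \<longlonglongrightarrow> qL u" by (rule Lim_transform_eventually)
      then have "qL u = qL (shift u)" using QL LIMSEQ_unique by blast
      moreover have "0 < qL (shift u)"
        by (rule less.IH[of "j - 1"]) (use less.prems False in \<open>auto simp: shift_def\<close>)
      ultimately show ?thesis by simp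
    qed
  qed
  show thesis
  proof (rule that[of L])
    fix u :: "nat \<Rightarrow> real" assume u: "\<exists>c<Suc p. u c \<noteq> 0"
    have "0 < qL u"
    proof (cases "\<exists>j. 1 \<le> j \<and> j \<le> p \<and> u j \<noteq> 0")
      case True
      define j where "j = (LEAST j. 1 \<le> j \<and> j \<le> p \<and> u j \<noteq> 0)"
      have j: "1 \<le> j \<and> j \<le> p \<and> u j \<noteq> 0" unfolding j_def using True by (rule LeastI_ex)
      have "u c = 0" if "1 \<le> c" "c < j" for c
      proof -
        have "\<not> (1 \<le> c \<and> c \<le> p \<and> u c \<noteq> 0)" using that(2) unfolding j_def by (rule not_less_Least)
        then show ?thesis using that j by auto
      qed
      then show ?thesis using pos[of j u] j by blast
    next
      case False
      then have z: "u c = 0" if "c \<noteq> 0" "c \<le> p" for c using that by (auto simp: Suc_le_eq)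
      have "u 0 \<noteq> 0"
      proof
        assume "u 0 = 0"
        with z have "u c = 0" if "c \<le> p" for c using that by (cases "c = 0") auto
        then show False using u by auto
      qed
      have s: "(\<Sum>c\<le>p. f c) = f 0" if "\<And>c. c \<noteq> 0 \<Longrightarrow> c \<le> p \<Longrightarrow> f c = 0" for f :: "nat \<Rightarrow> real"
      proof -
        have "(\<Sum>c\<le>p. f c) = (\<Sum>c\<in>{0}. f c)" by (rule sum.mono_neutral_right) (use that in auto)
        then show ?thesis by simp
      qed
      have "Q u l = (u 0)\<^sup>2" if l: "p - 1 \<le> l" for l
      proof -
        have "(\<Sum>c\<le>p. u c * y c k x)\<^sup>2 = (u 0)\<^sup>2" if "k \<in> gen_set l" for k
          using s[of "\<lambda>c. u c * y c k x"] z gen_set_ge[OF that l] by (simp add: y_def)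
        then show ?thesis by (simp add: Q_def card_gen_set)
      qed
      then have "\<forall>\<^sub>F l in sequentially. Q u l = (u 0)\<^sup>2" unfolding eventually_sequentially by blast
      with QL[of u] have "(\<lambda>l. (u 0)\<^sup>2) \<longlonglongrightarrow> qL u" by (rule Lim_transform_eventually)
      then have "qL u = (u 0)\<^sup>2" using LIMSEQ_unique tendsto_const by blast
      then show ?thesis using \<open>u 0 \<noteq> 0\<close> by simp
    qed
    then show "0 < (\<Sum>c<Suc p. \<Sum>d<Suc p. u c * L c d * u d)" unfolding qL_def lessThan_Suc_atMost .
  qed (use L in auto)
qed

end

section \<open>Quadratic strong law\<close>

text \<open>Diagonal and two triangles. For martingale increments, the inner sum of a triangle runs
  over earlier indices and is predictable at the outer one, so that both triangles are martingale
  sums.\<close>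

lemma sum_times_sum_ordered:
  fixes s t :: "nat \<Rightarrow> real"
  shows "(\<Sum>k=m..<n. s k) * (\<Sum>k=m..<n. t k) = (\<Sum>k=m..<n. s k * t k) +
    (\<Sum>k=m..<n. s k * (\<Sum>j=m..<k. t j)) + (\<Sum>k=m..<n. t k * (\<Sum>j=m..<k. s j))"
proof (induction n)
  case (Suc n)
  then show ?case by (cases "m \<le> n") (simp_all add: algebra_simps)
qed simp

lemma sum_mult_le_mult_sum:
  fixes s t :: "'i \<Rightarrow> real"
  assumes "finite A" "\<And>k. k \<in> A \<Longrightarrow> 0 \<le> s k" "\<And>k. k \<in> A \<Longrightarrow> 0 \<le> t k"
  shows "(\<Sum>k\<in>A. s k * t k) \<le> (\<Sum>k\<in>A. s k) * (\<Sum>k\<in>A. t k)"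
  unfolding sum_distrib_right
  by (intro sum_mono mult_left_mono member_le_sum) (use assms in auto)

lemma summable_inverse_Suc_square: "summable (\<lambda>l. C / (real (Suc l))\<^sup>2)"
proof -
  have "summable (\<lambda>l. C * inverse ((real (Suc l))\<^sup>2))"
    using summable_Suc_iff[of "\<lambda>l. inverse ((real l)\<^sup>2)"] inverse_power_summable[of 2, where ?'a = real] by (intro summable_mult) simp
  then show ?thesis by (simp add: divide_inverse)
qed

context filtration
begin

text \<open>The coefficients are only square integrable, so they are truncated at \<open>n\<close>:
  conditioning applies to the truncated ones, with the deterministic bound \<open>w\<close> on the
  conditional variance, and Fatou's lemma removes the truncation.\<close>

lemma mds_mult_square_integrable:
  assumes \<xi>: "mds \<xi>" and w: "\<And>k. AE x in M. real_cond_exp M (H k) (\<lambda>x. (\<xi> k x)\<^sup>2) x \<le> w"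
    and c: "\<And>k. c k \<in> borel_measurable (H k)" "\<And>k. integrable M (\<lambda>x. (c k x)\<^sup>2)"
  shows "mds (\<lambda>k x. c k x * \<xi> k x)" and "(\<integral>x. (c k x * \<xi> k x)\<^sup>2 \<partial>M) \<le> w * (\<integral>x. (c k x)\<^sup>2 \<partial>M)"
proof -
  have bound: "integrable M (\<lambda>x. (c k x * \<xi> k x)\<^sup>2) \<and> (\<integral>x. (c k x * \<xi> k x)\<^sup>2 \<partial>M) \<le> w * (\<integral>x. (c k x)\<^sup>2 \<partial>M)" for k
  proof -
    note [measurable] = mdsD(2)[OF \<xi>, of k] H_M[OF c(1), of k] c(1)[of k]
    define t where "t n x = (if \<bar>c k x\<bar> \<le> real n then c k x else 0)" for n :: nat and x
    have tH [measurable]: "t n \<in> borel_measurable (H k)" for n unfolding t_def by measurable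
    have tM [measurable]: "t n \<in> borel_measurable M" for n by (rule H_M[OF tH])
    have tb: "\<bar>t n x\<bar> \<le> real n" for n x by (simp add: t_def)
    have tle: "(t n x)\<^sup>2 \<le> (c k x)\<^sup>2" for n x by (simp add: t_def)
    have ti: "integrable M (\<lambda>x. (t n x)\<^sup>2)" for n
      by (rule Bochner_Integration.integrable_bound[OF c(2)[of k]]) (use tle in auto)
    have w0: "AE x in M. 0 \<le> real_cond_exp M (H k) (\<lambda>x. (\<xi> k x)\<^sup>2) x"
      by (rule sigma_finite_subalgebra.real_cond_exp_pos[OF sigma_finite_sub]) auto
    have wpos: "0 \<le> w"
    proof -
      from w[of k] w0 have "AE x in M. 0 \<le> w" by eventually_elim linarith
      then show ?thesis by simp
    qed
    have tE: "(\<integral>x. (t n x * \<xi> k x)\<^sup>2 \<partial>M) \<le> w * (\<integral>x. (c k x)\<^sup>2 \<partial>M)" for n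
    proof -
      have "(\<integral>x. (t n x * \<xi> k x)\<^sup>2 \<partial>M) = (\<integral>x. (t n x)\<^sup>2 * real_cond_exp M (H k) (\<lambda>x. (\<xi> k x)\<^sup>2) x \<partial>M)"
        by (rule mds_weighted_square(1)[OF \<xi> tH tb])
      also have "\<dots> \<le> (\<integral>x. w * (c k x)\<^sup>2 \<partial>M)"
      proof (rule integral_mono_AE)
        show "AE x in M. (t n x)\<^sup>2 * real_cond_exp M (H k) (\<lambda>x. (\<xi> k x)\<^sup>2) x \<le> w * (c k x)\<^sup>2"
          using w[of k] w0
        proof eventually_elim
          case (elim x)
          have "(t n x)\<^sup>2 * real_cond_exp M (H k) (\<lambda>x. (\<xi> k x)\<^sup>2) x \<le> (c k x)\<^sup>2 * w"
            using elim tle by (intro mult_mono) auto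
          then show ?case by (simp add: mult.commute)
        qed
      qed (use mds_weighted_square(2)[OF \<xi> tH tb] c(2) in auto)
      finally show ?thesis by simp
    qed
    have tint: "integrable M (\<lambda>x. (t n x * \<xi> k x)\<^sup>2)" for n
    proof (rule Bochner_Integration.integrable_bound)
      show "integrable M (\<lambda>x. (real n)\<^sup>2 * (\<xi> k x)\<^sup>2)" using mdsD(3)[OF \<xi>] by simp
      have "(t n x * \<xi> k x)\<^sup>2 \<le> (real n)\<^sup>2 * (\<xi> k x)\<^sup>2" for x
        unfolding power_mult_distrib using tb[of n x] abs_le_square_iff[of "t n x" "real n"] by (intro mult_right_mono) auto
      then show "AE x in M. norm ((t n x * \<xi> k x)\<^sup>2) \<le> norm ((real n)\<^sup>2 * (\<xi> k x)\<^sup>2)" by auto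
    qed simp
    have lim: "(\<lambda>n. (t n x * \<xi> k x)\<^sup>2) \<longlonglongrightarrow> (c k x * \<xi> k x)\<^sup>2" for x
    proof (rule tendsto_eventually)
      obtain N :: nat where "\<bar>c k x\<bar> \<le> real N" using real_arch_simple by blast
      then have "t n x = c k x" if "N \<le> n" for n using that by (auto simp: t_def)
      then show "\<forall>\<^sub>F n in sequentially. (t n x * \<xi> k x)\<^sup>2 = (c k x * \<xi> k x)\<^sup>2"
        unfolding eventually_sequentially by (intro exI[of _ N]) simp
    qed
    have "(\<integral>\<^sup>+x. ennreal ((c k x * \<xi> k x)\<^sup>2) \<partial>M) = (\<integral>\<^sup>+x. liminf (\<lambda>n. ennreal ((t n x * \<xi> k x)\<^sup>2)) \<partial>M)"
      by (intro nn_integral_cong lim_imp_Liminf[symmetric] tendsto_ennrealI lim) simp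
    also have "\<dots> \<le> liminf (\<lambda>n. \<integral>\<^sup>+x. ennreal ((t n x * \<xi> k x)\<^sup>2) \<partial>M)" by (rule nn_integral_liminf) simp
    also have "\<dots> \<le> liminf (\<lambda>n::nat. ennreal (w * (\<integral>x. (c k x)\<^sup>2 \<partial>M)))"
      by (intro Liminf_mono always_eventually allI)
         (subst nn_integral_eq_integral[OF tint], auto intro!: ennreal_leI tE)
    also have "\<dots> = ennreal (w * (\<integral>x. (c k x)\<^sup>2 \<partial>M))" by (intro lim_imp_Liminf tendsto_const) simp
    finally have le: "(\<integral>\<^sup>+x. ennreal ((c k x * \<xi> k x)\<^sup>2) \<partial>M) \<le> ennreal (w * (\<integral>x. (c k x)\<^sup>2 \<partial>M))" .
    have int: "integrable M (\<lambda>x. (c k x * \<xi> k x)\<^sup>2)"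
      by (rule integrableI_nonneg) (use le in \<open>auto intro: le_less_trans\<close>)
    have "ennreal (\<integral>x. (c k x * \<xi> k x)\<^sup>2 \<partial>M) \<le> ennreal (w * (\<integral>x. (c k x)\<^sup>2 \<partial>M))"
      using le by (subst (asm) nn_integral_eq_integral[OF int]) auto
    moreover have "0 \<le> w * (\<integral>x. (c k x)\<^sup>2 \<partial>M)" using wpos by simp
    ultimately show ?thesis using int by (simp add: ennreal_le_iff)
  qed
  show "(\<integral>x. (c k x * \<xi> k x)\<^sup>2 \<partial>M) \<le> w * (\<integral>x. (c k x)\<^sup>2 \<partial>M)" using bound by blast
  show "mds (\<lambda>k x. c k x * \<xi> k x)"
    unfolding mds_def
  proof (intro allI conjI)
    fix k
    note [measurable] = mdsD(1,2)[OF \<xi>, of k] H_mono[OF c(1), of k "Suc k"] H_M[OF c(1), of k]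
    show "(\<lambda>x. c k x * \<xi> k x) \<in> borel_measurable (H (Suc k))" by simp
    show i2: "integrable M (\<lambda>x. (c k x * \<xi> k x)\<^sup>2)" using bound by blast
    have "integrable M (\<lambda>x. c k x * \<xi> k x)" by (rule integrable_of_square) (use i2 in auto)
    from sigma_finite_subalgebra.real_cond_exp_mult[OF sigma_finite_sub c(1) _ this]
    have "AE x in M. real_cond_exp M (H k) (\<lambda>x. c k x * \<xi> k x) x = c k x * real_cond_exp M (H k) (\<xi> k) x"
      by simp
    then show "AE x in M. real_cond_exp M (H k) (\<lambda>x. c k x * \<xi> k x) x = 0"
      using mdsD(4)[OF \<xi>, of k] by eventually_elim simp
  qed
qed

end

context bar_process
begin

lemma e_cond_var_le: "i < 2 \<Longrightarrow> AE x in M. real_cond_exp M (H k) (\<lambda>x. (e i k x)\<^sup>2) x \<le> v"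
proof -
  assume i: "i < 2"
  from e_cov[OF i i, of k] show ?thesis
    by eventually_elim (use v_pos in \<open>auto simp: power2_eq_square \<Gamma>_def\<close>)
qed

section \<open>Martingale increments over a generation and the means of their products\<close>

definition D :: "nat \<Rightarrow> nat \<Rightarrow> nat \<Rightarrow> 'a \<Rightarrow> real" where
  "D i c l x = (\<Sum>k\<in>gen_set l. y c k x * e i k x)"

definition S :: "nat \<Rightarrow> nat \<Rightarrow> nat \<Rightarrow> 'a \<Rightarrow> real" where
  "S i c l x = (\<Sum>m<l. D i c m x)"

lemma S_eq: "S i c l x = (\<Sum>k=1..<2 ^ l. y c k x * e i k x)"
  unfolding S_def D_def by (rule sum_gen_set)

text \<open>Orthogonality of fewer than \<open>2 ^ l\<close> terms, each of second moment at most
  \<open>v * K\<close>.\<close>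

lemma S_square_le:
  assumes i: "i < 2" and c: "c \<le> p" and K: "\<And>k. (\<integral>x. (y c k x)\<^sup>2 \<partial>M) \<le> K"
  shows "integrable M (\<lambda>x. (S i c l x)\<^sup>2)" "(\<integral>x. (S i c l x)\<^sup>2 \<partial>M) \<le> v * K * 2 ^ l"
proof -
  note m = mds_mult_square_integrable[OF mds_e[OF i] e_cond_var_le[OF i] y_measurable[OF c] y_L2[OF c]]
  show "integrable M (\<lambda>x. (S i c l x)\<^sup>2)" unfolding S_eq by (rule mds_sum_square(1)[OF m(1)])
  have "0 \<le> K" using K[of 0] by (rule order_trans[rotated]) simp
  have "(\<integral>x. (S i c l x)\<^sup>2 \<partial>M) = (\<Sum>k=1..<2 ^ l. \<integral>x. (y c k x * e i k x)\<^sup>2 \<partial>M)"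
    unfolding S_eq by (rule mds_sum_square(2)[OF m(1)])
  also have "\<dots> \<le> (\<Sum>k\<in>{1..<2 ^ l :: nat}. v * K)"
    by (intro sum_mono order_trans[OF m(2)] mult_left_mono K) (use v_pos in auto)
  also have "\<dots> \<le> v * K * 2 ^ l" using v_pos \<open>0 \<le> K\<close> by (simp add: mult_left_mono mult.commute of_nat_diff)
  finally show "(\<integral>x. (S i c l x)\<^sup>2 \<partial>M) \<le> v * K * 2 ^ l" .
qed

text \<open>The martingale series with coefficients \<open>c / (2 ^ l * Suc l)\<close> converges
  almost surely, and Kronecker's lemma over the generations turns the factor
  \<open>1 / Suc l\<close> into a vanishing mean.\<close>

lemma cesaro_of_gen_summable:
  assumes c: "\<And>k. c k \<in> borel_measurable (H k)"
    and \<eta>: "mds \<eta>" "AE x in M. \<exists>K. \<forall>k. real_cond_exp M (H k) (\<lambda>x. (\<eta> k x)\<^sup>2) x \<le> K"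
    and s: "AE x in M. summable (\<lambda>l. (\<Sum>k\<in>gen_set l. (c k x)\<^sup>2) / (2 ^ l * real (Suc l))\<^sup>2)"
  shows "AE x in M. (\<lambda>n. (\<Sum>l<n. (\<Sum>k\<in>gen_set l. c k x * \<eta> k x) / 2 ^ l) / real n) \<longlonglongrightarrow> 0"
proof -
  define w where "w k x = c k x / (2 ^ generation k * real (Suc (generation k)))" for k x
  have wg: "w k x = c k x / (2 ^ l * real (Suc l))" if "k \<in> gen_set l" for k l x
    using generation_eq[OF that] by (simp add: w_def)
  have "(\<Sum>k\<in>gen_set l. (w k x)\<^sup>2) = (\<Sum>k\<in>gen_set l. (c k x)\<^sup>2) / (2 ^ l * real (Suc l))\<^sup>2" for l x
    unfolding sum_divide_distrib by (intro sum.cong refl) (simp add: wg power_divide)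
  then have "AE x in M. summable (\<lambda>l. \<Sum>k\<in>gen_set l. (w k x)\<^sup>2)" using s by simp
  then have "AE x in M. summable (\<lambda>l. \<Sum>k\<in>gen_set l. w k x * \<eta> k x)"
    by (intro mds_gen_summable[OF \<eta>]) (use c in \<open>simp add: w_def\<close>)
  then show ?thesis
  proof eventually_elim
    case (elim x)
    have "(\<Sum>k\<in>gen_set l. w k x * \<eta> k x) = (\<Sum>k\<in>gen_set l. c k x * \<eta> k x) / 2 ^ l / real (Suc l)" for l
      unfolding sum_divide_distrib by (intro sum.cong refl) (simp add: wg)
    with elim show ?case by (intro kronecker_cesaro) simp
  qed
qed

lemma good_mean_yy_bounded:
  assumes "good x" "c \<le> p"
  obtains B where "0 \<le> B" "\<And>l. mean_yy x c c l \<le> B"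
proof -
  have "Bseq (mean_yy x c c)" by (intro convergent_imp_Bseq good_mean_yy_convergent assms)
  then obtain B where B: "0 < B" "\<And>l. \<bar>mean_yy x c c l\<bar> \<le> B" unfolding Bseq_def by auto
  then have "mean_yy x c c l \<le> B" for l by (meson abs_ge_self order_trans)
  then show thesis using B(1) that[of B] by simp
qed

lemma mean_yy_nonneg: "0 \<le> mean_yy x c c l"
  unfolding mean_yy_def by (intro divide_nonneg_pos sum_nonneg) auto

lemma sum_y_square: "(\<Sum>k\<in>gen_set l. (y c k x)\<^sup>2) = 2 ^ l * mean_yy x c c l"
  by (simp add: mean_yy_def power2_eq_square)

text \<open>The sum of fourth order is at most the product of two sums of squares, each of order
  \<open>2 ^ l\<close> on good paths. After division by \<open>(2 ^ l * Suc l)\<^sup>2\<close> a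
  summable \<open>1 / (Suc l)\<^sup>2\<close> remains, and no fourth moment of \<open>y\<close>
  occurs.\<close>

lemma cesaro_diagonal:
  assumes i: "i < 2" and j: "j < 2" and c: "c \<le> p" and d: "d \<le> p"
  shows "AE x in M. (\<lambda>n. (\<Sum>l<n. (\<Sum>k\<in>gen_set l. (y c k x * y d k x) * ecov i j k x) / 2 ^ l) / real n) \<longlonglongrightarrow> 0"
proof (rule cesaro_of_gen_summable[OF _ mds_ecov[OF i j] ecov_var_bounded[OF i j]])
  show "(\<lambda>x. y c k x * y d k x) \<in> borel_measurable (H k)" for k
    using y_measurable[OF c] y_measurable[OF d] by simp
  show "AE x in M. summable (\<lambda>l. (\<Sum>k\<in>gen_set l. (y c k x * y d k x)\<^sup>2) / (2 ^ l * real (Suc l))\<^sup>2)"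
    using AE_good
  proof eventually_elim
    case (elim x)
    obtain B where B: "0 \<le> B" "\<And>l. mean_yy x c c l \<le> B" using good_mean_yy_bounded[OF elim c] by blast
    obtain B' where B': "0 \<le> B'" "\<And>l. mean_yy x d d l \<le> B'" using good_mean_yy_bounded[OF elim d] by blast
    show ?case
    proof (rule summable_comparison_test'[OF summable_inverse_Suc_square[of "B * B'"], of 0])
      fix l :: nat
      have "(\<Sum>k\<in>gen_set l. (y c k x * y d k x)\<^sup>2) \<le> (\<Sum>k\<in>gen_set l. (y c k x)\<^sup>2) * (\<Sum>k\<in>gen_set l. (y d k x)\<^sup>2)"
        unfolding power_mult_distrib by (rule sum_mult_le_mult_sum) auto
      also have "\<dots> = (2 ^ l)\<^sup>2 * (mean_yy x c c l * mean_yy x d d l)" unfolding sum_y_square by (simp add: power2_eq_square)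
      also have "\<dots> \<le> (2 ^ l)\<^sup>2 * (B * B')" by (intro mult_left_mono mult_mono B B' mean_yy_nonneg) auto
      finally have "(\<Sum>k\<in>gen_set l. (y c k x * y d k x)\<^sup>2) / (2 ^ l * real (Suc l))\<^sup>2 \<le> (2 ^ l)\<^sup>2 * (B * B') / (2 ^ l * real (Suc l))\<^sup>2"
        by (rule divide_right_mono) simp
      also have "\<dots> = B * B' / (real (Suc l))\<^sup>2" by (simp add: power_mult_distrib)
      finally show "norm ((\<Sum>k\<in>gen_set l. (y c k x * y d k x)\<^sup>2) / (2 ^ l * real (Suc l))\<^sup>2) \<le> B * B' / (real (Suc l))\<^sup>2"
        by (simp add: sum_nonneg)
    qed
  qed
qed

text \<open>\<open>S\<close> before generation \<open>l\<close> is a predictable coefficient for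
  \<open>D\<close> at \<open>l\<close>. Its second moment is of order \<open>2 ^ l\<close>, as is
  the sum of squares of \<open>y\<close> over the generation, so the normalised squared coefficients
  are of order \<open>1 / (Suc l)\<^sup>2\<close>.\<close>

lemma cesaro_S_D:
  assumes i: "i < 2" and j: "j < 2" and c: "c \<le> p" and d: "d \<le> p"
  shows "AE x in M. (\<lambda>n. (\<Sum>l<n. S i c l x * D j d l x / 2 ^ l) / real n) \<longlonglongrightarrow> 0"
proof -
  obtain K where K: "0 \<le> K" "\<And>k. (\<integral>x. (y c k x)\<^sup>2 \<partial>M) \<le> K" using y_second_moment_bounded c by blast
  define w where "w k x = S i c (generation k) x * y d k x" for k x
  have wg: "w k x = S i c l x * y d k x" if "k \<in> gen_set l" for k l x
    using generation_eq[OF that] by (simp add: w_def)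
  have wH: "w k \<in> borel_measurable (H k)" for k
  proof (cases "k = 0")
    case True
    then have "w k = (\<lambda>x. 0)" by (auto simp: w_def y_def)
    then show ?thesis by simp
  next
    case False
    then have k: "2 ^ generation k \<le> k" using gen_set_generation[of k] by (simp add: gen_set_eq)
    have "(\<lambda>x. y c m x * e i m x) \<in> borel_measurable (H k)" if "m \<in> {1..<2 ^ generation k}" for m
      using H_mono[OF y_measurable[OF c], of m k] H_mono[OF e_measurable[OF i], of m k] k that by simp
    then have "S i c (generation k) \<in> borel_measurable (H k)" unfolding S_eq[abs_def] by (rule borel_measurable_sum)
    then show ?thesis using y_measurable[OF d] by (simp add: w_def[abs_def])
  qed
  have "AE x in M. summable (\<lambda>l. (S i c l x)\<^sup>2 / (2 ^ l * (real (Suc l))\<^sup>2))"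
  proof (rule AE_summable_of_expectation)
    show "integrable M (\<lambda>x. (S i c l x)\<^sup>2 / (2 ^ l * (real (Suc l))\<^sup>2))" for l
      using S_square_le(1)[OF i c K(2)] by simp
    show "(\<integral>x. (S i c l x)\<^sup>2 / (2 ^ l * (real (Suc l))\<^sup>2) \<partial>M) \<le> v * K / (real (Suc l))\<^sup>2" for l
      using divide_right_mono[OF S_square_le(2)[OF i c K(2), of l], of "2 ^ l * (real (Suc l))\<^sup>2"]
      by (simp add: divide_simps split: if_splits)
    show "summable (\<lambda>l. v * K / (real (Suc l))\<^sup>2)" by (rule summable_inverse_Suc_square)
  qed simp
  with AE_good have "AE x in M. summable (\<lambda>l. (\<Sum>k\<in>gen_set l. (w k x)\<^sup>2) / (2 ^ l * real (Suc l))\<^sup>2)"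
  proof eventually_elim
    case (elim x)
    obtain B where B: "0 \<le> B" "\<And>l. mean_yy x d d l \<le> B" using good_mean_yy_bounded[OF elim(1) d] by blast
    show ?case
    proof (rule summable_comparison_test'[OF summable_mult[OF elim(2), of B], of 0])
      fix l :: nat
      have "(\<Sum>k\<in>gen_set l. (w k x)\<^sup>2) = (S i c l x)\<^sup>2 * (2 ^ l * mean_yy x d d l)"
        unfolding sum_y_square[symmetric] sum_distrib_left
        by (intro sum.cong refl) (simp add: wg power_mult_distrib)
      then have "(\<Sum>k\<in>gen_set l. (w k x)\<^sup>2) / (2 ^ l * real (Suc l))\<^sup>2 = mean_yy x d d l * ((S i c l x)\<^sup>2 / (2 ^ l * (real (Suc l))\<^sup>2))"
        by (simp add: power2_eq_square ac_simps)
      also have "\<dots> \<le> B * ((S i c l x)\<^sup>2 / (2 ^ l * (real (Suc l))\<^sup>2))" by (intro mult_right_mono B) simp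
      finally show "norm ((\<Sum>k\<in>gen_set l. (w k x)\<^sup>2) / (2 ^ l * real (Suc l))\<^sup>2) \<le> B * ((S i c l x)\<^sup>2 / (2 ^ l * (real (Suc l))\<^sup>2))"
        by (simp add: sum_nonneg)
    qed
  qed
  from cesaro_of_gen_summable[OF wH mds_e[OF j] e_var_bounded[OF j] this] show ?thesis
  proof eventually_elim
    case (elim x)
    have "(\<Sum>k\<in>gen_set l. w k x * e j k x) = S i c l x * D j d l x" for l
      unfolding D_def sum_distrib_left by (intro sum.cong refl) (simp add: wg)
    then show ?case using elim by simp
  qed
qed

text \<open>The inner sum of a triangle in the product of two increments: it runs over earlier
  mothers of the same generation, hence is predictable at \<open>k\<close>.\<close>

definition part :: "nat \<Rightarrow> nat \<Rightarrow> nat \<Rightarrow> 'a \<Rightarrow> real" where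
  "part j d k x = (\<Sum>m=2 ^ generation k..<k. y d m x * e j m x)"

text \<open>The moments of \<open>y\<close> of order four need not be bounded, so that the second moments of the
  partial sums are estimated on the event that the means of squares in their generation are at most \<open>K\<close>.\<close>

lemma part_second_moment:
  assumes j: "j < 2" and c: "c \<le> p" and d: "d \<le> p" and K: "0 \<le> K"
  defines "G \<equiv> \<lambda>l. {x \<in> space M. mean_yy x c c l \<le> K \<and> mean_yy x d d l \<le> K}"
  shows "integrable M (\<lambda>x. indicator (G l) x * (\<Sum>k\<in>gen_set l. (y c k x * part j d k x)\<^sup>2))"
    and "(\<integral>x. indicator (G l) x * (\<Sum>k\<in>gen_set l. (y c k x * part j d k x)\<^sup>2) \<partial>M) \<le> v * K\<^sup>2 * (2 ^ l)\<^sup>2"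
proof -
  \<comment> \<open>The event is decided at the start of the generation, whose states are all known
    at \<open>H (2 ^ l)\<close>; its indicator may therefore multiply predictable
    coefficients.\<close>
  have GH: "G l \<in> sets (H (2 ^ l))"
  proof -
    have [measurable]: "y c k \<in> borel_measurable (H (2 ^ l))" "y d k \<in> borel_measurable (H (2 ^ l))" if "k \<in> gen_set l" for k
      using that by (auto intro!: y_measurable_gen c d simp: gen_set_eq)
    show ?thesis unfolding G_def mean_yy_def space_H[of "2 ^ l", symmetric] by measurable
  qed
  have GM [measurable]: "G l \<in> sets M" using GH sub[of "2 ^ l"] by (auto simp: subalgebra_def)
  have sq: "(y c k x)\<^sup>2 \<le> K * 2 ^ l" "(y d k x)\<^sup>2 \<le> K * 2 ^ l" if "x \<in> G l" "k \<in> gen_set l" for x k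
  proof -
    have *: "(y b k x)\<^sup>2 \<le> K * 2 ^ l" if "mean_yy x b b l \<le> K" for b
    proof -
      have "(y b k x)\<^sup>2 \<le> (\<Sum>k\<in>gen_set l. (y b k x)\<^sup>2)" using \<open>k \<in> gen_set l\<close> by (intro member_le_sum) auto
      also have "\<dots> \<le> K * 2 ^ l" unfolding sum_y_square using that by simp
      finally show ?thesis .
    qed
    show "(y c k x)\<^sup>2 \<le> K * 2 ^ l" "(y d k x)\<^sup>2 \<le> K * 2 ^ l" using that by (auto simp: G_def intro!: *)
  qed
  \<comment> \<open>For fixed \<open>k\<close> the inner sum is a martingale in \<open>m\<close>.
    The factor \<open>y c k\<close> is a legitimate coefficient although \<open>m < k\<close>,
    because \<open>k < 2 * m\<close> within one generation, so that it is known at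
    \<open>H m\<close>.\<close>
  define z where "z k m x = (if m \<in> {2 ^ l..<k} then indicator (G l) x * (y c k x * y d m x) else 0)" for k m x
  \<comment> \<open>On \<open>G l\<close> every squared entry in the generation is part of a sum
    bounded by \<open>B\<close>. This bounds \<open>z\<close> by \<open>B\<close> and, over all
    pairs, the sum of its squares by \<open>B\<^sup>2\<close>.\<close>
  define B where "B = K * 2 ^ l"
  have B0: "0 \<le> B" using K by (simp add: B_def)
  have zH: "z k m \<in> borel_measurable (H m)" if k: "k \<in> gen_set l" for k m
  proof (cases "m \<in> {2 ^ l..<k}")
    case True
    have "G l \<in> sets (H m)" using GH mono[of "2 ^ l" m] True by (auto simp: subalgebra_def)
    moreover have "y c k \<in> borel_measurable (H m)" using k True by (intro y_measurable_gen c) (auto simp: gen_set_eq)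
    ultimately show ?thesis using True y_measurable[OF d, of m] unfolding z_def[abs_def] by simp
  next
    case False
    then have "z k m = (\<lambda>x. 0)" by (auto simp: z_def)
    then show ?thesis by simp
  qed
  have zb: "\<bar>z k m x\<bar> \<le> B" if k: "k \<in> gen_set l" for k m x
  proof (cases "m \<in> {2 ^ l..<k} \<and> x \<in> G l")
    case True
    then have m: "m \<in> gen_set l" using k by (auto simp: gen_set_eq)
    have "(z k m x)\<^sup>2 = (y c k x)\<^sup>2 * (y d m x)\<^sup>2" using True by (simp add: z_def power_mult_distrib)
    also have "\<dots> \<le> B * B" unfolding B_def using sq True m k K by (intro mult_mono) auto
    finally have "(z k m x)\<^sup>2 \<le> B\<^sup>2" by (simp add: power2_eq_square)
    then show ?thesis using B0 abs_le_square_iff[of "z k m x" B] by simp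
  qed (auto simp: z_def B0)
  note m = mds_mult[OF mds_e[OF j] zH, where C = "\<lambda>_. B", OF _ zb]
  have eq: "indicator (G l) x * (y c k x * part j d k x)\<^sup>2 = (\<Sum>m=2 ^ l..<k. z k m x * e j m x)\<^sup>2" if k: "k \<in> gen_set l" for k x
  proof -
    have "(\<Sum>m=2 ^ l..<k. z k m x * e j m x) = indicator (G l) x * (y c k x * part j d k x)"
      unfolding part_def generation_eq[OF k] sum_distrib_left by (intro sum.cong refl) (auto simp: z_def)
    then show ?thesis by (simp add: indicator_def)
  qed
  have eqs: "indicator (G l) x * (\<Sum>k\<in>gen_set l. (y c k x * part j d k x)\<^sup>2) = (\<Sum>k\<in>gen_set l. (\<Sum>m=2 ^ l..<k. z k m x * e j m x)\<^sup>2)" for x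
    unfolding sum_distrib_left by (intro sum.cong refl eq)
  have isq: "integrable M (\<lambda>x. (\<Sum>m=2 ^ l..<k. z k m x * e j m x)\<^sup>2)" if "k \<in> gen_set l" for k
    by (rule mds_sum_square(1)[OF m]) (use that in auto)
  show "integrable M (\<lambda>x. indicator (G l) x * (\<Sum>k\<in>gen_set l. (y c k x * part j d k x)\<^sup>2))"
    unfolding eqs by (intro Bochner_Integration.integrable_sum isq)
  have zi: "integrable M (\<lambda>x. (z k m x)\<^sup>2)" if k: "k \<in> gen_set l" for k m
  proof (rule integrable_const_bound[where B = "B\<^sup>2"])
    show "AE x in M. norm ((z k m x)\<^sup>2) \<le> B\<^sup>2" using zb[OF k, of m] B0 abs_le_square_iff[of _ B] by (auto simp: abs_of_nonneg)
    show "(\<lambda>x. (z k m x)\<^sup>2) \<in> borel_measurable M" using H_M[OF zH[OF k]] by simp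
  qed
  have e1: "(\<integral>x. (z k m x * e j m x)\<^sup>2 \<partial>M) \<le> v * (\<integral>x. (z k m x)\<^sup>2 \<partial>M)" if k: "k \<in> gen_set l" for k m
    by (rule mds_mult_square_integrable(2)[OF mds_e[OF j] e_cond_var_le[OF j] zH[OF k] zi[OF k]])
  have "(\<integral>x. indicator (G l) x * (\<Sum>k\<in>gen_set l. (y c k x * part j d k x)\<^sup>2) \<partial>M) =
    (\<Sum>k\<in>gen_set l. \<Sum>m=2 ^ l..<k. \<integral>x. (z k m x * e j m x)\<^sup>2 \<partial>M)"
    unfolding eqs using isq mds_sum_square(2)[OF m] by (subst Bochner_Integration.integral_sum) (auto intro!: sum.cong)
  also have "\<dots> \<le> (\<Sum>k\<in>gen_set l. \<Sum>m=2 ^ l..<k. v * (\<integral>x. (z k m x)\<^sup>2 \<partial>M))"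
    by (intro sum_mono e1)
  also have "\<dots> = v * (\<integral>x. (\<Sum>k\<in>gen_set l. \<Sum>m=2 ^ l..<k. (z k m x)\<^sup>2) \<partial>M)"
    using zi by (simp add: Bochner_Integration.integral_sum sum_distrib_left)
  also have "\<dots> \<le> v * (\<integral>x. B\<^sup>2 \<partial>M)"
  proof (intro mult_left_mono integral_mono)
    fix x
    show "(\<Sum>k\<in>gen_set l. \<Sum>m=2 ^ l..<k. (z k m x)\<^sup>2) \<le> B\<^sup>2"
    proof (cases "x \<in> G l")
      case True
      have "(\<Sum>k\<in>gen_set l. \<Sum>m=2 ^ l..<k. (z k m x)\<^sup>2) \<le> (\<Sum>k\<in>gen_set l. \<Sum>m\<in>gen_set l. (y c k x)\<^sup>2 * (y d m x)\<^sup>2)"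
      proof (rule sum_mono)
        fix k assume k: "k \<in> gen_set l"
        have "(\<Sum>m=2 ^ l..<k. (z k m x)\<^sup>2) = (\<Sum>m=2 ^ l..<k. (y c k x)\<^sup>2 * (y d m x)\<^sup>2)"
          using True by (intro sum.cong refl) (auto simp: z_def power_mult_distrib)
        also have "\<dots> \<le> (\<Sum>m\<in>gen_set l. (y c k x)\<^sup>2 * (y d m x)\<^sup>2)"
          using k by (intro sum_mono2) (auto simp: gen_set_eq)
        finally show "(\<Sum>m=2 ^ l..<k. (z k m x)\<^sup>2) \<le> (\<Sum>m\<in>gen_set l. (y c k x)\<^sup>2 * (y d m x)\<^sup>2)" .
      qed
      also have "\<dots> = (2 ^ l * mean_yy x c c l) * (2 ^ l * mean_yy x d d l)"
        unfolding sum_y_square[symmetric] sum_product ..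
      also have "\<dots> \<le> (2 ^ l * K) * (2 ^ l * K)"
        using True K by (intro mult_mono) (auto simp: G_def mean_yy_nonneg)
      finally show ?thesis by (simp add: B_def power2_eq_square mult.commute mult.left_commute)
    qed (auto simp: z_def)
  qed (use zi v_pos in auto)
  also have "\<dots> = v * K\<^sup>2 * (2 ^ l)\<^sup>2" by (simp add: prob_space B_def power_mult_distrib)
  finally show "(\<integral>x. indicator (G l) x * (\<Sum>k\<in>gen_set l. (y c k x * part j d k x)\<^sup>2) \<partial>M) \<le> v * K\<^sup>2 * (2 ^ l)\<^sup>2" .
qed

text \<open>For each integer \<open>K\<close> the localized series has finite expectation. A good
  path has bounded empirical second moments, hence lies in \<open>G K l\<close> for all
  \<open>l\<close> once \<open>K\<close> is large.\<close>

lemma cesaro_off_diagonal: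
  assumes i: "i < 2" and j: "j < 2" and c: "c \<le> p" and d: "d \<le> p"
  shows "AE x in M. (\<lambda>n. (\<Sum>l<n. (\<Sum>k\<in>gen_set l. (y c k x * part j d k x) * e i k x) / 2 ^ l) / real n) \<longlonglongrightarrow> 0"
proof (rule cesaro_of_gen_summable[OF _ mds_e[OF i] e_var_bounded[OF i]])
  show "(\<lambda>x. y c k x * part j d k x) \<in> borel_measurable (H k)" for k
  proof -
    have "(\<lambda>x. y d m x * e j m x) \<in> borel_measurable (H k)" if "m \<in> {2 ^ generation k..<k}" for m
      using H_mono[OF y_measurable[OF d], of m k] H_mono[OF e_measurable[OF j], of m k] that by simp
    then have "part j d k \<in> borel_measurable (H k)" unfolding part_def[abs_def] by (rule borel_measurable_sum)
    then show ?thesis using y_measurable[OF c] by simp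
  qed
  define G where "G K l = {x \<in> space M. mean_yy x c c l \<le> K \<and> mean_yy x d d l \<le> K}" for K l
  have "AE x in M. summable (\<lambda>l. indicator (G (real K) l) x * (\<Sum>k\<in>gen_set l. (y c k x * part j d k x)\<^sup>2) / (2 ^ l * real (Suc l))\<^sup>2)" for K :: nat
  proof (rule AE_summable_of_expectation)
    have K: "0 \<le> real K" by simp
    note P = part_second_moment[OF j c d K, folded G_def]
    show "integrable M (\<lambda>x. indicator (G (real K) l) x * (\<Sum>k\<in>gen_set l. (y c k x * part j d k x)\<^sup>2) / (2 ^ l * real (Suc l))\<^sup>2)" for l
      using P(1) by (rule integrable_divide_zero)
    show "(\<integral>x. indicator (G (real K) l) x * (\<Sum>k\<in>gen_set l. (y c k x * part j d k x)\<^sup>2) / (2 ^ l * real (Suc l))\<^sup>2 \<partial>M) \<le> v * (real K)\<^sup>2 / (real (Suc l))\<^sup>2" for l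
      using divide_right_mono[OF P(2)[of l], of "(2 ^ l * real (Suc l))\<^sup>2"] by (simp add: power_mult_distrib)
    show "summable (\<lambda>l. v * (real K)\<^sup>2 / (real (Suc l))\<^sup>2)" by (rule summable_inverse_Suc_square)
  qed (intro divide_nonneg_nonneg mult_nonneg_nonneg sum_nonneg; simp)
  then have "AE x in M. \<forall>K::nat. summable (\<lambda>l. indicator (G (real K) l) x * (\<Sum>k\<in>gen_set l. (y c k x * part j d k x)\<^sup>2) / (2 ^ l * real (Suc l))\<^sup>2)"
    unfolding AE_all_countable by blast
  with AE_good show "AE x in M. summable (\<lambda>l. (\<Sum>k\<in>gen_set l. (y c k x * part j d k x)\<^sup>2) / (2 ^ l * real (Suc l))\<^sup>2)"
  proof eventually_elim
    case (elim x)
    obtain B where B: "\<And>l. mean_yy x c c l \<le> B" using good_mean_yy_bounded[OF elim(1) c] by blast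
    obtain B' where B': "\<And>l. mean_yy x d d l \<le> B'" using good_mean_yy_bounded[OF elim(1) d] by blast
    obtain K :: nat where K: "max B B' \<le> real K" using real_arch_simple by blast
    have "mean_yy x c c l \<le> real K" "mean_yy x d d l \<le> real K" for l using B[of l] B'[of l] K by linarith+
    then have "x \<in> G (real K) l" for l using elim(1) by (auto simp: G_def good_def)
    then have "indicator (G (real K) l) x = (1 :: real)" for l by simp
    moreover have "summable (\<lambda>l. indicator (G (real K) l) x * (\<Sum>k\<in>gen_set l. (y c k x * part j d k x)\<^sup>2) / (2 ^ l * real (Suc l))\<^sup>2)"
      using elim(2) by blast
    ultimately show ?case by simp
  qed
qed

text \<open>Of the product, the diagonal centred by \<open>\<Gamma> i j\<close> and the two
  triangles vanish in the mean; what is left is \<open>\<Gamma> i j * mean_yy\<close>, convergent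
  even before averaging.\<close>

lemma cesaro_D_D:
  assumes i: "i < 2" and j: "j < 2" and c: "c \<le> p" and d: "d \<le> p"
  shows "AE x in M. (\<lambda>n. (\<Sum>l<n. D i c l x * D j d l x / 2 ^ l) / real n) \<longlonglongrightarrow> \<Gamma> i j * lim (mean_yy x c d)"
  using cesaro_diagonal[OF i j c d] cesaro_off_diagonal[OF i j c d] cesaro_off_diagonal[OF j i d c] AE_good
proof eventually_elim
  case (elim x)
  have "mean_yy x c d \<longlonglongrightarrow> lim (mean_yy x c d)"
    using good_mean_yy_convergent[OF elim(4) c d] by (simp add: convergent_LIMSEQ_iff)
  from tendsto_mult_left[OF cesaro_mean[OF this], of "\<Gamma> i j"]
  have 1: "(\<lambda>n. \<Gamma> i j * ((\<Sum>l<n. mean_yy x c d l) / real n)) \<longlonglongrightarrow> \<Gamma> i j * lim (mean_yy x c d)" .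
  have "D i c l x * D j d l x / 2 ^ l = \<Gamma> i j * mean_yy x c d l +
      (\<Sum>k\<in>gen_set l. (y c k x * y d k x) * ecov i j k x) / 2 ^ l +
      (\<Sum>k\<in>gen_set l. (y c k x * part j d k x) * e i k x) / 2 ^ l +
      (\<Sum>k\<in>gen_set l. (y d k x * part i c k x) * e j k x) / 2 ^ l" for l
  proof -
    have "D i c l x * D j d l x = (\<Sum>k\<in>gen_set l. (y c k x * e i k x) * (y d k x * e j k x)) +
      (\<Sum>k\<in>gen_set l. (y c k x * e i k x) * (\<Sum>m=2 ^ l..<k. y d m x * e j m x)) +
      (\<Sum>k\<in>gen_set l. (y d k x * e j k x) * (\<Sum>m=2 ^ l..<k. y c m x * e i m x))"
      unfolding D_def gen_set_eq by (rule sum_times_sum_ordered)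
    also have "(\<Sum>k\<in>gen_set l. (y c k x * e i k x) * (\<Sum>m=2 ^ l..<k. y d m x * e j m x)) = (\<Sum>k\<in>gen_set l. (y c k x * part j d k x) * e i k x)"
      by (intro sum.cong refl) (simp add: part_def generation_eq)
    also have "(\<Sum>k\<in>gen_set l. (y d k x * e j k x) * (\<Sum>m=2 ^ l..<k. y c m x * e i m x)) = (\<Sum>k\<in>gen_set l. (y d k x * part i c k x) * e j k x)"
      by (intro sum.cong refl) (simp add: part_def generation_eq)
    also have "(\<Sum>k\<in>gen_set l. (y c k x * e i k x) * (y d k x * e j k x)) =
      (\<Sum>k\<in>gen_set l. \<Gamma> i j * (y c k x * y d k x) + (y c k x * y d k x) * ecov i j k x)"
      by (intro sum.cong refl) (auto simp: ecov_def y_def algebra_simps)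
    also have "\<dots> = \<Gamma> i j * (2 ^ l * mean_yy x c d l) + (\<Sum>k\<in>gen_set l. (y c k x * y d k x) * ecov i j k x)"
      by (simp add: sum.distrib sum_distrib_left[symmetric] mean_yy_def)
    finally show ?thesis by (simp add: add_divide_distrib)
  qed
  then have "(\<lambda>n. (\<Sum>l<n. D i c l x * D j d l x / 2 ^ l) / real n) = (\<lambda>n. \<Gamma> i j * ((\<Sum>l<n. mean_yy x c d l) / real n) +
      (\<Sum>l<n. (\<Sum>k\<in>gen_set l. (y c k x * y d k x) * ecov i j k x) / 2 ^ l) / real n +
      (\<Sum>l<n. (\<Sum>k\<in>gen_set l. (y c k x * part j d k x) * e i k x) / 2 ^ l) / real n +
      (\<Sum>l<n. (\<Sum>k\<in>gen_set l. (y d k x * part i c k x) * e j k x) / 2 ^ l) / real n)"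
    by (simp add: sum.distrib add_divide_distrib sum_distrib_left[symmetric])
  then show ?case using tendsto_add[OF tendsto_add[OF tendsto_add[OF 1 elim(1)] elim(2)] elim(3)] by simp
qed

end

section \<open>Residuals\<close>

lemma sum_tree_from:
  assumes "1 \<le> n"
  shows "(\<Sum>k\<in>tree_from (n - 1) q. f k) = (\<Sum>l=q..<n. \<Sum>k\<in>gen_set l. f k)"
proof -
  have "(\<Sum>l=q..<n. \<Sum>k\<in>gen_set l. f k) = (\<Sum>k\<in>{2 ^ q..<2 ^ n}. f k)"
  proof (induction n)
    case 0
    have "1 \<le> (2::nat) ^ q" by simp
    then have "{2 ^ q..<2 ^ 0 :: nat} = {}" by simp
    then show ?case by simp
  next
    case (Suc n)
    show ?case
    proof (cases "q \<le> n")
      case True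
      then have "(2::nat) ^ q \<le> 2 ^ n" by (intro power_increasing) auto
      moreover have "(2::nat) ^ n \<le> 2 ^ Suc n" by simp
      ultimately have "(\<Sum>k=2 ^ q..<2 ^ n. f k) + (\<Sum>k=2 ^ n..<2 ^ Suc n. f k) = (\<Sum>k=2 ^ q..<2 ^ Suc n. f k)"
        by (rule sum.atLeastLessThan_concat)
      then show ?thesis using Suc True by (simp add: gen_set_eq[of n])
    next
      case False
      then have "(2::nat) ^ Suc n \<le> 2 ^ q" by (intro power_increasing) auto
      then show ?thesis using False by simp
    qed
  qed
  then show ?thesis using assms by (simp add: tree_from_eq)
qed

lemma card_tree: "card (tree n) = 2 ^ Suc n - 1"
  by (simp add: tree_eq)

lemma sum_from_mean_tendsto:
  fixes f :: "nat \<Rightarrow> real"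
  assumes "cmean f \<longlonglongrightarrow> c"
  shows "(\<lambda>n. (C + (\<Sum>l=q..<n. f l)) / real n) \<longlonglongrightarrow> c"
proof -
  have "(\<lambda>n. cmean f n + (C - (\<Sum>l<q. f l)) / real n) \<longlonglongrightarrow> c + 0"
    by (intro tendsto_add assms lim_const_over_n)
  moreover have "\<forall>\<^sub>F n in sequentially. cmean f n + (C - (\<Sum>l<q. f l)) / real n = (C + (\<Sum>l=q..<n. f l)) / real n"
    using eventually_ge_at_top[of q]
  proof eventually_elim
    case (elim n)
    have "(\<Sum>l<n. f l) = (\<Sum>l<q. f l) + (\<Sum>l=q..<n. f l)"
      using sum.atLeastLessThan_concat[of 0 q n f] elim by (simp add: atLeast0LessThan)
    then show ?case by (simp add: cmean_def add_divide_distrib diff_divide_distrib)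
  qed
  ultimately show ?thesis using Lim_transform_eventually by fastforce
qed

lemma power2_minus_1_at_top: "filterlim (\<lambda>n. (2::real) ^ n - 1) at_top sequentially"
  by real_asymp

text \<open>\<open>2 ^ n - 1\<close> is the size of \<open>tree (n - 1)\<close> for
  \<open>n \<ge> 1\<close>; neither its difference from \<open>2 ^ n\<close> nor the first
  \<open>q\<close> generations matter in the limit.\<close>

lemma sum_from_dyadic_tendsto:
  fixes f :: "nat \<Rightarrow> real"
  assumes "f \<longlonglongrightarrow> c"
  shows "(\<lambda>n. (\<Sum>l=q..<n. 2 ^ l * f l) / (2 ^ n - 1)) \<longlonglongrightarrow> c"
proof -
  have inv: "(\<lambda>n. K / ((2::real) ^ n - 1)) \<longlonglongrightarrow> 0" for K
    by (rule tendsto_divide_0[OF tendsto_const filterlim_at_top_imp_at_infinity[OF power2_minus_1_at_top]])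
  have "(\<lambda>n. (\<Sum>m<n. 2 ^ m * f m) / 2 ^ n * (1 + 1 / (2 ^ n - 1)) + (- (\<Sum>l<q. 2 ^ l * f l)) / (2 ^ n - 1)) \<longlonglongrightarrow> c * (1 + 0) + 0"
    by (rule tendsto_add[OF tendsto_mult[OF dyadic_mean_tendsto[OF assms] tendsto_add[OF tendsto_const inv]] inv])
  moreover have "\<forall>\<^sub>F n in sequentially. (\<Sum>m<n. 2 ^ m * f m) / 2 ^ n * (1 + 1 / (2 ^ n - 1)) + (- (\<Sum>l<q. 2 ^ l * f l)) / (2 ^ n - 1)
      = (\<Sum>l=q..<n. 2 ^ l * f l) / (2 ^ n - 1)"
    using eventually_ge_at_top[of "max 1 q"]
  proof eventually_elim
    case (elim n)
    have "(2::real) ^ 1 \<le> 2 ^ n" using elim by (intro power_increasing) auto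
    then have n: "(2::real) ^ n - 1 \<noteq> 0" "(2::real) ^ n \<noteq> 0" by auto
    have "(\<Sum>m<n. 2 ^ m * f m) = (\<Sum>m<q. 2 ^ m * f m) + (\<Sum>l=q..<n. 2 ^ l * f l)"
      using sum.atLeastLessThan_concat[of 0 q n "\<lambda>l. 2 ^ l * f l"] elim by (simp add: atLeast0LessThan)
    moreover have "(\<Sum>m<n. 2 ^ m * f m) / 2 ^ n * (1 + 1 / (2 ^ n - 1)) = (\<Sum>m<n. 2 ^ m * f m) / (2 ^ n - 1)"
    proof -
      have "1 + 1 / (2 ^ n - 1) = (2::real) ^ n / (2 ^ n - 1)" using n by (simp add: field_simps)
      then show ?thesis using n by simp
    qed
    ultimately show ?case by (simp add: add_divide_distrib diff_divide_distrib)
  qed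
  ultimately show ?thesis using Lim_transform_eventually by fastforce
qed

lemma card_tree_ratio: "(\<lambda>n. real (card (tree n)) / real (card (tree (n - 1)))) \<longlonglongrightarrow> 2"
proof -
  have inv: "(\<lambda>n. 1 / ((2::real) ^ n - 1)) \<longlonglongrightarrow> 0"
    by (rule tendsto_divide_0[OF tendsto_const filterlim_at_top_imp_at_infinity[OF power2_minus_1_at_top]])
  have "(\<lambda>n. 2 + 1 / ((2::real) ^ n - 1)) \<longlonglongrightarrow> 2 + 0" by (rule tendsto_add[OF tendsto_const inv])
  moreover have "\<forall>\<^sub>F n in sequentially. 2 + 1 / ((2::real) ^ n - 1) = real (card (tree n)) / real (card (tree (n - 1)))"
    using eventually_ge_at_top[of 1]
  proof eventually_elim
    case (elim n)
    have "(2::real) ^ 1 \<le> 2 ^ n" using elim by (intro power_increasing) auto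
    then have n: "(2::real) ^ n - 1 \<noteq> 0" by auto
    have c1: "real (card (tree (n - 1))) = 2 ^ n - 1" using elim by (simp add: card_tree of_nat_diff)
    have c2: "real (card (tree n)) = 2 * 2 ^ n - 1" by (simp add: card_tree of_nat_diff)
    show ?case unfolding c1 c2 using n by (simp add: field_simps)
  qed
  ultimately show ?thesis using Lim_transform_eventually by fastforce
qed

lemma over_card_tree_tendsto: "(\<lambda>n. real n / real (card (tree n))) \<longlonglongrightarrow> 0"
proof -
  have lim: "(\<lambda>n. of_nat n * (1 / 2 :: real) ^ n) \<longlonglongrightarrow> 0" by (rule powser_times_n_limit_0) simp
  have upper: "real n / real (card (tree n)) \<le> of_nat n * (1 / 2 :: real) ^ n" for n
  proof -
    have "(1::real) \<le> 2 ^ n" by simp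
    then have "(2::real) ^ n \<le> 2 * 2 ^ n - 1" by linarith
    then have le: "(2::real) ^ n \<le> real (card (tree n))" by (simp add: card_tree of_nat_diff)
    have pos: "(0::real) < 2 ^ n" by simp
    have "real n / real (card (tree n)) \<le> real n / 2 ^ n"
      by (rule divide_left_mono[OF le _ mult_pos_pos[OF less_le_trans[OF pos le] pos]]) simp
    then show ?thesis by (simp add: power_one_over)
  qed
  show ?thesis
    by (rule tendsto_sandwich[where f = "\<lambda>_. 0" and h = "\<lambda>n. of_nat n * (1 / 2 :: real) ^ n"])
       (use upper lim in \<open>auto intro!: always_eventually\<close>)
qed

context bar_process
begin

section \<open>Estimation error, residuals and the final limits\<close>

definition err :: "real mat \<Rightarrow> 'a \<Rightarrow> nat \<Rightarrow> nat \<Rightarrow> nat \<Rightarrow> real" where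
  "err init x i c l = theta_hat p init X l x $$ (c, i) - par i c"

lemma YY_index: "2 ^ (p - 1) \<le> k \<Longrightarrow> c \<le> p \<Longrightarrow> YY p X k x $ c = y c k x"
  by (cases c) (auto simp: YY_def XX_def y_def)

lemma ZZ_index: "i < 2 \<Longrightarrow> ZZ X k x $ i = X (2 * k + i) x"
  by (auto simp: ZZ_def less_2_cases_iff vec_of_list_index)

text \<open>The summands below generation \<open>p - 1\<close> vanish with \<open>y\<close>, so the
  sums of the estimator may be taken over all generations before \<open>l\<close>, as in the
  martingale \<open>S\<close>.\<close>

lemma sum_y_tree:
  assumes "p \<le> l"
  shows "(\<Sum>k\<in>tree_from (l - 1) (p - 1). y c k x * g k) = (\<Sum>m<l. \<Sum>k\<in>gen_set m. y c k x * g k)"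
proof -
  have "1 \<le> l" using assms p by simp
  then have "(\<Sum>k\<in>tree_from (l - 1) (p - 1). y c k x * g k) = (\<Sum>m=p-1..<l. \<Sum>k\<in>gen_set m. y c k x * g k)"
    by (rule sum_tree_from)
  also have "\<dots> = (\<Sum>m<l. \<Sum>k\<in>gen_set m. y c k x * g k)"
  proof (rule sum.mono_neutral_left)
    show "\<forall>m\<in>{..<l} - {p - 1..<l}. (\<Sum>k\<in>gen_set m. y c k x * g k) = 0"
    proof (intro ballI sum.neutral)
      fix m k assume m: "m \<in> {..<l} - {p - 1..<l}" and k: "k \<in> gen_set m"
      have "(2::nat) ^ Suc m \<le> 2 ^ (p - 1)" using m by (intro power_increasing) auto
      then have "k < 2 ^ (p - 1)" using k by (simp add: gen_set_eq)
      then show "y c k x * g k = 0" by (simp add: y_def)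
    qed
  qed auto
  finally show ?thesis .
qed

text \<open>Inserting the autoregression into the right side of the normal equations gives the Gram
  matrix times the true parameters, plus \<open>S\<close>. Hence the Gram matrix maps the estimation
  error to \<open>S\<close>, as soon as injectivity ensures that \<open>S_mat\<close> is the Gram
  matrix itself.\<close>

lemma normal_equations:
  assumes x: "x \<in> space M" and l: "p \<le> l"
    and inj: "\<And>u. (\<And>a. a < Suc p \<Longrightarrow> (\<Sum>b<Suc p. (\<Sum>m<l. 2 ^ m * mean_yy x a b m) * u b) = 0) \<Longrightarrow> (\<And>a. a < Suc p \<Longrightarrow> u a = 0)"
    and i: "i < 2" and c: "c < Suc p"
  shows "(\<Sum>b<Suc p. (\<Sum>m<l. 2 ^ m * mean_yy x c b m) * err init x i b l) = S i c l x"
proof -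
  let ?T = "tree_from (l - 1) (p - 1)"
  define A where "A = sum_outer (p + 1) (p + 1) ?T (\<lambda>k. YY p X k x) (\<lambda>k. YY p X k x)"
  define R where "R = sum_outer (p + 1) 2 ?T (\<lambda>k. YY p X k x) (\<lambda>k. ZZ X k x)"
  have T: "2 ^ (p - 1) \<le> k" if "k \<in> ?T" for k using that by (simp add: tree_from_def)
  have A: "A \<in> carrier_mat (p + 1) (p + 1)" and R: "R \<in> carrier_mat (p + 1) 2" by (simp_all add: A_def R_def sum_outer_def)
  have Aab: "A $$ (a, b) = (\<Sum>m<l. 2 ^ m * mean_yy x a b m)" if "a < Suc p" "b < Suc p" for a b
  proof -
    have "A $$ (a, b) = (\<Sum>k\<in>?T. y a k x * y b k x)"
      using that T by (auto simp: A_def sum_outer_def YY_index intro!: sum.cong)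
    then show ?thesis unfolding sum_y_tree[OF l] by (simp add: mean_yy_def)
  qed
  have Rai: "R $$ (a, i) = (\<Sum>b<Suc p. (\<Sum>m<l. 2 ^ m * mean_yy x a b m) * par i b) + S i a l x" if "a < Suc p" for a
  proof -
    have "R $$ (a, i) = (\<Sum>k\<in>?T. y a k x * X (2 * k + i) x)"
      using that i T by (auto simp: R_def sum_outer_def YY_index ZZ_index intro!: sum.cong)
    also have "\<dots> = (\<Sum>k\<in>?T. (\<Sum>b<Suc p. par i b * (y a k x * y b k x)) + y a k x * e i k x)"
      using BAR[OF T i x] by (intro sum.cong refl) (simp add: distrib_left sum_distrib_left lessThan_Suc_atMost algebra_simps)
    also have "\<dots> = (\<Sum>b<Suc p. par i b * (\<Sum>k\<in>?T. y a k x * y b k x)) + (\<Sum>k\<in>?T. y a k x * e i k x)"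
      by (simp only: sum.distrib sum.swap[of _ "{..<Suc p}"] sum_distrib_left)
    also have "\<dots> = (\<Sum>b<Suc p. (\<Sum>m<l. 2 ^ m * mean_yy x a b m) * par i b) + S i a l x"
      unfolding sum_y_tree[OF l] by (simp add: mean_yy_def S_def D_def mult.commute)
    finally show ?thesis .
  qed
  have mulA: "(A *\<^sub>v w) $ a = (\<Sum>b<Suc p. (\<Sum>m<l. 2 ^ m * mean_yy x a b m) * w $ b)" if "w \<in> carrier_vec (p + 1)" "a < Suc p" for w a
    using that A Aab by (auto simp: scalar_prod_def atLeast0LessThan intro!: sum.cong)
  obtain B where B: "mat_inverse A = Some B" "B \<in> carrier_mat (p + 1) (p + 1)" "A * B = 1\<^sub>m (p + 1)" "invertible_mat A"
  proof (rule mat_inverse_of_injective[OF A])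
    fix w assume w: "w \<in> carrier_vec (p + 1)" "A *\<^sub>v w = 0\<^sub>v (p + 1)"
    have "w $ a = 0" if "a < Suc p" for a
    proof (rule inj[of "\<lambda>a. w $ a"])
      fix a assume a: "a < Suc p"
      show "(\<Sum>b<Suc p. (\<Sum>m<l. 2 ^ m * mean_yy x a b m) * w $ b) = 0"
        unfolding mulA[OF w(1) a, symmetric] w(2) using a by simp
    qed (rule that)
    then show "w = 0\<^sub>v (p + 1)" using w(1) by (intro eq_vecI) auto
  qed blast
  have "S_mat p X (l - 1) x = A" using B(4) by (simp add: S_mat_def A_def Let_def)
  then have th: "theta_hat p init X l x = B * R" using l B(1) by (simp add: theta_hat_def R_def)
  have "A * (B * R) = R" using A B(2,3) R by (simp add: assoc_mult_mat[symmetric])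
  then have "R $$ (c, i) = (\<Sum>b<Suc p. A $$ (c, b) * (B * R) $$ (b, i))"
  proof -
    have "(A * (B * R)) $$ (c, i) = (\<Sum>b<Suc p. A $$ (c, b) * (B * R) $$ (b, i))"
      using A B(2) R c i by (simp add: scalar_prod_def atLeast0LessThan)
    with \<open>A * (B * R) = R\<close> show ?thesis by simp
  qed
  also have "\<dots> = (\<Sum>b<Suc p. (\<Sum>m<l. 2 ^ m * mean_yy x c b m) * theta_hat p init X l x $$ (b, i))"
    unfolding th using Aab[OF c] by simp
  finally show ?thesis
    unfolding Rai[OF c] err_def by (simp add: right_diff_distrib sum_subtractf)
qed

lemma eps_hat_eq:
  assumes k: "k \<in> gen_set l" and l: "p - 1 \<le> l" and i: "i < 2" and x: "x \<in> space M"
  shows "eps_hat p init X (2 * k + i) x = e i k x - (\<Sum>c<Suc p. err init x i c l * y c k x)"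
proof -
  have kp: "2 ^ (p - 1) \<le> k" by (rule gen_set_ge[OF k l])
  let ?t = "theta_hat p init X l x"
  have ki: "(2 * k + i) div 2 = k" "(2 * k + i) mod 2 = i" using i by auto
  have "eps_hat p init X (2 * k + i) x = X (2 * k + i) x - ?t $$ (0, i) - (\<Sum>c=1..p. ?t $$ (c, i) * X (k div 2 ^ (c - 1)) x)"
    unfolding eps_hat_def Let_def ki generation_eq[OF k] ..
  also have "?t $$ (0, i) + (\<Sum>c=1..p. ?t $$ (c, i) * X (k div 2 ^ (c - 1)) x) = (\<Sum>c\<le>p. ?t $$ (c, i) * y c k x)"
  proof -
    have "{..p} = insert 0 {1..p}" by auto
    then show ?thesis using kp by (auto simp: y_def intro!: sum.cong)
  qed
  then have "X (2 * k + i) x - ?t $$ (0, i) - (\<Sum>c=1..p. ?t $$ (c, i) * X (k div 2 ^ (c - 1)) x) = X (2 * k + i) x - (\<Sum>c\<le>p. ?t $$ (c, i) * y c k x)"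
    by simp
  finally show ?thesis
    unfolding BAR[OF kp i x] err_def lessThan_Suc_atMost by (simp add: left_diff_distrib sum_subtractf)
qed

text \<open>The part of a product of residuals that is quadratic in the prediction error;
  \<open>V\<close> below is the part mixed with an innovation. The estimate depends on the
  generation only and is constant over these sums.\<close>

definition W :: "real mat \<Rightarrow> 'a \<Rightarrow> nat \<Rightarrow> nat \<Rightarrow> nat \<Rightarrow> real" where
  "W init x i j l = (\<Sum>k\<in>gen_set l. (\<Sum>c<Suc p. err init x i c l * y c k x) * (\<Sum>d<Suc p. err init x j d l * y d k x))"

definition V :: "real mat \<Rightarrow> 'a \<Rightarrow> nat \<Rightarrow> nat \<Rightarrow> nat \<Rightarrow> real" where
  "V init x i j l = (\<Sum>k\<in>gen_set l. (\<Sum>c<Suc p. err init x i c l * y c k x) * e j k x)"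

text \<open>The index combinations are finite in number, so one null set serves for all of them; off
  it the least squares argument is deterministic, with \<open>d = Suc p\<close> entries and
  \<open>r = 2\<close> columns.\<close>

lemma AE_W_V:
  "AE x in M. good x \<and> (\<forall>i<2. \<forall>j<2. cmean (W init x i j) \<longlonglongrightarrow> (real p + 1) * \<Gamma> i j \<and> cmean (V init x i j) \<longlonglongrightarrow> 0)"
proof -
  have "AE x in M. \<forall>i\<in>{..<2}. \<forall>j\<in>{..<2}. \<forall>c\<in>{..p}. \<forall>d\<in>{..p}.
      (\<lambda>n. (\<Sum>l<n. D i c l x * D j d l x / 2 ^ l) / real n) \<longlonglongrightarrow> \<Gamma> i j * lim (mean_yy x c d)"
    by (intro AE_finite_allI finite_lessThan finite_atMost cesaro_D_D) auto
  moreover have "AE x in M. \<forall>i\<in>{..<2}. \<forall>j\<in>{..<2}. \<forall>c\<in>{..p}. \<forall>d\<in>{..p}.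
      (\<lambda>n. (\<Sum>l<n. S i c l x * D j d l x / 2 ^ l) / real n) \<longlonglongrightarrow> 0"
    by (intro AE_finite_allI finite_lessThan finite_atMost cesaro_S_D) auto
  ultimately show ?thesis using AE_good
  proof eventually_elim
    case (elim x)
    obtain L where L: "\<And>c d. c \<le> p \<Longrightarrow> d \<le> p \<Longrightarrow> mean_yy x c d \<longlonglongrightarrow> L c d"
      and pos: "\<And>u. (\<exists>c<Suc p. u c \<noteq> 0) \<Longrightarrow> 0 < (\<Sum>c<Suc p. \<Sum>d<Suc p. u c * L c d * u d)"
      by (rule good_limit[OF elim(3)]) blast
    obtain G where G: "\<And>a c. a < Suc p \<Longrightarrow> c < Suc p \<Longrightarrow> (\<Sum>b<Suc p. G a b * L b c) = (if a = c then 1 else 0)"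
      by (rule positive_definite_left_inverse[OF pos]) blast+
    have L': "mean_yy x a b \<longlonglongrightarrow> L a b" if "a < Suc p" "b < Suc p" for a b using L that by simp
    have x: "x \<in> space M" using elim(3) by (simp add: good_def)
    have inj: "\<forall>\<^sub>F l in sequentially. \<forall>u. (\<forall>a<Suc p. (\<Sum>b<Suc p. (\<Sum>m<l. 2 ^ m * mean_yy x a b m) * u b) = 0) \<longrightarrow> (\<forall>a<Suc p. u a = 0)"
      by (rule eventually_injective[where L = L and G = G]) (fact L', fact G)
    have ne: "\<forall>\<^sub>F l in sequentially. \<forall>i<2. \<forall>a<Suc p. (\<Sum>b<Suc p. (\<Sum>m<l. 2 ^ m * mean_yy x a b m) * err init x i b l) = S i a l x"
      using inj eventually_ge_at_top[of p]
    proof eventually_elim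
      case (elim l)
      show ?case
      proof (intro allI impI)
        fix i a :: nat assume "i < 2" "a < Suc p"
        then show "(\<Sum>b<Suc p. (\<Sum>m<l. 2 ^ m * mean_yy x a b m) * err init x i b l) = S i a l x"
          by (intro normal_equations[OF x elim(2)]) (use elim(1) in blast)+
      qed
    qed
    have DD: "cmean (\<lambda>l. D i a l x * D j b l x / 2 ^ l) \<longlonglongrightarrow> \<Gamma> i j * L a b" if "i < 2" "j < 2" "a < Suc p" "b < Suc p" for i j a b
    proof -
      have "lim (mean_yy x a b) = L a b" by (rule limI[OF L'[OF that(3,4)]])
      moreover have "(\<lambda>n. (\<Sum>l<n. D i a l x * D j b l x / 2 ^ l) / real n) \<longlonglongrightarrow> \<Gamma> i j * lim (mean_yy x a b)"
        using elim(1) that by simp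
      ultimately show ?thesis by (simp add: cmean_def[abs_def])
    qed
    have SD: "cmean (\<lambda>l. S i a l x * D j b l x / 2 ^ l) \<longlonglongrightarrow> 0" if "i < 2" "j < 2" "a < Suc p" "b < Suc p" for i j a b
      using elim(2) that by (simp add: cmean_def[abs_def])
    have SS: "S i a (Suc l) x = S i a l x + D i a l x" for i a l by (simp add: S_def)
    have ls: "cmean (\<lambda>l. \<Sum>a<Suc p. \<Sum>b<Suc p. err init x i a l * err init x j b l * (2 ^ l * mean_yy x a b l)) \<longlonglongrightarrow> real (Suc p) * \<Gamma> i j"
      "cmean (\<lambda>l. \<Sum>a<Suc p. err init x i a l * D j a l x) \<longlonglongrightarrow> 0" if ij: "i < 2" "j < 2" for i j
      by (rule least_squares_cesaro[where \<Phi> = "mean_yy x" and L = L and G = G and \<Gamma> = \<Gamma> and r = 2 and d = "Suc p" and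
        S = "\<lambda>i a l. S i a l x" and D = "\<lambda>i a l. D i a l x" and \<Delta> = "err init x"]; fact L' G SS DD SD ne ij)+
    have "cmean (W init x i j) \<longlonglongrightarrow> (real p + 1) * \<Gamma> i j \<and> cmean (V init x i j) \<longlonglongrightarrow> 0" if "i < 2" "j < 2" for i j
    proof
      have "W init x i j l = (\<Sum>a<Suc p. \<Sum>b<Suc p. err init x i a l * err init x j b l * (2 ^ l * mean_yy x a b l))" for l
      proof -
        have "W init x i j l = (\<Sum>k\<in>gen_set l. \<Sum>a<Suc p. \<Sum>b<Suc p. (err init x i a l * err init x j b l) * (y a k x * y b k x))"
          unfolding W_def sum_product by (intro sum.cong refl) (simp add: algebra_simps)
        also have "\<dots> = (\<Sum>a<Suc p. \<Sum>k\<in>gen_set l. \<Sum>b<Suc p. (err init x i a l * err init x j b l) * (y a k x * y b k x))"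
          by (rule sum.swap)
        also have "\<dots> = (\<Sum>a<Suc p. \<Sum>b<Suc p. \<Sum>k\<in>gen_set l. (err init x i a l * err init x j b l) * (y a k x * y b k x))"
          by (intro sum.cong refl sum.swap)
        finally show ?thesis by (simp only: sum_distrib_left[symmetric]) (simp add: mean_yy_def)
      qed
      then have "W init x i j = (\<lambda>l. \<Sum>a<Suc p. \<Sum>b<Suc p. err init x i a l * err init x j b l * (2 ^ l * mean_yy x a b l))" by (rule ext)
      then show "cmean (W init x i j) \<longlonglongrightarrow> (real p + 1) * \<Gamma> i j" using ls(1)[OF that] by (simp add: add.commute)
      have "V init x i j l = (\<Sum>a<Suc p. err init x i a l * D j a l x)" for l
      proof -
        have "V init x i j l = (\<Sum>k\<in>gen_set l. \<Sum>a<Suc p. err init x i a l * (y a k x * e j k x))"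
          unfolding V_def sum_distrib_right by (intro sum.cong refl) (simp add: algebra_simps)
        also have "\<dots> = (\<Sum>a<Suc p. \<Sum>k\<in>gen_set l. err init x i a l * (y a k x * e j k x))" by (rule sum.swap)
        finally show ?thesis by (simp only: sum_distrib_left[symmetric] D_def)
      qed
      then have "V init x i j = (\<lambda>l. \<Sum>a<Suc p. err init x i a l * D j a l x)" by (rule ext)
      then show "cmean (V init x i j) \<longlonglongrightarrow> 0" using ls(2)[OF that] by simp
    qed
    then show ?case using elim(3) by blast
  qed
qed

lemma residual_products:
  assumes WV: "good x \<and> (\<forall>i<2. \<forall>j<2. cmean (W init x i j) \<longlonglongrightarrow> (real p + 1) * \<Gamma> i j \<and> cmean (V init x i j) \<longlonglongrightarrow> 0)"
    and i: "i < 2" and j: "j < 2"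
  defines "h \<equiv> \<lambda>i k. eps_hat p init X (2 * k + i) x" and "f \<equiv> \<lambda>i k. eps (2 * k + i) x"
  shows "(\<lambda>n. (\<Sum>k\<in>tree_from (n - 1) p. (h i k - f i k) * (h j k - f j k)) / real n) \<longlonglongrightarrow> (real p + 1) * \<Gamma> i j"
    and "(\<lambda>n. ((\<Sum>k\<in>tree_from (n - 1) (p - 1). h i k * h j k) - (\<Sum>k\<in>tree_from (n - 1) p. f i k * f j k)) / real n) \<longlonglongrightarrow> (real p + 1) * \<Gamma> i j"
    and "(\<lambda>n. (\<Sum>k\<in>tree_from (n - 1) p. f i k * f j k) / real (card (tree (n - 1)))) \<longlonglongrightarrow> \<Gamma> i j"
proof -
  have x: "x \<in> space M" and ee: "mean_ee x i j \<longlonglongrightarrow> \<Gamma> i j" using WV i j by (auto simp: good_def)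
  have W: "cmean (W init x i j) \<longlonglongrightarrow> (real p + 1) * \<Gamma> i j" using WV i j by blast
  have V: "cmean (V init x i j) \<longlonglongrightarrow> 0" "cmean (V init x j i) \<longlonglongrightarrow> 0" using WV i j by blast+
  define w where "w i k = (\<Sum>c<Suc p. err init x i c (generation k) * y c k x)" for i k
  have fe: "f i k = e i k x" if "k \<in> gen_set l" "p - 1 \<le> l" for i k l
    using gen_set_ge[OF that] by (simp add: f_def e_def)
  have hw: "h i k = e i k x - w i k" if "i < 2" "k \<in> gen_set l" "p - 1 \<le> l" for i k l
    unfolding h_def w_def generation_eq[OF that(2)] by (rule eps_hat_eq[OF that(2,3,1) x])
  have Wl: "(\<Sum>k\<in>gen_set l. w i k * w j k) = W init x i j l" for i j l
    unfolding W_def w_def by (intro sum.cong refl) (simp add: generation_eq)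
  have Vl: "(\<Sum>k\<in>gen_set l. w i k * e j k x) = V init x i j l" for i j l
    unfolding V_def w_def by (intro sum.cong refl) (simp add: generation_eq)
  have "(\<Sum>k\<in>gen_set l. (h i k - f i k) * (h j k - f j k)) = W init x i j l" if "p \<le> l" for l
    unfolding Wl[symmetric]
    by (intro sum.cong refl) (use that i j in \<open>simp add: fe[of _ l] hw[of _ _ l]\<close>)
  then have 1: "(\<Sum>k\<in>tree_from (n - 1) p. (h i k - f i k) * (h j k - f j k)) = 0 + (\<Sum>l=p..<n. W init x i j l)" if "1 \<le> n" for n
    unfolding sum_tree_from[OF that] by simp
  show "(\<lambda>n. (\<Sum>k\<in>tree_from (n - 1) p. (h i k - f i k) * (h j k - f j k)) / real n) \<longlonglongrightarrow> (real p + 1) * \<Gamma> i j"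
    by (rule Lim_transform_eventually[OF sum_from_mean_tendsto[OF W, of 0 p]])
       (use eventually_ge_at_top[of 1] in \<open>eventually_elim, simp only: 1\<close>)
  \<comment> \<open>The residuals start one generation earlier than the innovations, at
    \<open>p - 1\<close>, where the estimate is \<open>init\<close>; that generation contributes a
    constant, lost after division by \<open>n\<close>.\<close>
  define C where "C = (\<Sum>k\<in>gen_set (p - 1). h i k * h j k)"
  define Q where "Q l = W init x i j l + (-1) * V init x i j l + (-1) * V init x j i l" for l
  have Q: "cmean Q \<longlonglongrightarrow> (real p + 1) * \<Gamma> i j"
  proof -
    have "cmean Q = (\<lambda>n. cmean (W init x i j) n + (-1) * cmean (V init x i j) n + (-1) * cmean (V init x j i) n)"
      unfolding Q_def[abs_def] by (rule ext) (simp only: cmean_add cmean_cmult)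
    moreover have "(\<lambda>n. cmean (W init x i j) n + (-1) * cmean (V init x i j) n + (-1) * cmean (V init x j i) n) \<longlonglongrightarrow> (real p + 1) * \<Gamma> i j + (-1) * 0 + (-1) * 0"
      by (intro tendsto_intros W V)
    ultimately show ?thesis by simp
  qed
  have hh: "(\<Sum>k\<in>gen_set l. h i k * h j k) = (\<Sum>k\<in>gen_set l. f i k * f j k) + Q l" if l: "p - 1 \<le> l" for l
  proof -
    have "(\<Sum>k\<in>gen_set l. h i k * h j k) = (\<Sum>k\<in>gen_set l. f i k * f j k + (w i k * w j k + (-1) * (w i k * e j k x) + (-1) * (w j k * e i k x)))"
      by (intro sum.cong refl) (use l i j in \<open>simp add: fe[of _ l] hw[of _ _ l] algebra_simps\<close>)
    also have "\<dots> = (\<Sum>k\<in>gen_set l. f i k * f j k) + ((\<Sum>k\<in>gen_set l. w i k * w j k) +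
        (-1) * (\<Sum>k\<in>gen_set l. w i k * e j k x) + (-1) * (\<Sum>k\<in>gen_set l. w j k * e i k x))"
      by (simp only: sum.distrib sum_distrib_left)
    finally show ?thesis by (simp only: Wl Vl Q_def)
  qed
  have 2: "(\<Sum>k\<in>tree_from (n - 1) (p - 1). h i k * h j k) - (\<Sum>k\<in>tree_from (n - 1) p. f i k * f j k) = C + (\<Sum>l=p..<n. Q l)" if n: "p \<le> n" for n
  proof -
    have n1: "1 \<le> n" using n p by simp
    have "(\<Sum>l=p-1..<n. \<Sum>k\<in>gen_set l. h i k * h j k) = C + (\<Sum>l=p..<n. \<Sum>k\<in>gen_set l. h i k * h j k)"
      using n p by (subst sum.atLeast_Suc_lessThan) (auto simp: C_def)
    also have "(\<Sum>l=p..<n. \<Sum>k\<in>gen_set l. h i k * h j k) = (\<Sum>l=p..<n. (\<Sum>k\<in>gen_set l. f i k * f j k) + Q l)"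
      by (intro sum.cong refl hh) auto
    finally show ?thesis unfolding sum_tree_from[OF n1] by (simp add: sum.distrib)
  qed
  show "(\<lambda>n. ((\<Sum>k\<in>tree_from (n - 1) (p - 1). h i k * h j k) - (\<Sum>k\<in>tree_from (n - 1) p. f i k * f j k)) / real n) \<longlonglongrightarrow> (real p + 1) * \<Gamma> i j"
    by (rule Lim_transform_eventually[OF sum_from_mean_tendsto[OF Q, of C p]])
       (use eventually_ge_at_top[of p] in \<open>eventually_elim, simp only: 2\<close>)
  have 3: "(\<Sum>k\<in>tree_from (n - 1) p. f i k * f j k) / real (card (tree (n - 1))) = (\<Sum>l=p..<n. 2 ^ l * mean_ee x i j l) / (2 ^ n - 1)" if n: "1 \<le> n" for n
  proof -
    have "real (card (tree (n - 1))) = 2 ^ n - 1" using n by (simp add: card_tree of_nat_diff)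
    moreover have "(\<Sum>l=p..<n. \<Sum>k\<in>gen_set l. f i k * f j k) = (\<Sum>l=p..<n. 2 ^ l * mean_ee x i j l)"
    proof (rule sum.cong)
      fix l assume "l \<in> {p..<n}"
      then have "p - 1 \<le> l" by auto
      then have "(\<Sum>k\<in>gen_set l. f i k * f j k) = (\<Sum>k\<in>gen_set l. e i k x * e j k x)"
        by (intro sum.cong refl) (simp add: fe[of _ l])
      then show "(\<Sum>k\<in>gen_set l. f i k * f j k) = 2 ^ l * mean_ee x i j l" by (simp add: mean_ee_def)
    qed simp
    ultimately show ?thesis unfolding sum_tree_from[OF n] by simp
  qed
  show "(\<lambda>n. (\<Sum>k\<in>tree_from (n - 1) p. f i k * f j k) / real (card (tree (n - 1)))) \<longlonglongrightarrow> \<Gamma> i j"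
    by (rule Lim_transform_eventually[OF sum_from_dyadic_tendsto[OF ee, of p]])
       (use eventually_ge_at_top[of 1] in \<open>eventually_elim, simp only: 3\<close>)
qed

lemma estimator_limits:
  assumes WV: "good x \<and> (\<forall>i<2. \<forall>j<2. cmean (W init x i j) \<longlonglongrightarrow> (real p + 1) * \<Gamma> i j \<and> cmean (V init x i j) \<longlonglongrightarrow> 0)"
  shows "(\<lambda>n. sigma2_hat p init X n x) \<longlonglongrightarrow> v"
    and "(\<lambda>n. 1 / real n * (\<Sum>k\<in>tree_from (n - 1) p.
          (eps_hat p init X (2 * k) x - eps (2 * k) x)\<^sup>2 +
          (eps_hat p init X (2 * k + 1) x - eps (2 * k + 1) x)\<^sup>2)) \<longlonglongrightarrow> 2 * (real p + 1) * v"
    and "(\<lambda>n. real (card (tree n)) / real n * (sigma2_hat p init X n x - sigma2_emp p eps n x)) \<longlonglongrightarrow> 2 * (real p + 1) * v"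
    and "(\<lambda>n. rho_hat p init X n x) \<longlonglongrightarrow> \<rho>"
    and "(\<lambda>n. 1 / real n * (\<Sum>k\<in>tree_from (n - 1) p.
          (eps_hat p init X (2 * k) x - eps (2 * k) x) *
          (eps_hat p init X (2 * k + 1) x - eps (2 * k + 1) x))) \<longlonglongrightarrow> (real p + 1) * \<rho>"
    and "(\<lambda>n. real (card (tree n)) / real n * (rho_hat p init X n x - rho_emp p eps n x)) \<longlonglongrightarrow> 2 * (real p + 1) * \<rho>"
proof -
  note R = residual_products[OF WV]
  note R00 = R[of 0 0, simplified] and R11 = R[of 1 1, simplified] and R01 = R[of 0 1, simplified]
  have Gm: "\<Gamma> 0 0 = v" "\<Gamma> 1 1 = v" "\<Gamma> (Suc 0) (Suc 0) = v" "\<Gamma> 0 1 = \<rho>" "\<Gamma> 0 (Suc 0) = \<rho>" by (simp_all add: \<Gamma>_def)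
  define h where "h i k = eps_hat p init X (2 * k + i) x" for i k
  define f where "f i k = eps (2 * k + i) x" for i k
  define A where "A i j n = (\<Sum>k\<in>tree_from (n - 1) (p - 1). h i k * h j k)" for i j n
  define B where "B i j n = (\<Sum>k\<in>tree_from (n - 1) p. f i k * f j k)" for i j n
  define E where "E i j n = (\<Sum>k\<in>tree_from (n - 1) p. (h i k - f i k) * (h j k - f j k))" for i j n
  define t where "t n = real (card (tree n))" for n
  have RE: "(\<lambda>n. E i j n / real n) \<longlonglongrightarrow> (real p + 1) * \<Gamma> i j"
    and RA: "(\<lambda>n. (A i j n - B i j n) / real n) \<longlonglongrightarrow> (real p + 1) * \<Gamma> i j"
    and RB: "(\<lambda>n. B i j n / t (n - 1)) \<longlonglongrightarrow> \<Gamma> i j" if "i < 2" "j < 2" for i j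
    using R[OF that] unfolding E_def A_def B_def h_def f_def t_def by auto
  have ratio: "(\<lambda>n. t n / t (n - 1)) \<longlonglongrightarrow> 2" unfolding t_def by (rule card_tree_ratio)
  have small: "(\<lambda>n. real n / t n) \<longlonglongrightarrow> 0" unfolding t_def by (rule over_card_tree_tendsto)
  have sh: "sigma2_hat p init X n x = (A 0 0 n + A 1 1 n) / (2 * t (n - 1))"
    and se: "sigma2_emp p eps n x = (B 0 0 n + B 1 1 n) / (2 * t (n - 1))"
    and rh: "rho_hat p init X n x = A 0 1 n / t (n - 1)"
    and re: "rho_emp p eps n x = B 0 1 n / t (n - 1)" for n
    by (simp_all add: sigma2_hat_def sigma2_emp_def rho_hat_def rho_emp_def A_def B_def h_def f_def t_def sum.distrib power2_eq_square)
  have "(\<lambda>n. E 0 0 n / real n + E 1 1 n / real n) \<longlonglongrightarrow> (real p + 1) * \<Gamma> 0 0 + (real p + 1) * \<Gamma> 1 1"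
    by (intro tendsto_add RE) auto
  moreover have "1 / real n * (\<Sum>k\<in>tree_from (n - 1) p.
          (eps_hat p init X (2 * k) x - eps (2 * k) x)\<^sup>2 +
          (eps_hat p init X (2 * k + 1) x - eps (2 * k + 1) x)\<^sup>2) = E 0 0 n / real n + E 1 1 n / real n" for n
    by (simp add: E_def h_def f_def sum.distrib power2_eq_square add_divide_distrib)
  ultimately show "(\<lambda>n. 1 / real n * (\<Sum>k\<in>tree_from (n - 1) p.
          (eps_hat p init X (2 * k) x - eps (2 * k) x)\<^sup>2 +
          (eps_hat p init X (2 * k + 1) x - eps (2 * k + 1) x)\<^sup>2)) \<longlonglongrightarrow> 2 * (real p + 1) * v"
    by (simp add: Gm algebra_simps)
  show "(\<lambda>n. 1 / real n * (\<Sum>k\<in>tree_from (n - 1) p.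
          (eps_hat p init X (2 * k) x - eps (2 * k) x) *
          (eps_hat p init X (2 * k + 1) x - eps (2 * k + 1) x))) \<longlonglongrightarrow> (real p + 1) * \<rho>"
    using RE[of 0 1] unfolding Gm E_def h_def f_def by simp
  \<comment> \<open>The half comes from averaging the two daughters and cancels against the ratio 2
    of the tree sizes, so that the sum of both limits remains.\<close>
  have lim_s: "(\<lambda>n. t n / t (n - 1) / 2 * ((A 0 0 n - B 0 0 n) / real n + (A 1 1 n - B 1 1 n) / real n)) \<longlonglongrightarrow> 2 / 2 * ((real p + 1) * \<Gamma> 0 0 + (real p + 1) * \<Gamma> 1 1)"
    by (intro tendsto_intros RA ratio) auto
  have eq_s: "t n / real n * (sigma2_hat p init X n x - sigma2_emp p eps n x) =
      t n / t (n - 1) / 2 * ((A 0 0 n - B 0 0 n) / real n + (A 1 1 n - B 1 1 n) / real n)" for n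
    unfolding sh se by (simp add: add_divide_distrib diff_divide_distrib algebra_simps)
  have val_s: "2 / 2 * ((real p + 1) * \<Gamma> 0 0 + (real p + 1) * \<Gamma> 1 1) = 2 * (real p + 1) * v"
    unfolding Gm by (simp add: algebra_simps)
  show s: "(\<lambda>n. real (card (tree n)) / real n * (sigma2_hat p init X n x - sigma2_emp p eps n x)) \<longlonglongrightarrow> 2 * (real p + 1) * v"
    unfolding t_def[symmetric] eq_s val_s[symmetric] by (rule lim_s)
  have lim_r: "(\<lambda>n. t n / t (n - 1) * ((A 0 1 n - B 0 1 n) / real n)) \<longlonglongrightarrow> 2 * ((real p + 1) * \<Gamma> 0 1)"
    by (intro tendsto_intros RA ratio) auto
  have eq_r: "t n / real n * (rho_hat p init X n x - rho_emp p eps n x) = t n / t (n - 1) * ((A 0 1 n - B 0 1 n) / real n)" for n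
    unfolding rh re by (simp add: diff_divide_distrib algebra_simps)
  have val_r: "2 * ((real p + 1) * \<Gamma> 0 1) = 2 * (real p + 1) * \<rho>"
    unfolding Gm by (simp add: algebra_simps)
  show r: "(\<lambda>n. real (card (tree n)) / real n * (rho_hat p init X n x - rho_emp p eps n x)) \<longlonglongrightarrow> 2 * (real p + 1) * \<rho>"
    unfolding t_def[symmetric] eq_r val_r[symmetric] by (rule lim_r)
  \<comment> \<open>A difference of order \<open>n / t n\<close> vanishes, so the estimators inherit
    their limits from the empirical quantities of the innovations.\<close>
  have recover: "u \<longlonglongrightarrow> c" if "u' \<longlonglongrightarrow> c" "(\<lambda>n. t n / real n * (u n - u' n)) \<longlonglongrightarrow> b" for u u' :: "nat \<Rightarrow> real" and b c
  proof -
    have "(\<lambda>n. u' n + real n / t n * (t n / real n * (u n - u' n))) \<longlonglongrightarrow> c + 0 * b"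
      by (intro tendsto_add tendsto_mult that small)
    moreover have "\<forall>\<^sub>F n in sequentially. u' n + real n / t n * (t n / real n * (u n - u' n)) = u n"
      using eventually_ge_at_top[of 1]
    proof eventually_elim
      case (elim n)
      have "(1::real) \<le> 2 ^ n" by simp
      then have "(1::real) < 2 * 2 ^ n" by linarith
      then have "0 < t n" by (simp add: t_def card_tree of_nat_diff)
      then show ?case using elim by simp
    qed
    ultimately show ?thesis using Lim_transform_eventually by fastforce
  qed
  have "(\<lambda>n. (B 0 0 n / t (n - 1) + B 1 1 n / t (n - 1)) / 2) \<longlonglongrightarrow> (\<Gamma> 0 0 + \<Gamma> 1 1) / 2"
    by (intro tendsto_intros RB) auto
  then have "(\<lambda>n. sigma2_emp p eps n x) \<longlonglongrightarrow> v" unfolding se by (simp add: Gm add_divide_distrib mult.commute)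
  then show "(\<lambda>n. sigma2_hat p init X n x) \<longlonglongrightarrow> v" by (rule recover) (use s in \<open>simp add: t_def\<close>)
  have "(\<lambda>n. rho_emp p eps n x) \<longlonglongrightarrow> \<rho>" using RB[of 0 1] unfolding re by (simp add: Gm)
  then show "(\<lambda>n. rho_hat p init X n x) \<longlonglongrightarrow> \<rho>" by (rule recover) (use r in \<open>simp add: t_def\<close>)
qed

end

theorem theorem5p3:
  fixes M :: "'a measure" and p :: nat
    and a b :: "nat \<Rightarrow> real" and X eps :: "nat \<Rightarrow> 'a \<Rightarrow> real"
    and N :: "real Matrix.vec \<Rightarrow> real" and init :: "real mat"
    and \<sigma> \<rho> :: real
  assumes M: "prob_space M"
    and p: "p \<ge> 1"
    and X_rv: "\<And>n. n \<ge> 1 \<Longrightarrow> X n \<in> borel_measurable M"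
    and eps_rv: "\<And>n. n \<ge> 2 ^ p \<Longrightarrow> eps n \<in> borel_measurable M"
    and BAR_even: "\<And>n \<omega>. n \<ge> 2 ^ (p - 1) \<Longrightarrow> \<omega> \<in> space M \<Longrightarrow>
        X (2 * n) \<omega> = a 0 + (\<Sum>k=1..p. a k * X (n div 2 ^ (k - 1)) \<omega>) + eps (2 * n) \<omega>"
    and BAR_odd: "\<And>n \<omega>. n \<ge> 2 ^ (p - 1) \<Longrightarrow> \<omega> \<in> space M \<Longrightarrow>
        X (2 * n + 1) \<omega> = b 0 + (\<Sum>k=1..p. b k * X (n div 2 ^ (k - 1)) \<omega>) + eps (2 * n + 1) \<omega>"
    and X_init: "\<And>k. 1 \<le> k \<Longrightarrow> k \<le> 2 ^ p - 1 \<Longrightarrow> integrable M (\<lambda>\<omega>. X k \<omega> ^ 8)"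
    and N: "is_norm p N"
    and contraction: "max (op_norm p N (companion p a)) (op_norm p N (companion p b)) < 1"
    and init: "init \<in> carrier_mat (p + 1) 2"
    and sigma_pos: "\<sigma>\<^sup>2 > 0"
    and rho: "\<bar>\<rho>\<bar> < \<sigma>\<^sup>2"
    and eps_L2: "\<And>n k. n \<ge> p - 1 \<Longrightarrow> k \<in> gen_set (n + 1) \<Longrightarrow> integrable M (\<lambda>\<omega>. (eps k \<omega>)\<^sup>2)"
    and eps_mean: "\<And>n k. n \<ge> p - 1 \<Longrightarrow> k \<in> gen_set (n + 1) \<Longrightarrow>
        AE \<omega> in M. real_cond_exp M (sigma_X M X n) (eps k) \<omega> = 0"
    and eps_var: "\<And>n k. n \<ge> p - 1 \<Longrightarrow> k \<in> gen_set (n + 1) \<Longrightarrow>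
        AE \<omega> in M. real_cond_exp M (sigma_X M X n) (\<lambda>\<omega>. (eps k \<omega>)\<^sup>2) \<omega> = \<sigma>\<^sup>2"
    and eps_cov: "\<And>n k l. n \<ge> p - 1 \<Longrightarrow> k \<in> gen_set (n + 1) \<Longrightarrow> l \<in> gen_set (n + 1) \<Longrightarrow>
        k \<noteq> l \<Longrightarrow> k div 2 = l div 2 \<Longrightarrow>
        AE \<omega> in M. real_cond_exp M (sigma_X M X n) (\<lambda>\<omega>. eps k \<omega> * eps l \<omega>) \<omega> = \<rho>"
    and eps_indep: "\<And>n. n \<ge> p - 1 \<Longrightarrow>
        cond_indep_vars M (sigma_X M X n) borel (siblings eps) (gen_set n)"
    and eps_L4: "\<And>n k. n \<ge> p - 1 \<Longrightarrow> k \<in> gen_set (n + 1) \<Longrightarrow> integrable M (\<lambda>\<omega>. eps k \<omega> ^ 4)"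
    and eps_sup4: "AE \<omega> in M.
        (SUP n\<in>{p - 1..}. SUP k\<in>gen_set (n + 1).
           nn_cond_exp M (sigma_X M X n) (\<lambda>\<omega>. ennreal (eps k \<omega> ^ 4)) \<omega>) < \<infinity>"
  shows
    "(AE \<omega> in M. (\<lambda>n. sigma2_hat p init X n \<omega>) \<longlonglongrightarrow> \<sigma>\<^sup>2) \<and>
     (AE \<omega> in M. (\<lambda>n. 1 / real n * (\<Sum>k\<in>tree_from (n - 1) p.
          (eps_hat p init X (2 * k) \<omega> - eps (2 * k) \<omega>)\<^sup>2 +
          (eps_hat p init X (2 * k + 1) \<omega> - eps (2 * k + 1) \<omega>)\<^sup>2))
        \<longlonglongrightarrow> 2 * (real p + 1) * \<sigma>\<^sup>2) \<and>
     (AE \<omega> in M. (\<lambda>n. real (card (tree n)) / real n *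
          (sigma2_hat p init X n \<omega> - sigma2_emp p eps n \<omega>))
        \<longlonglongrightarrow> 2 * (real p + 1) * \<sigma>\<^sup>2) \<and>
     (AE \<omega> in M. (\<lambda>n. rho_hat p init X n \<omega>) \<longlonglongrightarrow> \<rho>) \<and>
     (AE \<omega> in M. (\<lambda>n. 1 / real n * (\<Sum>k\<in>tree_from (n - 1) p.
          (eps_hat p init X (2 * k) \<omega> - eps (2 * k) \<omega>) *
          (eps_hat p init X (2 * k + 1) \<omega> - eps (2 * k + 1) \<omega>)))
        \<longlonglongrightarrow> (real p + 1) * \<rho>) \<and>
     (AE \<omega> in M. (\<lambda>n. real (card (tree n)) / real n *
          (rho_hat p init X n \<omega> - rho_emp p eps n \<omega>))
        \<longlonglongrightarrow> 2 * (real p + 1) * \<rho>)"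
proof -
  interpret M: prob_space M by (rule M)
  have X2: "integrable M (\<lambda>\<omega>. (X k \<omega>)\<^sup>2)" if k: "1 \<le> k" "k \<le> 2 ^ p - 1" for k
  proof (rule Bochner_Integration.integrable_bound)
    show "integrable M (\<lambda>\<omega>. 1 + X k \<omega> ^ 8)" using X_init[OF k] by simp
    have "(s::real)\<^sup>2 \<le> 1 + s ^ 8" for s
    proof (cases "\<bar>s\<bar> \<le> 1")
      case True
      then have "s\<^sup>2 \<le> 1" by (simp add: abs_square_le_1)
      moreover have "0 \<le> s ^ 8" by simp
      ultimately show ?thesis by linarith
    next
      case False
      then have "\<bar>s\<bar> ^ 2 \<le> \<bar>s\<bar> ^ 8" by (intro power_increasing) auto
      then show ?thesis by simp
    qed
    then show "AE \<omega> in M. norm ((X k \<omega>)\<^sup>2) \<le> norm (1 + X k \<omega> ^ 8)" by (auto simp: add_nonneg_nonneg)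
    show "(\<lambda>\<omega>. (X k \<omega>)\<^sup>2) \<in> borel_measurable M" using X_rv[OF k(1)] by simp
  qed
  interpret B: bar_process M p a b X eps "\<sigma>\<^sup>2" \<rho>
  proof
    show "\<exists>N. is_norm p N \<and> max (op_norm p N (companion p a)) (op_norm p N (companion p b)) < 1"
      using N contraction by blast
  qed (fact p X_rv eps_rv BAR_even BAR_odd X2 sigma_pos eps_L2 eps_mean eps_var eps_cov eps_indep eps_L4 eps_sup4)+
  note WV = B.AE_W_V[of init]
  show ?thesis
    by (intro conjI; rule eventually_mono[OF WV]; erule B.estimator_limits)
qed

end
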